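(* Let $n,r\in\mathbb N$ with $r<n$. The bipartite strategy with $5$ inputs for the first party, $4$ inputs for the second party, and $2$ outputs per input, $$\mathcal S_{n,r}=\Big(|\phi_n\rangle;\ (\mathfrak P^{(n)}_i,I-\mathfrak P^{(n)}_i)_{i=1}^4,\ (\mathfrak Q^{(n,r)},I-\mathfrak Q^{(n,r)});\ (\mathfrak P^{(n)}_i,I-\mathfrak P^{(n)}_i)_{i=1}^4\Big),$$ is self-tested by its correlation.
   Context: A bipartite strategy $\mathcal S=(|\psi\rangle;\mathcal M_1,\dots,\mathcal M_{N_A};\mathcal N_1,\dots,\mathcal N_{N_B})$ consists of finite-dimensional Hilbert spaces $\mathcal H_A,\mathcal H_B$, a unit vector $|\psi\rangle\in\mathcal H_A\otimes\mathcal H_B$, POVMs $\mathcal M_i=(\mathcal M_{i,a})_a$ on $\mathcal H_A$ and POVMs $\mathcal N_j=(\mathcal N_{j,b})_b$ on $\mathcal H_B$ (tuples of positive semidefinite operators summing to $I$). Its correlation is $p(a,b|i,j)=\langle\psi|\mathcal M_{i,a}\otimes\mathcal N_{j,b}|\psi\rangle$. A strategy $\widetilde{\mathcal S}=(|\widetilde\psi\rangle;\widetilde{\mathcal M};\widetilde{\mathcal N})$ on $\widetilde{\mathcal H}_A\otimes\widetilde{\mathcal H}_B$ (with the same numbers of inputs and outputs) is a local dilation of $\mathcal S$ if there exist finite-dimensional Hilbert spaces $\mathcal K_A,\mathcal K_B$, a state $|\mathrm{aux}\rangle\in\mathcal K_A\otimes\mathcal K_B$ and isometries $U_A:\mathcal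 H_A\to\widetilde{\mathcal H}_A\otimes\mathcal K_A$, $U_B:\mathcal H_B\to\widetilde{\mathcal H}_B\otimes\mathcal K_B$ with $(U_A\otimes U_B)(\mathcal M_{i,a}\otimes\mathcal N_{j,b})|\psi\rangle=(\widetilde{\mathcal M}_{i,a}\otimes\widetilde{\mathcal N}_{j,b})|\widetilde\psi\rangle\otimes|\mathrm{aux}\rangle$ for all $i,j,a,b$. $\widetilde{\mathcal S}$ is self-tested by its correlation if it is a local dilation of every strategy with the same numbers of inputs and outputs and the same correlation. $|\phi_n\rangle=\frac1{\sqrt n}\sum_{i=1}^n|i\rangle|i\rangle$. For an invertible Hermitian $X$, $\operatorname{sgn}(X)$ is the unique Hermitian unitary commuting with $X$ with $\operatorname{sgn}(X)X$ positive definite. For $n\in\mathbb N$, $\mathfrak P^{(n)}_1,\dots,\mathfrak P^{(n)}_4\in M_n(\mathbb R)$ denote orthogonal projections (real symmetric idempotent matrices) such that (i) $\mathfrak P^{(n)}_1+\dots+\mathfrak P^{(n)}_4=(2-\frac1n)I_n$; (ii) $\operatorname{rk}\mathfrak P^{(n)}_1=\lfloor\frac n2\rfloor-(-1)^n$ and $\operatorname{rk}\mathfrak P^{(n)}_i=\lfloor\frac n2\rfloor$ for $i=2,3,4$; (iii) the only subspaces of $\mathbb C^n$ invariant under all four matrices are $0$ and $\mathbb C^n$. Such quadruples exist for every $n$, and any two of them are simultaneously unitarily equivalent. For $0\le r\le n$, $\mathfrak Q^{(n,r)}:=\frac12\big(I+\operatorname{sgn}((2r-\frac12)I-n(\mathfrak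 P^{(n)}_3+\mathfrak P^{(n)}_4))\big)$, a real orthogonal projection of rank $r$. *)

theory Defs
  imports "Jordan_Normal_Form.Matrix" "Jordan_Normal_Form.DL_Rank"
begin

text \<open>A finite-dimensional Hilbert space is modelled as C^d (JNF vectors of
 dimension d); operators are d x d complex matrices.\<close>

definition cinner :: "complex vec \<Rightarrow> complex vec \<Rightarrow> complex" where
  "cinner u v = (\<Sum>k<dim_vec v. cnj (u $ k) * v $ k)"

definition unit_vec_c :: "nat \<Rightarrow> complex vec \<Rightarrow> bool" where
  "unit_vec_c d v \<longleftrightarrow> v \<in> carrier_vec d \<and> cinner v v = 1"

definition adj :: "complex mat \<Rightarrow> complex mat" where
  "adj A = mat (dim_col A) (dim_row A) (\<lambda>(i,j). cnj (A $$ (j,i)))"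

definition kron :: "complex mat \<Rightarrow> complex mat \<Rightarrow> complex mat" where
  "kron A B = mat (dim_row A * dim_row B) (dim_col A * dim_col B)
     (\<lambda>(i,j). A $$ (i div dim_row B, j div dim_col B) * B $$ (i mod dim_row B, j mod dim_col B))"

definition psd :: "nat \<Rightarrow> complex mat \<Rightarrow> bool" where
  "psd d A \<longleftrightarrow> A \<in> carrier_mat d d \<and>
     (\<forall>v\<in>carrier_vec d. Im (cinner v (A *\<^sub>v v)) = 0 \<and> Re (cinner v (A *\<^sub>v v)) \<ge> 0)"

definition posdef :: "nat \<Rightarrow> complex mat \<Rightarrow> bool" where
  "posdef d A \<longleftrightarrow> A \<in> carrier_mat d d \<and>
     (\<forall>v\<in>carrier_vec d. v \<noteq> 0\<^sub>v d \<longrightarrow> Im (cinner v (A *\<^sub>v v)) = 0 \<and> Re (cinner v (A *\<^sub>v v)) > 0)"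

definition isometry :: "nat \<Rightarrow> nat \<Rightarrow> complex mat \<Rightarrow> bool" where
  "isometry m d U \<longleftrightarrow> U \<in> carrier_mat m d \<and> adj U * U = 1\<^sub>m d"

definition povm :: "nat \<Rightarrow> nat \<Rightarrow> (nat \<Rightarrow> complex mat) \<Rightarrow> bool" where
  "povm d m E \<longleftrightarrow> (\<forall>a<m. psd d (E a)) \<and>
     (\<forall>i<d. \<forall>j<d. (\<Sum>a<m. E a $$ (i,j)) = (if i = j then 1 else 0))"

definition strategy :: "nat \<Rightarrow> nat \<Rightarrow> complex vec \<Rightarrow>
    nat \<Rightarrow> (nat \<Rightarrow> nat) \<Rightarrow> (nat \<Rightarrow> nat \<Rightarrow> complex mat) \<Rightarrow>
    nat \<Rightarrow> (nat \<Rightarrow> nat) \<Rightarrow> (nat \<Rightarrow> nat \<Rightarrow> complex mat) \<Rightarrow> bool" where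
  "strategy dA dB psi NA oA M NB oB N \<longleftrightarrow>
     unit_vec_c (dA * dB) psi \<and>
     (\<forall>i<NA. povm dA (oA i) (M i)) \<and> (\<forall>j<NB. povm dB (oB j) (N j))"

definition corr :: "complex vec \<Rightarrow> (nat \<Rightarrow> nat \<Rightarrow> complex mat) \<Rightarrow> (nat \<Rightarrow> nat \<Rightarrow> complex mat)
    \<Rightarrow> nat \<Rightarrow> nat \<Rightarrow> nat \<Rightarrow> nat \<Rightarrow> complex" where
  "corr psi M N a b i j = cinner psi (kron (M i a) (N j b) *\<^sub>v psi)"

text \<open>The strategy (psi', M', N') on C^dA' (x) C^dB' is a local dilation of
  (psi, M, N) on C^dA (x) C^dB.  The isometry U_A maps C^dA into C^dA' (x) K_A
  with K_A = C^kA (index x*kA+k), similarly U_B.  The identity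
  (U_A (x) U_B)(M (x) N) psi = ((M' (x) N') psi') (x) aux
  is written componentwise, which makes the canonical identification
  (H'_A (x) K_A) (x) (H'_B (x) K_B) = (H'_A (x) H'_B) (x) (K_A (x) K_B) explicit.\<close>
definition local_dilation :: "nat \<Rightarrow> nat \<Rightarrow> complex vec \<Rightarrow>
    (nat \<Rightarrow> nat \<Rightarrow> complex mat) \<Rightarrow> (nat \<Rightarrow> nat \<Rightarrow> complex mat) \<Rightarrow>
    nat \<Rightarrow> (nat \<Rightarrow> nat) \<Rightarrow> nat \<Rightarrow> (nat \<Rightarrow> nat) \<Rightarrow>
    nat \<Rightarrow> nat \<Rightarrow> complex vec \<Rightarrow>
    (nat \<Rightarrow> nat \<Rightarrow> complex mat) \<Rightarrow> (nat \<Rightarrow> nat \<Rightarrow> complex mat) \<Rightarrow> bool" where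
  "local_dilation dA' dB' psi' M' N' NA oA NB oB dA dB psi M N \<longleftrightarrow>
    (\<exists>kA kB aux UA UB.
       unit_vec_c (kA * kB) aux \<and>
       isometry (dA' * kA) dA UA \<and> isometry (dB' * kB) dB UB \<and>
       (\<forall>i<NA. \<forall>j<NB. \<forall>a<oA i. \<forall>b<oB j.
          (let w = kron UA UB *\<^sub>v (kron (M i a) (N j b) *\<^sub>v psi);
               v = kron (M' i a) (N' j b) *\<^sub>v psi'
           in \<forall>x<dA'. \<forall>k<kA. \<forall>y<dB'. \<forall>l<kB.
                w $ ((x * kA + k) * (dB' * kB) + (y * kB + l))
                  = v $ (x * dB' + y) * aux $ (k * kB + l))))"

definition self_tested :: "nat \<Rightarrow> nat \<Rightarrow> complex vec \<Rightarrow>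
    nat \<Rightarrow> (nat \<Rightarrow> nat) \<Rightarrow> (nat \<Rightarrow> nat \<Rightarrow> complex mat) \<Rightarrow>
    nat \<Rightarrow> (nat \<Rightarrow> nat) \<Rightarrow> (nat \<Rightarrow> nat \<Rightarrow> complex mat) \<Rightarrow> bool" where
  "self_tested dA' dB' psi' NA oA M' NB oB N' \<longleftrightarrow>
     strategy dA' dB' psi' NA oA M' NB oB N' \<and>
     (\<forall>dA dB psi M N.
        strategy dA dB psi NA oA M NB oB N \<and>
        (\<forall>i<NA. \<forall>j<NB. \<forall>a<oA i. \<forall>b<oB j. corr psi M N a b i j = corr psi' M' N' a b i j)
        \<longrightarrow> local_dilation dA' dB' psi' M' N' NA oA NB oB dA dB psi M N)"

definition phi :: "nat \<Rightarrow> complex vec" where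
  "phi n = vec (n * n) (\<lambda>k. if k div n = k mod n then complex_of_real (1 / sqrt (real n)) else 0)"

definition cplx :: "real mat \<Rightarrow> complex mat" where
  "cplx A = map_mat complex_of_real A"

text \<open>sgn of an invertible Hermitian matrix: the unique Hermitian unitary
  commuting with X such that sgn(X) X is positive definite.\<close>
definition msgn :: "complex mat \<Rightarrow> complex mat" where
  "msgn X = (THE S. S \<in> carrier_mat (dim_row X) (dim_row X) \<and> adj S = S \<and>
      S * S = 1\<^sub>m (dim_row X) \<and> S * X = X * S \<and> posdef (dim_row X) (S * X))"

definition real_orth_proj :: "nat \<Rightarrow> real mat \<Rightarrow> bool" where
  "real_orth_proj n P \<longleftrightarrow> P \<in> carrier_mat n n \<and> transpose_mat P = P \<and> P * P = P"

definition csubspace :: "nat \<Rightarrow> complex vec set \<Rightarrow> bool" where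
  "csubspace n W \<longleftrightarrow> W \<subseteq> carrier_vec n \<and> 0\<^sub>v n \<in> W \<and>
     (\<forall>u\<in>W. \<forall>v\<in>W. u + v \<in> W) \<and> (\<forall>c. \<forall>v\<in>W. c \<cdot>\<^sub>v v \<in> W)"

definition frakP_quad :: "nat \<Rightarrow> (nat \<Rightarrow> real mat) \<Rightarrow> bool" where
  "frakP_quad n P \<longleftrightarrow>
     (\<forall>i\<in>{1..4}. real_orth_proj n (P i)) \<and>
     P 1 + P 2 + P 3 + P 4 = (2 - 1 / real n) \<cdot>\<^sub>m 1\<^sub>m n \<and>
     int (vec_space.rank n (P 1)) = int (n div 2) - (-1) ^ n \<and>
     (\<forall>i\<in>{2..4}. vec_space.rank n (P i) = n div 2) \<and>
     (\<forall>W. csubspace n W \<and> (\<forall>i\<in>{1..4}. \<forall>v\<in>W. cplx (P i) *\<^sub>v v \<in> W)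
          \<longrightarrow> W = {0\<^sub>v n} \<or> W = carrier_vec n)"

definition frakQ :: "nat \<Rightarrow> nat \<Rightarrow> (nat \<Rightarrow> real mat) \<Rightarrow> complex mat" where
  "frakQ n r P = (1/2 :: complex) \<cdot>\<^sub>m (1\<^sub>m n +
      msgn ((complex_of_real (2 * real r - 1/2)) \<cdot>\<^sub>m 1\<^sub>m n
            - (complex_of_real (real n)) \<cdot>\<^sub>m (cplx (P 3) + cplx (P 4))))"

definition binmeas :: "nat \<Rightarrow> complex mat \<Rightarrow> nat \<Rightarrow> complex mat" where
  "binmeas n E a = (if a = 0 then E else 1\<^sub>m n - E)"

definition stratA :: "nat \<Rightarrow> nat \<Rightarrow> (nat \<Rightarrow> real mat) \<Rightarrow> nat \<Rightarrow> nat \<Rightarrow> complex mat" where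
  "stratA n r P i = (if i < 4 then binmeas n (cplx (P (i + 1))) else binmeas n (frakQ n r P))"

definition stratB :: "nat \<Rightarrow> (nat \<Rightarrow> real mat) \<Rightarrow> nat \<Rightarrow> nat \<Rightarrow> complex mat" where
  "stratB n P j = binmeas n (cplx (P (j + 1)))"

end

theory Submission
  imports Defs
begin

text \<open>
  Write the state of a strategy as a matrix \<open>\<Psi>\<close>, so that \<open>A \<otimes> B\<close> acts by \<open>\<Psi> \<mapsto> A \<Psi> B\<^sup>T\<close>.  Equality of
  correlations forces \<open>M\<^sub>i \<Psi> = \<Psi> N\<^sub>i\<^sup>T\<close>, \<open>M\<^sub>i\<^sup>2 \<Psi> = M\<^sub>i \<Psi>\<close> and \<open>\<Sum>\<^sub>i M\<^sub>i \<Psi> = (2 - 1/n) \<Psi>\<close>; hence on the support of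
  \<open>\<Psi>\<close> the \<open>M\<^sub>i\<close> are projections with sum \<open>2 - 1/n\<close> which commute with the reduced state.

  Put \<open>S = M\<^sub>1 + M\<^sub>2 - 1\<close>, \<open>D = M\<^sub>1 - M\<^sub>2\<close>, \<open>D' = M\<^sub>3 - M\<^sub>4\<close>.  Then \<open>D\<close> anticommutes with \<open>S\<close>, \<open>D'\<close> anticommutes with
  \<open>S + 1/n\<close>, and \<open>D\<^sup>2 = 1 - S\<^sup>2\<close>, \<open>D'\<^sup>2 = 1 - (S + 1/n)\<^sup>2\<close>.  Alternating \<open>D'\<close> and \<open>D\<close> carries \<open>ker S\<close> isometrically onto
  \<open>n\<close> mutually orthogonal eigenspaces of \<open>S\<close>, so \<open>\<tau>(ker S) \<le> 1/n\<close> for the tracial state \<open>\<tau>\<close>.  On the other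
  hand \<open>D\<close> has trace zero off \<open>ker S\<close>, so \<open>\<tau>(D) = \<plusminus>1/n\<close> (the rank condition) gives \<open>\<tau>(ker S) \<ge> 1/n\<close>.
  Equality means that \<open>D = \<plusminus>1\<close> on \<open>ker S\<close> and that the chain exhausts the support, which determines the
  quadruple up to multiplicity.

  Finally the fifth projection is the positive spectral projection of an invertible affine combination
  \<open>X\<close> of \<open>P\<^sub>3\<close> and \<open>P\<^sub>4\<close>, hence the unique effect \<open>F\<close> maximising \<open>\<tau>(F X)\<close>, a number which the correlation
  determines.
\<close>

section \<open>Finitely supported matrices\<close>

text \<open>A correlation never contains a product of two operators of the same party, so
  \<open>M i * M j * Psi\<close> is not directly observable. What it does fix are the inner products
  of the vectors \<open>M i * Psi\<close> with the vectors \<open>Psi * R j\<close>, where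
  \<open>R j\<close> is the transposed effect of the other party. An effect satisfies
  \<open>F^2 <= F\<close>, hence neither family is longer than its reference counterpart, and this
  forces the distance between \<open>M i * Psi\<close> and \<open>Psi * R i\<close> to be zero. From
  then on a second factor can be moved to the other party, and squared norms become combinations of
  correlations.

  The reduced state need not be maximally mixed, as ker \<open>S\<close> may carry any state.
  \<open>tau\<close> behaves as a trace because the operators built from the \<open>M i\<close>
  commute with that state.

  The reference quadruple satisfies the same locale assumptions as an arbitrary strategy, so both
  have the same matrix coefficients along their chains, and the isometries only match one chain with
  the other. The multiplicity space is ker \<open>S\<close>, and the auxiliary state is the part of
  \<open>Psi\<close> lying over it.\<close>

text \<open>Operators between spaces of different dimensions are kept in one type of infinite matrices with
  finite support.  It is a ring, so no carrier conditions arise in algebraic computations; the price is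
  that the identity of \<open>C^d\<close> is a projection \<open>idm d\<close> and there is no global unit.\<close>

typedef fmat = "{f :: nat \<Rightarrow> nat \<Rightarrow> complex. \<exists>d. \<forall>i j. d \<le> i \<or> d \<le> j \<longrightarrow> f i j = 0}"
  morphisms ent Abs_fmat
  by auto

setup_lifting type_definition_fmat

lemma fmat_eqI: "(\<And>i j. ent A i j = ent B i j) \<Longrightarrow> A = B"
  by (metis ent_inject ext)

definition sized :: "nat \<Rightarrow> nat \<Rightarrow> fmat \<Rightarrow> bool" where
  "sized m n A \<longleftrightarrow> (\<forall>i j. m \<le> i \<or> n \<le> j \<longrightarrow> ent A i j = 0)"

lemma sized_ex: "\<exists>d. \<forall>d'\<ge>d. sized d' d' A"
  using ent[of A] unfolding sized_def by (auto) (meson le_trans)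

lemma sized_ex3: "\<exists>d. sized d d A \<and> sized d d B \<and> sized d d C"
proof -
  obtain a b c where "\<forall>d'\<ge>a. sized d' d' A" "\<forall>d'\<ge>b. sized d' d' B" "\<forall>d'\<ge>c. sized d' d' C"
    using sized_ex by metis
  then show ?thesis by (intro exI[of _ "max a (max b c)"]) auto
qed

lemma sized_ex2: "\<exists>d. sized d d A \<and> sized d d B"
  using sized_ex3 by blast

lemma sized_ent: "sized m n A \<Longrightarrow> \<not> (i < m \<and> j < n) \<Longrightarrow> ent A i j = 0"
  unfolding sized_def by auto

lemma sum_restrict_zero:
  fixes f :: "nat \<Rightarrow> complex"
  assumes "\<And>k. k \<ge> d \<Longrightarrow> f k = 0"
  shows "(\<Sum>k | f k \<noteq> 0. f k) = (\<Sum>k<d. f k)"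
proof (rule sum.mono_neutral_left)
  show "{k. f k \<noteq> 0} \<subseteq> {..<d}"
    using assms by (auto simp: not_less[symmetric])
qed auto

instantiation fmat :: real_algebra
begin

lift_definition zero_fmat :: fmat is "\<lambda>i j. 0" by auto

lift_definition plus_fmat :: "fmat \<Rightarrow> fmat \<Rightarrow> fmat" is "\<lambda>f g i j. f i j + g i j"
proof -
  fix f g :: "nat \<Rightarrow> nat \<Rightarrow> complex"
  assume "\<exists>d. \<forall>i j. d \<le> i \<or> d \<le> j \<longrightarrow> f i j = 0" "\<exists>d. \<forall>i j. d \<le> i \<or> d \<le> j \<longrightarrow> g i j = 0"
  then obtain d1 d2 where "\<forall>i j. d1 \<le> i \<or> d1 \<le> j \<longrightarrow> f i j = 0" "\<forall>i j. d2 \<le> i \<or> d2 \<le> j \<longrightarrow> g i j = 0"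
    by blast
  then show "\<exists>d. \<forall>i j. d \<le> i \<or> d \<le> j \<longrightarrow> f i j + g i j = 0"
    by (intro exI[of _ "max d1 d2"]) auto
qed

lift_definition uminus_fmat :: "fmat \<Rightarrow> fmat" is "\<lambda>f i j. - f i j" by auto

lift_definition scaleR_fmat :: "real \<Rightarrow> fmat \<Rightarrow> fmat" is "\<lambda>c f i j. of_real c * f i j" by auto

lift_definition minus_fmat :: "fmat \<Rightarrow> fmat \<Rightarrow> fmat" is "\<lambda>f g i j. f i j - g i j"
proof -
  fix f g :: "nat \<Rightarrow> nat \<Rightarrow> complex"
  assume "\<exists>d. \<forall>i j. d \<le> i \<or> d \<le> j \<longrightarrow> f i j = 0" "\<exists>d. \<forall>i j. d \<le> i \<or> d \<le> j \<longrightarrow> g i j = 0"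
  then obtain d1 d2 where "\<forall>i j. d1 \<le> i \<or> d1 \<le> j \<longrightarrow> f i j = 0" "\<forall>i j. d2 \<le> i \<or> d2 \<le> j \<longrightarrow> g i j = 0"
    by blast
  then show "\<exists>d. \<forall>i j. d \<le> i \<or> d \<le> j \<longrightarrow> f i j - g i j = 0"
    by (intro exI[of _ "max d1 d2"]) auto
qed

text \<open>Summing over the indices of nonzero terms avoids choosing a common dimension for the
  factors; \<open>ent_times_gen\<close> recovers the ordinary sum.\<close>

lift_definition times_fmat :: "fmat \<Rightarrow> fmat \<Rightarrow> fmat" is
  "\<lambda>f g i j. \<Sum>k | f i k * g k j \<noteq> 0. f i k * g k j"
proof -
  fix f g :: "nat \<Rightarrow> nat \<Rightarrow> complex"
  assume "\<exists>d. \<forall>i j. d \<le> i \<or> d \<le> j \<longrightarrow> f i j = 0" "\<exists>d. \<forall>i j. d \<le> i \<or> d \<le> j \<longrightarrow> g i j = 0"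
  then obtain d1 d2 where d: "\<forall>i j. d1 \<le> i \<or> d1 \<le> j \<longrightarrow> f i j = 0" "\<forall>i j. d2 \<le> i \<or> d2 \<le> j \<longrightarrow> g i j = 0"
    by blast
  have "(\<Sum>k | f i k * g k j \<noteq> 0. f i k * g k j) = 0" if "max d1 d2 \<le> i \<or> max d1 d2 \<le> j" for i j
  proof -
    have "{k. f i k * g k j \<noteq> 0} = {}" using d that by auto
    then show ?thesis by simp
  qed
  then show "\<exists>d. \<forall>i j. d \<le> i \<or> d \<le> j \<longrightarrow> (\<Sum>k | f i k * g k j \<noteq> 0. f i k * g k j) = 0"
    by blast
qed

lemma ent_times_gen:
  assumes "\<And>i k. d \<le> k \<Longrightarrow> ent A i k = 0 \<or> ent B k j = 0"
  shows "ent (A * B) i j = (\<Sum>k<d. ent A i k * ent B k j)"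
  unfolding times_fmat.rep_eq by (rule sum_restrict_zero) (use assms in auto)

instance
proof
  fix A B C :: fmat and a b :: real
  show "(A * B) * C = A * (B * C)"
  proof (rule fmat_eqI)
    fix i j
    obtain d where d: "sized d d A" "sized d d B" "sized d d C"
      using sized_ex3 by blast
    have "ent ((A * B) * C) i j = (\<Sum>k<d. (\<Sum>l<d. ent A i l * ent B l k) * ent C k j)"
      by (subst ent_times_gen[of d]) (use d in \<open>auto simp: sized_def ent_times_gen[of d]\<close>)
    also have "\<dots> = (\<Sum>l<d. \<Sum>k<d. ent A i l * ent B l k * ent C k j)"
      unfolding sum_distrib_right by (rule sum.swap)
    also have "\<dots> = (\<Sum>l<d. ent A i l * (\<Sum>k<d. ent B l k * ent C k j))"
      by (simp add: sum_distrib_left mult.assoc)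
    also have "\<dots> = ent (A * (B * C)) i j"
      by (subst ent_times_gen[of d]) (use d in \<open>auto simp: sized_def ent_times_gen[of d]\<close>)
    finally show "ent ((A * B) * C) i j = ent (A * (B * C)) i j" .
  qed
  show "A + B + C = A + (B + C)" by transfer (simp add: add.assoc)
  show "A + B = B + A" by transfer (simp add: add.commute)
  show "0 + A = A" by transfer simp
  show "- A + A = 0" by transfer simp
  show "A - B = A + - B" by transfer simp
  show "(A + B) * C = A * C + B * C"
  proof (rule fmat_eqI)
    fix i j
    obtain d where d: "sized d d A" "sized d d B" "sized d d C"
      using sized_ex3 by blast
    then show "ent ((A + B) * C) i j = ent (A * C + B * C) i j"
      by (auto simp: sized_def ent_times_gen[of d] plus_fmat.rep_eq sum.distrib algebra_simps)
  qed
  show "A * (B + C) = A * B + A * C"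
  proof (rule fmat_eqI)
    fix i j
    obtain d where d: "sized d d A" "sized d d B" "sized d d C"
      using sized_ex3 by blast
    then show "ent (A * (B + C)) i j = ent (A * B + A * C) i j"
      by (auto simp: sized_def ent_times_gen[of d] plus_fmat.rep_eq sum.distrib algebra_simps)
  qed
  show "a *\<^sub>R (A + B) = a *\<^sub>R A + a *\<^sub>R B" by transfer (simp add: algebra_simps)
  show "(a + b) *\<^sub>R A = a *\<^sub>R A + b *\<^sub>R A" by transfer (simp add: algebra_simps)
  show "a *\<^sub>R b *\<^sub>R A = (a * b) *\<^sub>R A" by transfer (simp add: algebra_simps)
  show "1 *\<^sub>R A = A" by transfer simp
  show "a *\<^sub>R A * B = a *\<^sub>R (A * B)"
  proof (rule fmat_eqI)
    fix i j
    obtain d where d: "sized d d A" "sized d d B"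
      using sized_ex2 by blast
    then show "ent (a *\<^sub>R A * B) i j = ent (a *\<^sub>R (A * B)) i j"
      by (auto simp: sized_def ent_times_gen[of d] scaleR_fmat.rep_eq sum_distrib_left algebra_simps)
  qed
  show "A * a *\<^sub>R B = a *\<^sub>R (A * B)"
  proof (rule fmat_eqI)
    fix i j
    obtain d where d: "sized d d A" "sized d d B"
      using sized_ex2 by blast
    then show "ent (A * a *\<^sub>R B) i j = ent (a *\<^sub>R (A * B)) i j"
      by (auto simp: sized_def ent_times_gen[of d] scaleR_fmat.rep_eq sum_distrib_left algebra_simps)
  qed
qed

end

lemmas ent_simps = zero_fmat.rep_eq plus_fmat.rep_eq uminus_fmat.rep_eq scaleR_fmat.rep_eq minus_fmat.rep_eq

lemma ent_sum: "ent (sum f I) i j = (\<Sum>k\<in>I. ent (f k) i j)"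
  by (induction I rule: infinite_finite_induct) (auto simp: ent_simps)

lemma ent_times:
  assumes "sized m d A \<or> sized d m B"
  shows "ent (A * B) i j = (\<Sum>k<d. ent A i k * ent B k j)"
  by (rule ent_times_gen) (use assms in \<open>auto simp: sized_def\<close>)

lemma sized_ops:
  "sized m n 0" "sized m n A \<Longrightarrow> sized m n B \<Longrightarrow> sized m n (A + B)"
  "sized m n A \<Longrightarrow> sized m n B \<Longrightarrow> sized m n (A - B)"
  "sized m n A \<Longrightarrow> sized m n (c *\<^sub>R A)"
  by (auto simp: sized_def ent_simps)

lemma sized_sum: "(\<And>k. k \<in> I \<Longrightarrow> sized m n (f k)) \<Longrightarrow> sized m n (sum f I)"
  by (auto simp: sized_def ent_sum)

lemma sized_times: "sized m k A \<Longrightarrow> sized l n B \<Longrightarrow> sized m n (A * B)"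
  by (auto simp: sized_def times_fmat.rep_eq)

lift_definition star :: "fmat \<Rightarrow> fmat" is "\<lambda>f i j. cnj (f j i)" by auto

lift_definition scaleC :: "complex \<Rightarrow> fmat \<Rightarrow> fmat" is "\<lambda>c f i j. c * f i j" by auto

lift_definition fmat_of :: "nat \<Rightarrow> nat \<Rightarrow> (nat \<Rightarrow> nat \<Rightarrow> complex) \<Rightarrow> fmat"
  is "\<lambda>m n f i j. if i < m \<and> j < n then f i j else 0"
proof -
  fix m n :: nat and f :: "nat \<Rightarrow> nat \<Rightarrow> complex"
  show "\<exists>d. \<forall>i j. d \<le> i \<or> d \<le> j \<longrightarrow> (if i < m \<and> j < n then f i j else 0) = 0"
    by (intro exI[of _ "max m n"]) auto
qed

definition idm :: "nat \<Rightarrow> fmat" where "idm d = fmat_of d d (\<lambda>i j. if i = j then 1 else 0)"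

lemma sized_fmat_of[simp]: "sized m n (fmat_of m n f)" by (auto simp: sized_def fmat_of.rep_eq)
lemma sized_idm[simp]: "sized d d (idm d)" by (simp add: idm_def)

lemma sized_star: "sized m n A \<Longrightarrow> sized n m (star A)" by (auto simp: sized_def star.rep_eq)

lemma sized_scaleC: "sized m n A \<Longrightarrow> sized m n (scaleC c A)" by (auto simp: sized_def scaleC.rep_eq)

lemma star_star[simp]: "star (star A) = A" by transfer simp
lemma star_zero[simp]: "star 0 = 0" by transfer simp
lemma star_add: "star (A + B) = star A + star B" by transfer simp
lemma star_diff: "star (A - B) = star A - star B"
  by (rule fmat_eqI) (simp add: ent_simps star.rep_eq)
lemma star_uminus: "star (- A) = - star A" by transfer simp
lemma star_scaleR: "star (c *\<^sub>R A) = c *\<^sub>R star A" by transfer simp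
lemma star_scaleC: "star (scaleC c A) = scaleC (cnj c) (star A)" by transfer simp
lemma star_sum: "star (sum f I) = (\<Sum>k\<in>I. star (f k))"
  by (induction I rule: infinite_finite_induct) (auto simp: star_add)

lemma star_times: "star (A * B) = star B * star A"
proof (rule fmat_eqI)
  fix i j
  obtain d where "sized d d A" "sized d d B" using sized_ex2 by blast
  then show "ent (star (A * B)) i j = ent (star B * star A) i j"
    by (simp add: ent_times[of d d] sized_star star.rep_eq mult.commute)
qed

lemmas star_simps = star_add star_diff star_uminus star_scaleR star_sum star_times

lemma star_idm[simp]: "star (idm d) = idm d"
  by (rule fmat_eqI) (auto simp: idm_def star.rep_eq fmat_of.rep_eq)

lemma star_inject: "star A = star B \<longleftrightarrow> A = B" by (metis star_star)
lemma star_eq_0[simp]: "star A = 0 \<longleftrightarrow> A = 0" by (metis star_star star_zero)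

lemma scaleC_times_left: "scaleC c A * B = scaleC c (A * B)"
proof (rule fmat_eqI)
  fix i j
  obtain d where "sized d d A" "sized d d B" using sized_ex2 by blast
  then show "ent (scaleC c A * B) i j = ent (scaleC c (A * B)) i j"
    by (simp add: ent_times[of d d] sized_scaleC scaleC.rep_eq sum_distrib_left mult.assoc)
qed

lemma scaleC_times_right: "A * scaleC c B = scaleC c (A * B)"
proof (rule fmat_eqI)
  fix i j
  obtain d where "sized d d A" "sized d d B" using sized_ex2 by blast
  then show "ent (A * scaleC c B) i j = ent (scaleC c (A * B)) i j"
    by (simp add: ent_times[of d d] sized_scaleC scaleC.rep_eq sum_distrib_left mult_ac)
qed

lemma scaleC_add: "scaleC c (A + B) = scaleC c A + scaleC c B" by transfer (simp add: algebra_simps)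
lemma scaleC_add_left: "scaleC (a + b) A = scaleC a A + scaleC b A" by transfer (simp add: algebra_simps)
lemma scaleC_zero[simp]: "scaleC c 0 = 0" by transfer simp
lemma scaleC_0[simp]: "scaleC 0 A = 0" by transfer simp
lemma scaleC_1[simp]: "scaleC 1 A = A" by transfer simp
lemma scaleC_scaleC[simp]: "scaleC a (scaleC b A) = scaleC (a * b) A" by transfer (simp add: mult.assoc)
lemma scaleC_sum: "scaleC c (sum f I) = (\<Sum>k\<in>I. scaleC c (f k))"
  by (induction I rule: infinite_finite_induct) (auto simp: scaleC_add)
lemma scaleC_sum_left: "scaleC (sum f I) A = (\<Sum>k\<in>I. scaleC (f k) A)"
  by (induction I rule: infinite_finite_induct) (auto simp: scaleC_add_left)
lemma scaleR_scaleC: "r *\<^sub>R A = scaleC (of_real r) A" by transfer simp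

lemma idm_left: "sized d m A \<Longrightarrow> idm d * A = A"
proof (rule fmat_eqI)
  fix i j assume A: "sized d m A"
  have "ent (idm d * A) i j = (\<Sum>k<d. ent (idm d) i k * ent A k j)"
    by (rule ent_times[of d]) simp
  also have "\<dots> = (\<Sum>k<d. if k = i then ent A k j else 0)"
    by (intro sum.cong) (auto simp: idm_def fmat_of.rep_eq)
  also have "\<dots> = ent A i j"
    using A by (auto simp: sized_def)
  finally show "ent (idm d * A) i j = ent A i j" .
qed

lemma idm_right: "sized m d A \<Longrightarrow> A * idm d = A"
  by (metis idm_left sized_star star_idm star_inject star_times)

lemma idm_idm[simp]: "idm d * idm d = idm d" by (simp add: idm_left[of d d])

section \<open>Trace and Hilbert-Schmidt norm\<close>

definition tr :: "fmat \<Rightarrow> complex" where "tr A = (\<Sum>i | ent A i i \<noteq> 0. ent A i i)"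

lemma tr_eq: "sized d m A \<or> sized m d A \<Longrightarrow> tr A = (\<Sum>i<d. ent A i i)"
  unfolding tr_def by (rule sum_restrict_zero) (auto simp: sized_def)

lemma tr_add: "tr (A + B) = tr A + tr B"
proof -
  obtain d where "sized d d A" "sized d d B" using sized_ex2 by blast
  then show ?thesis by (simp add: tr_eq[of d d] sized_ops ent_simps sum.distrib)
qed

lemma tr_scaleC: "tr (scaleC c A) = c * tr A"
proof -
  obtain d where "sized d d A" using sized_ex2 by blast
  then show ?thesis by (simp add: tr_eq[of d d] sized_scaleC scaleC.rep_eq sum_distrib_left)
qed

lemma tr_zero[simp]: "tr 0 = 0" by (simp add: tr_def ent_simps)
lemma tr_scaleR: "tr (c *\<^sub>R A) = of_real c * tr A" by (simp add: scaleR_scaleC tr_scaleC)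
lemma tr_uminus: "tr (- A) = - tr A" using tr_scaleR[of "-1" A] by simp
lemma tr_diff: "tr (A - B) = tr A - tr B" using tr_add[of A "- B"] by (simp add: tr_uminus)
lemma tr_sum: "tr (sum f I) = (\<Sum>k\<in>I. tr (f k))"
  by (induction I rule: infinite_finite_induct) (auto simp: tr_add)

lemmas tr_simps = tr_add tr_diff tr_uminus tr_scaleR tr_sum tr_scaleC

lemma tr_comm: "tr (A * B) = tr (B * A)"
proof -
  obtain d where d: "sized d d A" "sized d d B" using sized_ex2 by blast
  have "tr (A * B) = (\<Sum>i<d. \<Sum>k<d. ent A i k * ent B k i)"
    using d by (simp add: tr_eq[of d d] sized_times[of _ d _ d] ent_times[of d d])
  also have "\<dots> = (\<Sum>k<d. \<Sum>i<d. ent B k i * ent A i k)"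
    by (subst sum.swap) (simp add: mult.commute)
  also have "\<dots> = tr (B * A)"
    using d by (simp add: tr_eq[of d d] sized_times[of _ d _ d] ent_times[of d d])
  finally show ?thesis .
qed

lemma tr_star: "tr (star A) = cnj (tr A)"
proof -
  obtain d where "sized d d A" using sized_ex2 by blast
  then show ?thesis by (simp add: tr_eq[of d d] sized_star star.rep_eq)
qed

lemma tr_idm: "tr (idm d) = of_nat d"
  by (subst tr_eq[of d d]) (auto simp: idm_def fmat_of.rep_eq)

definition nrm2 :: "fmat \<Rightarrow> real" where "nrm2 A = Re (tr (star A * A))"

lemma tr_star_times:
  assumes "sized m n A" shows "tr (star A * B) = (\<Sum>j<n. \<Sum>i<m. cnj (ent A i j) * ent B i j)"
proof -
  have "sized n m (star A)" by (rule sized_star[OF assms])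
  then have "tr (star A * B) = (\<Sum>j<n. ent (star A * B) j j)"
  proof -
    obtain l where "sized l l B" using sized_ex2 by blast
    with \<open>sized n m (star A)\<close> have "sized n l (star A * B)" by (rule sized_times)
    then show ?thesis by (intro tr_eq) blast
  qed
  also have "\<dots> = (\<Sum>j<n. \<Sum>i<m. cnj (ent A i j) * ent B i j)"
    by (subst ent_times[of n m]) (auto simp: sized_star assms star.rep_eq)
  finally show ?thesis .
qed

lemma nrm2_eq: "sized m n A \<Longrightarrow> nrm2 A = (\<Sum>j<n. \<Sum>i<m. (cmod (ent A i j))\<^sup>2)"
  by (simp add: nrm2_def tr_star_times complex_norm_square[symmetric] mult.commute)

lemma tr_star_self: "tr (star A * A) = of_real (nrm2 A)"
proof -
  obtain d where "sized d d A" using sized_ex2 by blast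
  then show ?thesis
    by (simp only: nrm2_eq tr_star_times of_real_sum complex_norm_square mult.commute)
qed

lemma nrm2_nonneg: "nrm2 A \<ge> 0"
proof -
  obtain d where "sized d d A" using sized_ex2 by blast
  then show ?thesis by (simp add: nrm2_eq sum_nonneg)
qed

text \<open>Stated with an inequality because its main uses bound a squared norm from above. This is
  how numerical identities between correlations become operator identities.\<close>

lemma nrm2_le_0: "nrm2 A \<le> 0 \<Longrightarrow> A = 0"
proof (rule fmat_eqI)
  fix i j assume 0: "nrm2 A \<le> 0"
  obtain d where d: "sized d d A" using sized_ex2 by blast
  have "nrm2 A = 0" using 0 nrm2_nonneg[of A] by simp
  then have "(\<Sum>j<d. \<Sum>i<d. (cmod (ent A i j))\<^sup>2) = 0" by (simp add: nrm2_eq[OF d])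
  then have "\<forall>j<d. \<forall>i<d. ent A i j = 0"
    by (subst (asm) sum_nonneg_eq_0_iff) (auto simp: sum_nonneg sum_nonneg_eq_0_iff)
  then show "ent A i j = ent 0 i j"
    using d by (cases "i < d \<and> j < d") (auto simp: ent_simps sized_def not_less)
qed

lemma star_self_0: "star A * A = 0 \<Longrightarrow> A = 0"
  by (rule nrm2_le_0) (simp add: nrm2_def)

text \<open>Multiplying by \<open>star A\<close> on the right exhibits \<open>A * B\<close> times
  its own adjoint. It serves to cancel a reduced state \<open>Psi * star Psi\<close> down to
  \<open>Psi\<close>.\<close>

lemma times_star_self_0: "A * B * star B = 0 \<Longrightarrow> A * B = 0"
proof -
  assume "A * B * star B = 0"
  then have "star (star (A * B)) * star (A * B) = 0"
    by (simp add: star_times mult.assoc[symmetric])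
  then show ?thesis using star_self_0 star_eq_0 by blast
qed

section \<open>Kernel and support projections\<close>

definition of_mat :: "complex mat \<Rightarrow> fmat" where
  "of_mat A = fmat_of (dim_row A) (dim_col A) (\<lambda>i j. A $$ (i, j))"

lemma sized_of_mat[simp]: "A \<in> carrier_mat m n \<Longrightarrow> sized m n (of_mat A)" by (auto simp: of_mat_def)

lemma of_mat_mult:
  assumes "A \<in> carrier_mat m k" "B \<in> carrier_mat k n" shows "of_mat (A * B) = of_mat A * of_mat B"
proof (rule fmat_eqI)
  fix i j
  show "ent (of_mat (A * B)) i j = ent (of_mat A * of_mat B) i j"
    using assms
    by (subst ent_times[of m k]) (auto simp: of_mat_def fmat_of.rep_eq scalar_prod_def atLeast0LessThan)
qed

lemma of_mat_one: "of_mat (1\<^sub>m d) = idm d"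
  by (rule fmat_eqI) (auto simp: of_mat_def idm_def fmat_of.rep_eq)

lemma of_mat_ent: "sized m n A \<Longrightarrow> of_mat (mat m n (\<lambda>(i, j). ent A i j)) = A"
  by (rule fmat_eqI) (auto simp: of_mat_def fmat_of.rep_eq sized_def)

lemma inverse_ex:
  assumes A: "sized d d A" and inj: "\<And>v. sized d 1 v \<Longrightarrow> A * v = 0 \<Longrightarrow> v = 0"
  shows "\<exists>Y. sized d d Y \<and> A * Y = idm d \<and> Y * A = idm d"
proof -
  let ?B = "mat d d (\<lambda>(i, j). ent A i j)"
  have B: "?B \<in> carrier_mat d d" by simp
  have "det ?B \<noteq> 0"
  proof
    assume "det ?B = 0"
    then obtain v where v: "v \<in> carrier_vec d" "v \<noteq> 0\<^sub>v d" "?B *\<^sub>v v = 0\<^sub>v d"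
      using det_0_iff_vec_prod_zero[OF B] by blast
    let ?v = "fmat_of d 1 (\<lambda>i j. v $ i)"
    have "A * ?v = 0"
    proof (rule fmat_eqI)
      fix i j
      have "ent (A * ?v) i j = (\<Sum>k<d. ent A i k * ent ?v k j)"
        by (rule ent_times[of d]) (simp add: A)
      also have "\<dots> = (if i < d \<and> j < 1 then (?B *\<^sub>v v) $ i else 0)"
        using A v(1) by (auto simp: sized_def fmat_of.rep_eq scalar_prod_def atLeast0LessThan intro!: sum.cong)
      also have "\<dots> = ent 0 i j" using v(3) by (simp add: ent_simps)
      finally show "ent (A * ?v) i j = ent 0 i j" .
    qed
    then have "?v = 0" using inj by simp
    then have h: "ent ?v i 0 = 0" for i by (simp add: ent_simps)
    have "\<forall>i<d. v $ i = 0"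
    proof (intro allI impI)
      fix i assume "i < d"
      then show "v $ i = 0" using h[of i] by (simp add: fmat_of.rep_eq)
    qed
    then show False using v(1,2) by (auto simp: vec_eq_iff)
  qed
  then have "?B \<in> Units (ring_mat TYPE(complex) d ())" by (rule det_non_zero_imp_unit[OF B])
  then obtain Z where Z: "Z \<in> carrier_mat d d" "Z * ?B = 1\<^sub>m d" "?B * Z = 1\<^sub>m d"
    unfolding Units_def ring_mat_def by auto
  show ?thesis
    using of_mat_mult[OF B Z(1)] of_mat_mult[OF Z(1) B] Z of_mat_ent[OF A] by (intro exI[of _ "of_mat Z"]) (auto simp: of_mat_one)
qed

definition is_proj :: "fmat \<Rightarrow> bool" where "is_proj e \<longleftrightarrow> star e = e \<and> e * e = e"

lemma is_projD: "is_proj e \<Longrightarrow> star e = e" "is_proj e \<Longrightarrow> e * e = e" "is_proj e \<Longrightarrow> e * (e * x) = e * x"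
  by (auto simp: is_proj_def mult.assoc[symmetric])

lemma column_gram: "sized d 1 y \<Longrightarrow> star y * y = nrm2 y *\<^sub>R idm 1"
proof (rule fmat_eqI)
  fix a b assume y: "sized d 1 y"
  have yy: "sized 1 1 (star y * y)" by (rule sized_times[OF sized_star[OF y] y])
  have "ent (star y * y) 0 0 = of_real (nrm2 y)"
    using tr_star_self[of y] tr_eq[of 1 1 "star y * y"] yy by simp
  then show "ent (star y * y) a b = ent (nrm2 y *\<^sub>R idm 1) a b"
    using sized_ent[OF yy, of a b] by (cases "a = 0 \<and> b = 0") (auto simp: ent_simps idm_def fmat_of.rep_eq)
qed

lemma unit_column:
  assumes "u \<noteq> 0" "sized d c u"
  shows "\<exists>w. sized c 1 w \<and> star (u * w) * (u * w) = idm 1"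
proof -
  obtain i j where ij: "ent u i j \<noteq> 0" using fmat_eqI[of u 0] assms by (auto simp: ent_simps)
  then have jc: "j < c" using assms(2) by (auto simp: sized_def not_less[symmetric])
  define E where "E = fmat_of c 1 (\<lambda>a b. if a = j then 1 else 0)"
  have "ent (u * E) i 0 = (\<Sum>l<c. ent u i l * ent E l 0)"
    using assms(2) by (intro ent_times[of d c]) simp
  also have "\<dots> = (\<Sum>l<c. if l = j then ent u i j else 0)"
    by (intro sum.cong) (auto simp: E_def fmat_of.rep_eq)
  also have "\<dots> = ent u i j" using jc by simp
  finally have "u * E \<noteq> 0" using ij by (auto simp: ent_simps)
  then have pos: "nrm2 (u * E) > 0" using nrm2_le_0[of "u * E"] by fastforce
  have "sized d 1 (u * E)" unfolding E_def by (rule sized_times[OF assms(2) sized_fmat_of])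
  note gram = column_gram[OF this]
  define w where "w = (1 / sqrt (nrm2 (u * E))) *\<^sub>R E"
  have "star (u * w) * (u * w) = (1 / (sqrt (nrm2 (u * E)) * sqrt (nrm2 (u * E)))) *\<^sub>R (star (u * E) * (u * E))"
    by (simp add: w_def star_scaleR)
  also have "\<dots> = idm 1" using pos by (simp add: gram)
  finally show ?thesis by (intro exI[of _ w]) (simp add: w_def sized_ops E_def)
qed

lemma column_proj:
  assumes "sized d 1 y" "star y * y = idm 1"
  shows "is_proj (y * star y)" "tr (y * star y) = 1"
proof -
  have "(y * star y) * (y * star y) = y * (star y * y) * star y" by (simp add: mult.assoc)
  also have "\<dots> = y * star y" by (simp only: assms(2) idm_right[OF assms(1)])
  finally show "is_proj (y * star y)" by (simp add: is_proj_def star_times)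
  show "tr (y * star y) = 1" by (simp add: tr_comm[of y] assms tr_idm)
qed

text \<open>If no projection inside the kernel captured all of it, a rank one projection could
  always be added. Projections of every integer trace would then exist, which is impossible in
  dimension \<open>d\<close>.\<close>

lemma kernel_projector:
  assumes T: "sized m d T"
  shows "\<exists>e. sized d d e \<and> is_proj e \<and> T * e = 0 \<and> (\<forall>v c. sized d c v \<longrightarrow> T * v = 0 \<longrightarrow> e * v = v)"
proof (rule ccontr)
  assume contra: "\<not> ?thesis"
  have "\<exists>e. sized d d e \<and> is_proj e \<and> T * e = 0 \<and> tr e = of_nat k" for k
  proof (induction k)
    case 0
    show ?case by (intro exI[of _ 0]) (auto simp: sized_ops is_proj_def)
  next
    case (Suc k)
    then obtain e where e: "sized d d e" "is_proj e" "T * e = 0" "tr e = of_nat k" by blast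
    then obtain v c where v: "sized d c v" "T * v = 0" "e * v \<noteq> v" using contra by blast
    \<comment> \<open>The part of \<open>v\<close> orthogonal to \<open>e\<close>, which still lies
      in the kernel of \<open>T\<close>.\<close>
    define u where "u = v - e * v"
    have u: "u \<noteq> 0" "sized d c u" using v e(1) by (auto simp: u_def sized_ops sized_times)
    from unit_column[OF this] obtain w where w: "sized c 1 w" "star (u * w) * (u * w) = idm 1"
      by blast
    have uw: "sized d 1 (u * w)" by (rule sized_times[OF u(2) w(1)])
    define f where "f = u * w * star (u * w)"
    have f: "sized d d f" "is_proj f" "tr f = 1"
      unfolding f_def using column_proj[OF uw w(2)] sized_times[OF uw sized_star[OF uw]] by auto
    have "e * u = 0" by (simp add: u_def algebra_simps is_projD[OF e(2)])
    then have ef: "e * f = 0" by (simp add: f_def mult.assoc[symmetric])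
    then have "f * e = 0" using e(2) f(2) by (metis is_proj_def star_times star_zero)
    have "T * u = 0" using v(2) e(3) by (simp add: u_def algebra_simps) (simp add: mult.assoc[symmetric])
    then have "T * f = 0" by (simp add: f_def mult.assoc[symmetric])
    show ?case
    proof (intro exI[of _ "e + f"] conjI)
      show "is_proj (e + f)"
        using e(2) f(2) ef \<open>f * e = 0\<close> by (simp add: is_proj_def star_add algebra_simps)
    qed (use e \<open>T * f = 0\<close> f in \<open>auto simp: sized_ops algebra_simps tr_add\<close>)
  qed
  then obtain e where e: "sized d d e" "is_proj e" "tr e = of_nat (Suc d)" by blast
  \<comment> \<open>A projection has its trace as squared norm; here that would be -1.\<close>
  have "star (idm d - e) * (idm d - e) = idm d - e"
    using e by (simp add: star_diff algebra_simps is_projD idm_left idm_right)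
  then have "nrm2 (idm d - e) = real d - real (Suc d)"
    by (simp add: nrm2_def tr_diff tr_idm e(3))
  then show False using nrm2_nonneg[of "idm d - e"] by simp
qed

definition kerproj :: "nat \<Rightarrow> fmat \<Rightarrow> fmat" where
  "kerproj d T = (SOME e. sized d d e \<and> is_proj e \<and> T * e = 0 \<and> (\<forall>v c. sized d c v \<longrightarrow> T * v = 0 \<longrightarrow> e * v = v))"

lemma kerproj:
  assumes "sized m d T"
  shows "sized d d (kerproj d T)" "is_proj (kerproj d T)" "T * kerproj d T = 0"
    "sized d c v \<Longrightarrow> T * v = 0 \<Longrightarrow> kerproj d T * v = v"
  using someI_ex[OF kernel_projector[OF assms]] unfolding kerproj_def by blast+

text \<open>The range of \<open>Psi\<close> is the orthogonal complement of the kernel of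
  \<open>star Psi\<close>; it is the support of \<open>Psi * star Psi\<close>.\<close>

definition supproj :: "nat \<Rightarrow> fmat \<Rightarrow> fmat" where
  "supproj d Psi = idm d - kerproj d (star Psi)"

lemma supproj:
  assumes "sized d k Psi"
  shows "sized d d (supproj d Psi)" "is_proj (supproj d Psi)" "supproj d Psi * Psi = Psi"
    and supproj_0: "X * Psi = 0 \<Longrightarrow> X * supproj d Psi = 0"
proof -
  note K = kerproj[OF sized_star[OF assms]]
  show b: "sized d d (supproj d Psi)" by (simp add: supproj_def sized_ops K)
  show "is_proj (supproj d Psi)"
    using K(1,2) by (simp add: is_proj_def supproj_def star_diff algebra_simps idm_left idm_right)
  have "kerproj d (star Psi) * Psi = 0"
    using K(3) K(2) by (metis is_projD(1) star_star star_times star_zero)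
  then show "supproj d Psi * Psi = Psi"
    using assms by (simp add: supproj_def algebra_simps idm_left)
  assume X: "X * Psi = 0"
  \<comment> \<open>\<open>X\<close> may have more than \<open>d\<close> columns. Cutting it with
    \<open>idm d\<close> makes its adjoint a legitimate argument for the kernel projection.\<close>
  obtain c where c: "sized c c (X * idm d)" using sized_ex2 by blast
  have "sized d c (star (X * idm d))"
  proof -
    have "star (X * idm d) = idm d * star (X * idm d)" by (simp add: star_times mult.assoc[symmetric])
    then show ?thesis by (metis sized_idm sized_times sized_star c)
  qed
  moreover have "star Psi * star (X * idm d) = 0"
    using X assms by (simp add: star_times[symmetric] mult.assoc idm_left)
  ultimately have "kerproj d (star Psi) * star (X * idm d) = star (X * idm d)" by (rule K(4))
  then have "X * idm d * kerproj d (star Psi) = X * idm d"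
    using K(2) by (metis is_projD(1) star_inject star_times)
  then show "X * supproj d Psi = 0"
    using K(1) by (simp add: supproj_def algebra_simps idm_left)
qed

text \<open>Plain expansion; \<open>p\<close> acts as the unit of the corner containing
  \<open>a\<close> and \<open>b\<close>.\<close>

lemma proj_pair:
  fixes a b p :: fmat
  assumes "a * a = a" "b * b = b" "p * p = p" "p * a = a" "a * p = a" "p * b = b" "b * p = b"
  shows "(a + b - p) * (a + b - p) + (a - b) * (a - b) = p"
    and "(a + b - p) * (a - b) = - ((a - b) * (a + b - p))"
  using assms by (simp_all add: algebra_simps)

section \<open>Four projections with sum 2 - 1/n\<close>

text \<open>Applying \<open>x -> - x - 2/n\<close> and \<open>x -> - x\<close> in turn, starting at
  0, gives 0, -2/n, 2/n, -4/n, 4/n, ...\<close>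

definition chain_ev :: "nat \<Rightarrow> nat \<Rightarrow> real" where
  "chain_ev n j = (if even j then real j / real n else - real (Suc j) / real n)"

text \<open>The factor by which \<open>X j\<close> scales lengths on the \<open>j\<close>-th
  eigenspace: with \<open>x = chain_ev n j\<close>, both \<open>1 - (x + 1/n)^2\<close> for even
  \<open>j\<close> and \<open>1 - x^2\<close> for odd \<open>j\<close> equal
  \<open>1 - ((j + 1)/n)^2\<close>.\<close>

definition chain_coeff :: "nat \<Rightarrow> nat \<Rightarrow> real" where "chain_coeff n j = sqrt (1 - (real (Suc j) / real n)\<^sup>2)"

text \<open>The matrix of \<open>D\<close> along the chain, as \<open>deven\<close> is that of
  \<open>D'\<close>. Index 0 has no partner under \<open>D\<close>, which acts there by a
  sign.\<close>

definition dodd :: "nat \<Rightarrow> real \<Rightarrow> nat \<Rightarrow> nat \<Rightarrow> real" where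
  "dodd n eps l k = (if l = 0 \<and> k = 0 then eps else if l = Suc k \<and> odd k then chain_coeff n k
     else if k = Suc l \<and> odd l then chain_coeff n l else 0)"

definition deven :: "nat \<Rightarrow> nat \<Rightarrow> nat \<Rightarrow> real" where
  "deven n l k = (if l = Suc k \<and> even k then chain_coeff n k else if k = Suc l \<and> even l then chain_coeff n l else 0)"

text \<open>The matrices of the four projections along the chain, read off from
  \<open>(1 + S +- D)/2\<close> and \<open>(1 + S' +- D')/2\<close> with
  \<open>S' = - S - 1/n\<close>. They depend only on \<open>n\<close> and the sign, which makes
  different quadruples comparable.\<close>

definition act_coeff :: "nat \<Rightarrow> real \<Rightarrow> nat \<Rightarrow> nat \<Rightarrow> nat \<Rightarrow> real" where
  "act_coeff n eps i l k =
    (if i = 0 then ((if l = k then 1 + chain_ev n k else 0) + dodd n eps l k) / 2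
     else if i = 1 then ((if l = k then 1 + chain_ev n k else 0) - dodd n eps l k) / 2
     else if i = 2 then ((if l = k then 1 - 1 / real n - chain_ev n k else 0) + deven n l k) / 2
     else ((if l = k then 1 - 1 / real n - chain_ev n k else 0) - deven n l k) / 2)"

lemma act_coeff_sym: "act_coeff n eps i l k = act_coeff n eps i k l"
  unfolding act_coeff_def dodd_def deven_def by auto

lemma chain_ev_inj: "n \<ge> 1 \<Longrightarrow> chain_ev n j = chain_ev n k \<Longrightarrow> j = k"
proof -
  assume n: "n \<ge> 1" and e: "chain_ev n j = chain_ev n k"
  define f :: "nat \<Rightarrow> real" where "f i = (if even i then real i else - real (Suc i))" for i
  have "chain_ev n i = f i / real n" for i by (simp add: chain_ev_def f_def)
  then have "f j = f k" using n e by simp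
  then show "j = k" by (simp add: f_def split: if_splits)
qed

lemma chain_coeff_pos: "Suc j < n \<Longrightarrow> chain_coeff n j > 0"
  by (simp add: chain_coeff_def power2_eq_square divide_simps mult_strict_mono)

lemma chain_coeff_sq: "Suc j \<le> n \<Longrightarrow> (chain_coeff n j)\<^sup>2 = 1 - (real (Suc j) / real n)\<^sup>2"
proof -
  assume a: "Suc j \<le> n"
  then have "real (Suc j) / real n \<le> 1" by (simp add: divide_simps)
  then have "(real (Suc j) / real n)\<^sup>2 \<le> 1" by (simp add: power_le_one)
  then show ?thesis by (simp add: chain_coeff_def)
qed

lemma sum_single:
  fixes f :: "nat \<Rightarrow> 'a::comm_monoid_add"
  assumes "\<And>l. l < n \<Longrightarrow> l \<noteq> j \<Longrightarrow> f l = 0"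
  shows "(\<Sum>l<n. f l) = (if j < n then f j else 0)"
proof -
  have "(\<Sum>l<n. f l) = (\<Sum>l<n. if l = j then f j else 0)"
    by (intro sum.cong) (use assms in auto)
  then show ?thesis by simp
qed

text \<open>One party of a strategy, with indices shifted to start at 0.  The columns of the \<open>d \<times> k\<close> matrix
  \<open>Psi\<close> span the support of the reduced state \<open>rho = Psi * star Psi\<close>, and \<open>tau\<close> below is a trace on the
  operators commuting with \<open>rho\<close>.\<close>

locale quad =
  fixes d k n :: nat and eps :: real and Psi :: fmat and M :: "nat \<Rightarrow> fmat"
  assumes npos: "n \<ge> 1" and eps: "eps * eps = 1"
    and Psi_sized: "sized d k Psi" and M_sized: "i < 4 \<Longrightarrow> sized d d (M i)"
    and M_star: "i < 4 \<Longrightarrow> star (M i) = M i"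
    and M_idem: "i < 4 \<Longrightarrow> M i * (M i * Psi) = M i * Psi"
    and M_comm: "i < 4 \<Longrightarrow> M i * (Psi * star Psi) = Psi * star Psi * M i"
    and M_sum: "M 0 * Psi + M 1 * Psi + M 2 * Psi + M 3 * Psi = (2 - 1 / real n) *\<^sub>R Psi"
    and tr_Psi: "tr (star Psi * Psi) = 1"
    and tr_D: "tr (star Psi * ((M 0 - M 1) * Psi)) = of_real (eps / real n)"
begin

definition "pj = supproj d Psi"
definition "m i = M i * pj"
definition "S = m 0 + m 1 - pj"
definition "D = m 0 - m 1"
definition "S' = m 2 + m 3 - pj"
definition "D' = m 2 - m 3"
text \<open>\<open>S\<close> also vanishes off the support of the state. Adding the complementary
  projection removes this spurious kernel, so ker \<open>T\<close> is the kernel of \<open>S\<close>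
  inside the support.\<close>

definition "T = S + (idm d - pj)"
definition "e0 = kerproj d T"
definition "X (j::nat) = (if even j then D' else D)"
text \<open>\<open>D\<close> maps the \<open>\<lambda>\<close>-eigenspace of \<open>S\<close> to that of \<open>-\<lambda>\<close>, and \<open>D'\<close> maps it to that of
  \<open>-\<lambda> - 2/n\<close>.  Starting from the kernel of \<open>S\<close> and applying them alternately runs through the
  eigenvalues \<open>chain_ev n j\<close>, and stops after \<open>n\<close> steps because \<open>chain_coeff n (n - 1) = 0\<close>.\<close>

primrec C where
  "C 0 = e0" | "C (Suc j) = (1 / chain_coeff n j) *\<^sub>R (X j * C j)"
definition "rho = Psi * star Psi"

section \<open>Restriction of the operators to the support\<close>

lemma Pi_sized: "sized d d pj" and Pi_star: "star pj = pj" and Pi_Pi: "pj * pj = pj"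
  and Pi_Psi: "pj * Psi = Psi"
  using supproj(1-3)[OF Psi_sized] is_projD unfolding pj_def by simp_all

lemma ext0: "A * Psi = 0 \<Longrightarrow> A * pj = 0"
  unfolding pj_def by (rule supproj_0[OF Psi_sized])

lemma ext0_rho: "A * rho = 0 \<Longrightarrow> A * Psi = 0"
  unfolding rho_def by (rule times_star_self_0) (simp add: mult.assoc)

lemma ext_eq: "A * Psi = B * Psi \<Longrightarrow> A * pj = B * pj"
  using ext0[of "A - B"] by (simp add: algebra_simps)

lemma rho_star: "star rho = rho" by (simp add: rho_def star_times)
lemma Pi_rho: "pj * rho = rho" by (simp add: rho_def mult.assoc[symmetric] Pi_Psi)
lemma rho_Pi: "rho * pj = rho" by (metis Pi_rho Pi_star rho_star star_times)

context fixes i :: nat assumes i: "i < 4" begin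

text \<open>\<open>M i\<close> commutes with \<open>rho\<close>, so it leaves the range of
  \<open>rho\<close> invariant, and that range is the support.\<close>

lemma PMP: "pj * (M i * pj) = M i * pj"
proof -
  have "(pj * M i) * rho = M i * rho"
    using M_comm[OF i] by (metis Pi_rho mult.assoc rho_def)
  then have "(pj * M i - M i) * rho = 0" by (simp add: algebra_simps)
  then have "(pj * M i - M i) * pj = 0" using ext0 ext0_rho by blast
  then show ?thesis by (simp add: algebra_simps)
qed

lemma m_sized: "sized d d (m i)" unfolding m_def by (rule sized_times[OF M_sized[OF i] Pi_sized])
lemma Pi_m: "pj * m i = m i" by (simp add: m_def PMP)
lemma m_Pi: "m i * pj = m i" by (simp add: m_def mult.assoc Pi_Pi)
lemma m_star: "star (m i) = m i"
proof -
  have "star (pj * (M i * pj)) = star (M i * pj)" by (simp add: PMP)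
  then have "pj * (M i * pj) = pj * M i" by (simp add: star_times Pi_star M_star i mult.assoc)
  then show ?thesis by (simp add: m_def star_times Pi_star M_star i PMP)
qed
lemma m_m: "m i * m i = m i"
proof -
  have "(M i * M i) * pj = M i * pj" by (rule ext_eq) (simp add: mult.assoc M_idem i)
  then show ?thesis by (simp add: m_def mult.assoc PMP)
qed
lemma m_Psi: "m i * Psi = M i * Psi" by (simp add: m_def mult.assoc Pi_Psi)
lemma m_rho: "m i * rho = rho * m i"
  using M_comm[OF i] by (metis m_def mult.assoc Pi_rho rho_Pi rho_def)

end

lemma m_sum: "m 0 + m 1 + m 2 + m 3 = (2 - 1 / real n) *\<^sub>R pj"
proof -
  have "(M 0 + M 1 + M 2 + M 3) * Psi = ((2 - 1 / real n) *\<^sub>R idm d) * Psi"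
    using M_sum idm_left[OF Psi_sized] by (simp add: algebra_simps)
  then have "(M 0 + M 1 + M 2 + M 3) * pj = ((2 - 1 / real n) *\<^sub>R idm d) * pj" by (rule ext_eq)
  then show ?thesis using idm_left[OF Pi_sized] by (simp add: algebra_simps m_def)
qed

lemma S'_eq: "S' = - S - (1 / real n) *\<^sub>R pj"
proof -
  have "m 2 + m 3 = (2 - 1 / real n) *\<^sub>R pj - m 0 - m 1"
    using m_sum by (simp add: algebra_simps)
  then have "S' = (2 - 1 / real n) *\<^sub>R pj - m 0 - m 1 - pj" by (simp add: S'_def)
  also have "\<dots> = - S - (1 / real n) *\<^sub>R pj"
    by (simp add: S_def scaleR_left_diff_distrib scaleR_2)
  finally show ?thesis .
qed

lemma SD: "S * S + D * D = pj" "S * D = - (D * S)"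
  unfolding S_def D_def by (rule proj_pair; simp add: m_m m_Pi Pi_m Pi_Pi)+
lemma SD': "S' * S' + D' * D' = pj" "S' * D' = - (D' * S')"
  unfolding S'_def D'_def by (rule proj_pair; simp add: m_m m_Pi Pi_m Pi_Pi)+

lemma stars: "star S = S" "star D = D" "star S' = S'" "star D' = D'" "star T = T"
  by (simp_all add: S_def D_def S'_def D'_def T_def star_simps m_star Pi_star)

lemma Pis: "pj * S = S" "pj * D = D" "pj * S' = S'" "pj * D' = D'"
  "S * pj = S" "D * pj = D" "S' * pj = S'" "D' * pj = D'"
  by (simp_all add: S_def D_def S'_def D'_def algebra_simps m_Pi Pi_m Pi_Pi)

lemma inbs: "sized d d S" "sized d d D" "sized d d S'" "sized d d D'" "sized d d T"
  by (simp_all add: S_def D_def S'_def D'_def T_def sized_ops m_sized Pi_sized)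

lemma rhos: "S * rho = rho * S" "D * rho = rho * D" "D' * rho = rho * D'"
  by (simp_all add: S_def D_def D'_def algebra_simps m_rho Pi_rho rho_Pi)

lemma T_rho: "T * rho = rho * T"
  using idm_left[of d d rho] idm_right[of d d rho] sized_times[OF Psi_sized sized_star[OF Psi_sized]]
  by (simp add: T_def algebra_simps rhos Pi_rho rho_Pi) (simp add: rho_def)

lemma e0_sized: "sized d d e0" and e0_proj: "is_proj e0" and T_e0: "T * e0 = 0"
  and e0_ker: "sized d c v \<Longrightarrow> T * v = 0 \<Longrightarrow> e0 * v = v"
  using kerproj[OF inbs(5)] unfolding e0_def by auto

lemmas e0_star = is_projD(1)[OF e0_proj]
lemmas e0_e0 = is_projD(2)[OF e0_proj]

lemma e0_T: "e0 * T = 0" by (metis T_e0 e0_star star_times star_zero stars(5))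

lemma Pi_T: "pj * T = S" "T * pj = S"
  by (simp_all add: T_def algebra_simps Pis Pi_Pi idm_left[OF Pi_sized] idm_right[OF Pi_sized])

lemma S_e0: "S * e0 = 0" by (metis Pi_T(1) T_e0 mult.assoc mult_zero_right)
lemma Pi_e0: "pj * e0 = e0"
  using T_e0 S_e0 by (simp add: T_def algebra_simps idm_left[OF e0_sized])
lemma e0_Pi: "e0 * pj = e0" by (metis Pi_e0 Pi_star e0_star star_times)
lemma e0_ker': "sized d c v \<Longrightarrow> pj * v = v \<Longrightarrow> S * v = 0 \<Longrightarrow> e0 * v = v"
  by (rule e0_ker) (auto simp: T_def algebra_simps idm_left)

text \<open>Commuting with \<open>T\<close>, \<open>rho\<close> maps ker \<open>T\<close> into
  itself. Since \<open>rho\<close> and \<open>e0\<close> are Hermitian, taking adjoints upgrades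
  invariance to commutation.\<close>

lemma e0_rho: "e0 * rho = rho * e0"
proof -
  have "sized d d (rho * e0)"
    unfolding rho_def by (rule sized_times[OF sized_times[OF Psi_sized sized_star[OF Psi_sized]] e0_sized])
  moreover have "T * (rho * e0) = 0" by (metis T_rho T_e0 mult.assoc mult_zero_right)
  ultimately have "e0 * (rho * e0) = rho * e0" by (rule e0_ker)
  moreover from this have "e0 * (rho * e0) = e0 * rho"
    by (metis e0_star mult.assoc rho_star star_times)
  ultimately show ?thesis by simp
qed

text \<open>The same argument: an operator that anticommutes with \<open>S\<close> preserves ker
  \<open>S\<close>.\<close>

lemma e0_D: "e0 * D = D * e0"
proof -
  have "sized d d (D * e0)" by (rule sized_times[OF inbs(2) e0_sized])
  moreover have "S * (D * e0) = 0" by (metis SD(2) S_e0 minus_mult_left mult.assoc mult_zero_right neg_equal_0_iff_equal)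
  moreover have "pj * (D * e0) = D * e0" by (metis Pis(2) mult.assoc)
  ultimately have "e0 * (D * e0) = D * e0" using e0_ker' by blast
  moreover from this have "e0 * (D * e0) = e0 * D"
    by (metis e0_star mult.assoc stars(2) star_times)
  ultimately show ?thesis by simp
qed

section \<open>The chain of eigenspaces of \<open>S\<close>\<close>

lemma Pi_C: "pj * C j = C j"
  by (induction j) (auto simp: Pi_e0 X_def mult.assoc[symmetric] Pis)

lemma S_C: "S * C j = chain_ev n j *\<^sub>R C j"
proof (induction j)
  case 0
  then show ?case by (simp add: chain_ev_def S_e0)
next
  case (Suc j)
  have "S * (X j * C j) = chain_ev n (Suc j) *\<^sub>R (X j * C j)"
  proof (cases "even j")
    case True
    have "S * D' = - (S' * D') - (1 / real n) *\<^sub>R D'"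
    proof -
      have "S = - S' - (1 / real n) *\<^sub>R pj" using S'_eq by simp
      then have "S * D' = (- S' - (1 / real n) *\<^sub>R pj) * D'" by (rule arg_cong)
      then show ?thesis by (simp add: algebra_simps Pis)
    qed
    also have "\<dots> = D' * S' - (1 / real n) *\<^sub>R D'" by (simp add: SD')
    also have "\<dots> = - (D' * S) - (2 / real n) *\<^sub>R D'"
      by (simp add: S'_eq algebra_simps Pis) (simp add: scaleR_left.add[symmetric])
    finally have "S * (D' * C j) = - (D' * (S * C j)) - (2 / real n) *\<^sub>R (D' * C j)"
      by (simp add: mult.assoc[symmetric]) (simp add: algebra_simps)
    also have "\<dots> = (- chain_ev n j - 2 / real n) *\<^sub>R (D' * C j)"
      by (simp add: Suc scaleR_left_diff_distrib)
    also have "- chain_ev n j - 2 / real n = chain_ev n (Suc j)"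
      using True npos by (simp add: chain_ev_def field_simps)
    finally show ?thesis using True by (simp add: X_def)
  next
    case False
    have "S * (D * C j) = - (D * (S * C j))" by (metis SD(2) minus_mult_left mult.assoc)
    moreover have "- chain_ev n j = chain_ev n (Suc j)" using False by (simp add: chain_ev_def minus_divide_left)
    ultimately show ?thesis using False by (simp add: Suc X_def scaleR_minus_left[symmetric] del: scaleR_minus_left)
  qed
  then show ?case by simp
qed

lemma C_sized: "sized d d (C j)"
  by (induction j) (auto simp: e0_sized X_def sized_ops sized_times[OF inbs(2)] sized_times[OF inbs(4)])

lemma C_e0: "C j * e0 = C j"
  by (induction j) (auto simp: e0_e0 mult.assoc)

lemma C_rho: "C j * rho = rho * C j"
proof (induction j)
  case (Suc j)
  then show ?case by (simp add: X_def rhos mult.assoc) (simp add: rhos mult.assoc[symmetric])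
qed (simp add: e0_rho)

lemma X_star: "star (X j) = X j" by (simp add: X_def stars)

lemma X_X_C: "X j * (X j * C j) = (1 - (real (Suc j) / real n)\<^sup>2) *\<^sub>R C j"
proof (cases "even j")
  case True
  have S'C: "S' * C j = (- chain_ev n j - 1 / real n) *\<^sub>R C j"
    by (simp add: S'_eq algebra_simps S_C Pi_C)
  have "X j * (X j * C j) = D' * D' * C j" using True by (simp add: X_def mult.assoc)
  also have "D' * D' = pj - S' * S'" using SD'(1) by (simp add: algebra_simps)
  also have "(pj - S' * S') * C j = C j - S' * (S' * C j)" by (simp add: algebra_simps Pi_C mult.assoc)
  also have "\<dots> = (1 - (- chain_ev n j - 1 / real n) * (- chain_ev n j - 1 / real n)) *\<^sub>R C j"
    by (simp add: S'C scaleR_left_diff_distrib[of 1])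
  also have "(- chain_ev n j - 1 / real n) * (- chain_ev n j - 1 / real n) = (real (Suc j) / real n)\<^sup>2"
    using True by (simp add: chain_ev_def power2_eq_square algebra_simps add_divide_distrib)
  finally show ?thesis .
next
  case False
  have "X j * (X j * C j) = D * D * C j" using False by (simp add: X_def mult.assoc)
  also have "D * D = pj - S * S" using SD(1) by (simp add: algebra_simps)
  also have "(pj - S * S) * C j = C j - S * (S * C j)" by (simp add: algebra_simps Pi_C mult.assoc)
  also have "\<dots> = (1 - chain_ev n j * chain_ev n j) *\<^sub>R C j"
    by (simp add: S_C scaleR_left_diff_distrib[of 1])
  also have "chain_ev n j * chain_ev n j = (real (Suc j) / real n)\<^sup>2"
    using False by (simp add: chain_ev_def power2_eq_square) (simp add: algebra_simps)
  finally show ?thesis .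
qed

text \<open>\<open>X j\<close> squared multiplies \<open>C j\<close> by the square of
  \<open>chain_coeff n j\<close>, which the definition of \<open>C\<close> divides out, so each
  \<open>C j\<close> is a partial isometry with initial space ker \<open>S\<close>. Up to index
  \<open>n - 1\<close> no division by zero has occurred.\<close>

lemma C_norm: "j < n \<Longrightarrow> star (C j) * C j = e0"
proof (induction j)
  case 0
  then show ?case by (simp add: e0_star e0_e0)
next
  case (Suc j)
  then have s: "chain_coeff n j > 0" "(chain_coeff n j)\<^sup>2 = 1 - (real (Suc j) / real n)\<^sup>2" using chain_coeff_pos[of j n] chain_coeff_sq[of j n] by simp_all
  have "star (C (Suc j)) * C (Suc j) = (1 / (chain_coeff n j)\<^sup>2) *\<^sub>R (star (C j) * (X j * (X j * C j)))"
    by (simp add: star_scaleR star_times X_star mult.assoc power2_eq_square)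
  also have "\<dots> = ((1 / (chain_coeff n j)\<^sup>2) * (chain_coeff n j)\<^sup>2) *\<^sub>R (star (C j) * C j)"
    unfolding X_X_C s(2)[symmetric] by simp
  also have "\<dots> = e0" using s(1) Suc by simp
  finally show ?case .
qed

text \<open>The two ranges are eigenspaces of the Hermitian \<open>S\<close> for distinct
  eigenvalues.\<close>

lemma C_orth: "j \<noteq> l \<Longrightarrow> star (C j) * C l = 0"
proof -
  assume jl: "j \<noteq> l"
  have "star (S * C j) * C l = star (C j) * (S * C l)" by (simp add: star_times stars mult.assoc)
  then have "(chain_ev n j - chain_ev n l) *\<^sub>R (star (C j) * C l) = 0"
    by (simp add: S_C star_scaleR scaleR_left_diff_distrib)
  moreover have "chain_ev n j - chain_ev n l \<noteq> 0" using chain_ev_inj[OF npos] jl by auto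
  ultimately show ?thesis by simp
qed

lemma C_C: "j < n \<Longrightarrow> star (C j) * C l = (if j = l then e0 else 0)"
  using C_norm C_orth by auto

lemma X_C_up: "Suc j < n \<Longrightarrow> X j * C j = chain_coeff n j *\<^sub>R C (Suc j)"
  using chain_coeff_pos[of j n] by simp

text \<open>Here \<open>X j\<close> squared acts by \<open>1 - (n/n)^2 = 0\<close>, and a Hermitian
  operator whose square kills \<open>C j\<close> kills it as well.\<close>

lemma X_C_last: "Suc j = n \<Longrightarrow> X j * C j = 0"
proof -
  assume j: "Suc j = n"
  have "star (X j * C j) * (X j * C j) = star (C j) * (X j * (X j * C j))"
    by (simp add: star_times X_star mult.assoc)
  also have "\<dots> = 0" unfolding X_X_C using j npos by (simp add: j[symmetric])
  finally show ?thesis by (rule star_self_0)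
qed

lemma X_C_down: "Suc j < n \<Longrightarrow> X j * C (Suc j) = chain_coeff n j *\<^sub>R C j"
proof -
  assume j: "Suc j < n"
  have "X j * C (Suc j) = (1 / chain_coeff n j) *\<^sub>R (X j * (X j * C j))" by simp
  also have "\<dots> = (1 / chain_coeff n j * (chain_coeff n j)\<^sup>2) *\<^sub>R C j"
    unfolding X_X_C using chain_coeff_sq[of j n] j by simp
  finally show ?thesis using chain_coeff_pos[OF j] by (simp add: power2_eq_square)
qed

section \<open>The state \<open>tau\<close> and the rigidity of the chain\<close>

definition "tau Z = tr (star Psi * (Z * Psi))"

lemma tau_rho: "tau Z = tr (Z * rho)"
  by (simp add: tau_def rho_def tr_comm[of "star Psi"] mult.assoc)

text \<open>A factor can be cycled around the state as soon as that factor commutes with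
  \<open>rho\<close>.\<close>

lemma tau_comm: "Y * rho = rho * Y \<Longrightarrow> tau (Y * Z) = tau (Z * Y)"
proof -
  assume "Y * rho = rho * Y"
  then have "tr (Z * Y * rho) = tr (Z * rho * Y)" by (simp add: mult.assoc)
  also have "\<dots> = tr (Y * (Z * rho))" by (rule tr_comm)
  finally show ?thesis by (simp add: tau_rho mult.assoc)
qed

lemma tau_simps: "tau (A + B) = tau A + tau B" "tau (A - B) = tau A - tau B"
  "tau (- A) = - tau A" "tau (c *\<^sub>R A) = of_real c * tau A" "tau (sum f I) = (\<Sum>j\<in>I. tau (f j))"
  by (simp_all add: tau_rho algebra_simps tr_simps sum_distrib_right)

lemma tau_nrm2: "tau (star Z * Z) = of_real (nrm2 (Z * Psi))"
  by (simp add: tau_def tr_star_self[symmetric] star_times mult.assoc)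

lemma tau_Pi: "tau pj = 1" by (simp add: tau_def Pi_Psi tr_Psi)

lemma tau_D: "tau D = of_real (eps / real n)"
proof -
  have "D * Psi = (M 0 - M 1) * Psi" by (simp add: D_def algebra_simps m_Psi)
  then show ?thesis using tr_D by (simp add: tau_def)
qed

text \<open>Off the kernel of \<open>S\<close>, the operator \<open>D\<close> anticommutes with an invertible one and so has trace zero.\<close>

lemma tau_D_e0: "tau (D * e0) = of_real (eps / real n)"
proof -
  \<comment> \<open>\<open>T + e0\<close> is invertible, and its inverse \<open>Y\<close> inverts
    \<open>T\<close> off ker \<open>T\<close>.\<close>
  have "sized d d (T + e0)" by (intro sized_ops inbs e0_sized)
  moreover have "v = 0" if v: "sized d 1 v" "(T + e0) * v = 0" for v
  proof -
    have "e0 * ((T + e0) * v) = 0" by (simp add: v)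
    then have ev: "e0 * v = 0" by (simp add: algebra_simps) (simp add: mult.assoc[symmetric] e0_T e0_e0)
    then have "T * v = 0" using v(2) by (simp add: algebra_simps)
    then show ?thesis using e0_ker[OF v(1)] ev by simp
  qed
  ultimately obtain Y where Y: "sized d d Y" "(T + e0) * Y = idm d" "Y * (T + e0) = idm d"
    using inverse_ex by blast
  have "e0 * ((T + e0) * Y) = e0" by (simp add: Y idm_right[OF e0_sized])
  then have "e0 * Y = e0" by (simp add: algebra_simps) (simp add: mult.assoc[symmetric] e0_T e0_e0)
  then have TY: "T * Y = idm d - e0" using Y(2) by (simp add: algebra_simps)
  have "(Y * (T + e0)) * e0 = e0" by (simp add: Y idm_left[OF e0_sized])
  then have "Y * e0 = e0" by (simp add: algebra_simps mult.assoc T_e0 e0_e0)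
  then have YT: "Y * T = idm d - e0" using Y(3) by (simp add: algebra_simps)
  have YS: "Y * S = pj - e0"
    using arg_cong[OF YT, of "\<lambda>z. z * pj"] by (simp add: mult.assoc Pi_T algebra_simps idm_left[OF Pi_sized] e0_Pi)
  have DT: "D * T = D * S" using Pis(6) Pi_T(1) by (metis mult.assoc)
  have DS: "D * S = - (S * D)" by (simp add: SD)
  \<comment> \<open>Cyclicity moves the leading \<open>S\<close> of \<open>- S D Y\<close> to the
    right end, where \<open>Y * S = pj - e0\<close> restores \<open>D - D * e0\<close>. The value of
    \<open>tau\<close> there equals its own negative.\<close>
  have "D - D * e0 = D * (T * Y)" by (simp add: TY algebra_simps idm_right[OF inbs(2)])
  also have "\<dots> = - (S * (D * Y))" by (simp add: mult.assoc[symmetric] DT DS)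
  finally have "tau (D - D * e0) = - tau (S * (D * Y))" by (simp add: tau_simps)
  also have "\<dots> = - tau (D * (Y * S))" using tau_comm[OF rhos(1)] by (simp add: mult.assoc)
  also have "\<dots> = - tau (D - D * e0)" by (simp add: YS algebra_simps Pis)
  finally have "tau (D - D * e0) = 0" by (simp add: complex_eq_iff)
  then show ?thesis by (simp add: tau_simps tau_D)
qed

definition "Q = (\<Sum>j<n. C j * star (C j))"

lemma C_star_rho: "star (C j) * rho = rho * star (C j)"
  by (metis C_rho rho_star star_times)

lemma tau_CC: "j < n \<Longrightarrow> tau (C j * star (C j)) = tau e0"
  using tau_comm[OF C_rho] C_norm by simp

lemma Q_Q: "Q * Q = Q"
proof -
  have "Q * Q = (\<Sum>j<n. \<Sum>l<n. C j * ((star (C j) * C l) * star (C l)))"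
    by (simp add: Q_def sum_product mult.assoc)
  also have "\<dots> = (\<Sum>j<n. \<Sum>l<n. if l = j then C j * star (C j) else 0)"
  proof (intro sum.cong refl)
    fix j l assume "j \<in> {..<n}" "l \<in> {..<n}"
    then show "C j * ((star (C j) * C l) * star (C l)) = (if l = j then C j * star (C j) else 0)"
      by (simp add: C_C) (simp add: mult.assoc[symmetric] C_e0)
  qed
  finally show ?thesis by (simp add: Q_def)
qed

lemma Q_star: "star Q = Q" by (simp add: Q_def star_simps)
lemma Pi_Q: "pj * Q = Q" by (simp add: Q_def sum_distrib_left mult.assoc[symmetric] Pi_C)
lemma Q_Pi: "Q * pj = Q" by (metis Pi_Q Q_star Pi_star star_times)

lemma D_D_e0: "D * (D * e0) = e0"
proof -
  have "D * D = pj - S * S" using SD(1) by (simp add: algebra_simps)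
  then have "D * D * e0 = (pj - S * S) * e0" by simp
  then show ?thesis by (simp add: algebra_simps Pi_e0 S_e0 mult.assoc)
qed

lemma rigidity: "tau e0 = of_real (1 / real n)" "D * e0 = eps *\<^sub>R e0" "Q = pj"
proof -
  define t where "t = nrm2 (e0 * Psi)"
  have t: "tau e0 = of_real t" using tau_nrm2[of e0] by (simp add: t_def e0_star e0_e0)
  \<comment> \<open>\<open>pj - Q\<close> is a projection, so \<open>tau\<close> of it is a squared
    norm; this yields the upper bound \<open>n * t <= 1\<close>.\<close>
  have "of_real (nrm2 ((pj - Q) * Psi)) = tau (pj - Q)"
    unfolding tau_nrm2[symmetric] by (simp add: star_diff Pi_star Q_star algebra_simps Pi_Pi Pi_Q Q_Pi Q_Q)
  also have "\<dots> = of_real (1 - real n * t)"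
    by (simp add: tau_simps tau_Pi) (simp add: Q_def tau_simps tau_CC t)
  finally have 1: "nrm2 ((pj - Q) * Psi) = 1 - real n * t" by (metis of_real_eq_iff)
  \<comment> \<open>On ker \<open>S\<close> the operator \<open>eps * D\<close> is a Hermitian
    involution, so \<open>u\<close> is twice the projection onto its eigenspace for -1.
    Nonnegativity of \<open>tau u\<close> is the lower bound on \<open>t\<close>.\<close>
  define u where "u = e0 - eps *\<^sub>R (D * e0)"
  have uu: "star u * u = 2 *\<^sub>R u"
  proof -
    have su: "star u = u" by (simp add: u_def star_simps e0_star stars e0_D)
    have "D * e0 * (D * e0) = e0"
      by (metis D_D_e0 e0_D e0_e0 mult.assoc)
    moreover have "D * e0 * e0 = D * e0" by (simp add: mult.assoc e0_e0)
    moreover from this have "e0 * (D * e0) = D * e0" by (metis e0_D mult.assoc)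
    ultimately have w: "w * w = e0" "w * e0 = w" "e0 * w = w" if "w = eps *\<^sub>R (D * e0)" for w
      using eps that by simp_all
    have "u * u = 2 *\<^sub>R u"
      unfolding u_def scaleR_2 by (simp only: left_diff_distrib right_diff_distrib w[OF refl] e0_e0) simp
    then show ?thesis by (simp add: su)
  qed
  have "of_real (nrm2 (u * Psi)) = tau (2 *\<^sub>R u)" unfolding tau_nrm2[symmetric] uu ..
  also have "\<dots> = of_real (2 * (t - eps * (eps / real n)))"
    by (simp add: u_def tau_simps tau_D_e0 t)
  finally have "nrm2 (u * Psi) = 2 * (t - eps * (eps / real n))" by (metis of_real_eq_iff)
  then have 2: "nrm2 (u * Psi) = 2 * (t - 1 / real n)" using eps by simp
  have "real n * t \<le> 1" using 1 nrm2_nonneg[of "(pj - Q) * Psi"] by simp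
  moreover have "1 / real n \<le> t" using 2 nrm2_nonneg[of "u * Psi"] by simp
  ultimately have "t = 1 / real n"
    using npos by (auto simp: field_simps intro: antisym)
  then show "tau e0 = of_real (1 / real n)" using t by simp
  have "nrm2 (u * Psi) \<le> 0" "nrm2 ((pj - Q) * Psi) \<le> 0"
    using 1 2 \<open>t = 1 / real n\<close> npos by simp_all
  then have "u * Psi = 0" "(pj - Q) * Psi = 0" using nrm2_le_0 by blast+
  then have "u * pj = 0" "(pj - Q) * pj = 0" using ext0 by blast+
  then have u0: "e0 = eps *\<^sub>R (D * e0)" and "Q = pj"
    by (simp_all add: u_def algebra_simps Pi_Pi Q_Pi mult.assoc e0_Pi)
  show "Q = pj" by fact
  have "eps *\<^sub>R e0 = (eps * eps) *\<^sub>R (D * e0)" using u0 by (metis scaleR_scaleR)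
  then show "D * e0 = eps *\<^sub>R e0" by (simp add: eps)
qed

lemma D_C: "l < n \<Longrightarrow> D * C l = (\<Sum>j<n. dodd n eps j l *\<^sub>R C j)"
proof (cases "l = 0")
  case True
  then have "(\<Sum>j<n. dodd n eps j l *\<^sub>R C j) = (if 0 < n then dodd n eps 0 l *\<^sub>R C 0 else 0)"
    by (intro sum_single) (auto simp: dodd_def)
  then show ?thesis using True npos rigidity(2) by (simp add: dodd_def)
next
  case l0: False
  assume l: "l < n"
  show ?thesis
  proof (cases "odd l")
    case True
    then have "(\<Sum>j<n. dodd n eps j l *\<^sub>R C j) = (if Suc l < n then dodd n eps (Suc l) l *\<^sub>R C (Suc l) else 0)"
      by (intro sum_single) (auto simp: dodd_def)
    moreover have "D = X l" using True by (simp add: X_def)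
    \<comment> \<open>At the top of the chain, \<open>Suc l = n\<close>, the sum has no nonzero term
      and \<open>X_C_last\<close> supplies the matching zero.\<close>
    ultimately show ?thesis
      using X_C_up[of l] X_C_last[of l] l True by (auto simp: dodd_def simp del: C.simps)
  next
    case False
    obtain i where i: "l = Suc i" using l0 by (cases l) auto
    have "(\<Sum>j<n. dodd n eps j l *\<^sub>R C j) = (if i < n then dodd n eps i l *\<^sub>R C i else 0)"
      using False i by (intro sum_single) (auto simp: dodd_def)
    moreover have "D = X i" using False i by (simp add: X_def)
    ultimately show ?thesis
      using X_C_down[of i] l False i by (auto simp: dodd_def simp del: C.simps)
  qed
qed

lemma D'_C: "l < n \<Longrightarrow> D' * C l = (\<Sum>j<n. deven n j l *\<^sub>R C j)"
proof (cases "even l")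
  case True
  assume l: "l < n"
  from True have "(\<Sum>j<n. deven n j l *\<^sub>R C j) = (if Suc l < n then deven n (Suc l) l *\<^sub>R C (Suc l) else 0)"
    by (intro sum_single) (auto simp: deven_def)
  moreover have "D' = X l" using True by (simp add: X_def)
  ultimately show ?thesis
    using X_C_up[of l] X_C_last[of l] l True by (auto simp: deven_def simp del: C.simps)
next
  case False
  assume l: "l < n"
  obtain i where i: "l = Suc i" using False by (cases l) auto
  have "(\<Sum>j<n. deven n j l *\<^sub>R C j) = (if i < n then deven n i l *\<^sub>R C i else 0)"
    using False i by (intro sum_single) (auto simp: deven_def)
  moreover have "D' = X i" using False i by (simp add: X_def)
  ultimately show ?thesis
    using X_C_down[of i] l False i by (auto simp: deven_def simp del: C.simps)
qed

lemma diag_C: "l < n \<Longrightarrow> (\<Sum>j<n. (if j = l then c else 0) *\<^sub>R C j) = c *\<^sub>R C l"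
  by (subst sum_single[where j = l]) auto

lemma m_C:
  assumes i: "i < 4" and l: "l < n"
  shows "m i * C l = (\<Sum>j<n. act_coeff n eps i j l *\<^sub>R C j)"
proof -
  let ?a = "1 + chain_ev n l" and ?b = "1 - 1 / real n - chain_ev n l"
  have S'C: "S' * C l = (- chain_ev n l - 1 / real n) *\<^sub>R C l"
    by (simp add: S'_eq algebra_simps S_C Pi_C)
  have "m 0 = (1 / 2) *\<^sub>R (pj + S + D)" "m 1 = (1 / 2) *\<^sub>R (pj + S - D)"
    "m 2 = (1 / 2) *\<^sub>R (pj + S' + D')" "m 3 = (1 / 2) *\<^sub>R (pj + S' - D')"
    by (simp_all add: S_def D_def S'_def D'_def scaleR_2[symmetric])
  then have "m 0 * C l = (1 / 2) *\<^sub>R (?a *\<^sub>R C l + D * C l)" "m 1 * C l = (1 / 2) *\<^sub>R (?a *\<^sub>R C l - D * C l)"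
    "m 2 * C l = (1 / 2) *\<^sub>R (?b *\<^sub>R C l + D' * C l)" "m 3 * C l = (1 / 2) *\<^sub>R (?b *\<^sub>R C l - D' * C l)"
    by (simp_all add: distrib_right left_diff_distrib Pi_C S_C S'C scaleR_left_distrib scaleR_left_diff_distrib)
  moreover have "(\<Sum>j<n. act_coeff n eps 0 j l *\<^sub>R C j) = (1 / 2) *\<^sub>R (?a *\<^sub>R C l + D * C l)"
    unfolding D_C[OF l] diag_C[OF l, symmetric] scaleR_right.sum sum.distrib[symmetric]
    by (intro sum.cong) (simp_all add: act_coeff_def scaleR_left_distrib[symmetric])
  moreover have "(\<Sum>j<n. act_coeff n eps 1 j l *\<^sub>R C j) = (1 / 2) *\<^sub>R (?a *\<^sub>R C l - D * C l)"
    unfolding D_C[OF l] diag_C[OF l, symmetric] scaleR_right.sum sum_subtractf[symmetric]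
    by (intro sum.cong) (simp_all add: act_coeff_def scaleR_left_diff_distrib[symmetric])
  moreover have "(\<Sum>j<n. act_coeff n eps 2 j l *\<^sub>R C j) = (1 / 2) *\<^sub>R (?b *\<^sub>R C l + D' * C l)"
    unfolding D'_C[OF l] diag_C[OF l, symmetric] scaleR_right.sum sum.distrib[symmetric]
    by (intro sum.cong) (simp_all add: act_coeff_def scaleR_left_distrib[symmetric])
  moreover have "(\<Sum>j<n. act_coeff n eps 3 j l *\<^sub>R C j) = (1 / 2) *\<^sub>R (?b *\<^sub>R C l - D' * C l)"
    unfolding D'_C[OF l] diag_C[OF l, symmetric] scaleR_right.sum sum_subtractf[symmetric]
    by (intro sum.cong) (simp_all add: act_coeff_def scaleR_left_diff_distrib[symmetric])
  moreover have "i = 0 \<or> i = 1 \<or> i = 2 \<or> i = 3" using i by auto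
  ultimately show ?thesis by auto
qed

end

section \<open>Effects and the spectral threshold\<close>

text \<open>\<open>Y\<close> may have any number of columns, so that positivity applies directly to
  a state matrix; \<open>psdFI\<close> reduces the check to single columns.\<close>

definition psdF :: "nat \<Rightarrow> fmat \<Rightarrow> bool" where
  "psdF d F \<longleftrightarrow> star F = F \<and> sized d d F \<and> (\<forall>c Y. sized d c Y \<longrightarrow> 0 \<le> Re (tr (star Y * (F * Y))))"

definition effect :: "nat \<Rightarrow> fmat \<Rightarrow> bool" where
  "effect d F \<longleftrightarrow> psdF d F \<and> psdF d (idm d - F)"

lemma effect_compl: "effect d F \<Longrightarrow> effect d (idm d - F)"
  by (simp add: effect_def)

lemma effect_sized: "effect d F \<Longrightarrow> sized d d F" and effect_star: "effect d F \<Longrightarrow> star F = F"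
  by (simp_all add: effect_def psdF_def)

text \<open>\<open>F - F\<^sup>2 = F (1 - F) F + (1 - F) F (1 - F)\<close>.\<close>

lemma effect_square_le:
  assumes F: "effect d F" and Y: "sized d c Y"
  shows "nrm2 (F * Y) \<le> Re (tr (star Y * (F * Y)))"
proof -
  note sF = effect_star[OF F] and bF = effect_sized[OF F]
  let ?G = "idm d - F"
  have iY: "idm d * Y = Y" by (rule idm_left[OF Y])
  have iFY: "idm d * (F * Z) = F * Z" for Z by (simp add: mult.assoc[symmetric] idm_left[OF bF])
  have Fi: "F * (idm d * Z) = F * Z" for Z by (simp add: mult.assoc[symmetric] idm_right[OF bF])
  have "0 \<le> Re (tr (star (F * Y) * (?G * (F * Y))))" "0 \<le> Re (tr (star (?G * Y) * (F * (?G * Y))))"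
    using F sized_times[OF bF Y] sized_times[OF _ Y, of d d ?G] bF unfolding effect_def psdF_def
    by (auto simp: sized_ops)
  then have "0 \<le> Re (tr (star (F * Y) * (?G * (F * Y)) + star (?G * Y) * (F * (?G * Y))))"
    by (simp add: tr_add)
  also have "star (F * Y) * (?G * (F * Y)) + star (?G * Y) * (F * (?G * Y))
      = star Y * (F * Y) - star (F * Y) * (F * Y)"
    by (simp add: star_times star_diff sF) (simp add: algebra_simps iY iFY Fi)
  finally show ?thesis by (simp add: nrm2_def tr_diff)
qed

text \<open>A vector on which a positive form vanishes lies in the kernel;
  \<open>effect_square_le\<close> takes the place of the square root of \<open>F\<close>.\<close>

lemma effect_zero:
  assumes "effect d F" "sized d c Y" "Re (tr (star Y * (F * Y))) \<le> 0" shows "F * Y = 0"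
  using effect_square_le[OF assms(1,2)] assms(3) by (intro nrm2_le_0) simp

section \<open>The threshold operator and its optimal effect\<close>

context quad begin

lemma Pi_sum: "(\<Sum>k<n. C k * star (C k)) = pj"
  using rigidity(3) by (simp add: Q_def)

text \<open>Eigenvalues of \<open>(2 r - 1/2) - n (m 2 + m 3)\<close> along the chain, obtained from
  \<open>m 2 + m 3 = 1 - 1/n - S\<close>.\<close>

definition "mu r j = 2 * r - 1 / 2 - (real n - 1) + real n * chain_ev n j"

lemma threshold_spectral:
  "(2 * r - 1 / 2) *\<^sub>R pj - real n *\<^sub>R (m 2 + m 3) = (\<Sum>j<n. mu r j *\<^sub>R (C j * star (C j)))"
proof -
  have "m 2 + m 3 = S' + pj" by (simp add: S'_def)
  then have "m 2 + m 3 = (1 - 1 / real n) *\<^sub>R pj - S" by (simp add: S'_eq algebra_simps)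
  then have "real n *\<^sub>R (m 2 + m 3) = (real n * (1 - 1 / real n)) *\<^sub>R pj - real n *\<^sub>R S"
    by (simp add: scaleR_right_diff_distrib)
  moreover have "real n * (1 - 1 / real n) = real n - 1" using npos by (simp add: field_simps)
  ultimately have h: "real n *\<^sub>R (m 2 + m 3) = (real n - 1) *\<^sub>R pj - real n *\<^sub>R S"
    by simp
  have "(2 * r - 1 / 2) *\<^sub>R pj - real n *\<^sub>R (m 2 + m 3)
      = (2 * r - 1 / 2 - (real n - 1)) *\<^sub>R pj + real n *\<^sub>R (S * pj)"
    unfolding h by (simp only: Pis scaleR_left_diff_distrib) simp
  also have "\<dots> = (\<Sum>j<n. mu r j *\<^sub>R (C j * star (C j)))"
    unfolding Pi_sum[symmetric] sum_distrib_left scaleR_right.sum sum.distrib[symmetric]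
    by (intro sum.cong)
      (simp_all add: mult.assoc[symmetric] S_C mu_def scaleR_left_distrib)
  finally show ?thesis .
qed

text \<open>\<open>n * chain_ev n j\<close> is an integer, so \<open>mu\<close> is an integer minus
  1/2. This is the purpose of the 1/2 in the threshold.\<close>

lemma mu_nonzero: "mu (real r) j \<noteq> 0"
proof
  assume "mu (real r) j = 0"
  then have "2 * (2 * real r - (real n - 1) + real n * chain_ev n j) = 1" by (simp add: mu_def)
  moreover obtain z :: int where "real n * chain_ev n j = of_int z"
  proof
    show "real n * chain_ev n j = of_int (if even j then int j else - int (Suc j))"
      using npos by (simp add: chain_ev_def)
  qed
  ultimately have "real_of_int (2 * (2 * int r - (int n - 1) + z)) = real_of_int 1" by simp
  then have "2 * (2 * int r - (int n - 1) + z) = 1" by (simp only: of_int_eq_iff)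
  then show False by presburger
qed

abbreviation "E j \<equiv> C j * star (C j)"

lemma E_E: "j < n \<Longrightarrow> l < n \<Longrightarrow> E j * E l = (if j = l then E j else 0)"
proof -
  assume "j < n" "l < n"
  then have "C j * (star (C j) * C l) * star (C l) = (if j = l then E j else 0)"
    by (simp add: C_C C_e0)
  then show ?thesis by (simp add: mult.assoc)
qed

lemma E_star: "star (E j) = E j" by (simp add: star_times)

lemma E_sized: "sized d d (E j)" by (rule sized_times[OF C_sized sized_star[OF C_sized]])

text \<open>\<open>E j\<close> is idempotent and commutes with \<open>rho\<close>, so a second copy
  of it can be cycled to the left of \<open>F\<close>. The result is a form that positivity of
  \<open>F\<close> controls.\<close>

lemma tr_F_E:
  assumes "j < n"
  shows "tr (star Psi * (F * (E j * Psi))) = tr (star (E j * Psi) * (F * (E j * Psi)))"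
proof -
  have "E j * rho = rho * E j" by (metis C_rho C_star_rho mult.assoc)
  then have "tau (E j * (F * E j)) = tau (F * E j * E j)" by (rule tau_comm)
  then have "tau (E j * (F * E j)) = tau (F * E j)"
    using E_E[OF assms assms] by (simp add: mult.assoc)
  then show ?thesis by (simp add: tau_def star_times mult.assoc)
qed

lemma nrm2_E: "j < n \<Longrightarrow> nrm2 (E j * Psi) = 1 / real n"
proof -
  assume j: "j < n"
  have "of_real (nrm2 (E j * Psi)) = tau (E j)"
    using tau_nrm2[of "E j"] E_E[OF j j] by (simp add: E_star)
  also have "\<dots> = of_real (1 / real n)" using tau_CC[OF j] rigidity(1) by simp
  finally show ?thesis by (metis of_real_eq_iff)
qed

lemma E_Psi_sized: "sized d k (E j * Psi)" by (rule sized_times[OF E_sized Psi_sized])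

definition "q r j = (if mu r j > 0 then 1 else 0 :: real)"

text \<open>The weight \<open>f j\<close> of \<open>F\<close> on the \<open>j\<close>-th eigenspace
  lies between 0 and \<open>1/n\<close>, the weight of the identity. As every \<open>mu\<close> is
  nonzero, the weighted sum is maximal only if each \<open>f j\<close> sits at the end of this
  interval selected by the sign of \<open>mu\<close>. Then \<open>F\<close> or its complement has
  zero form on \<open>E j * Psi\<close> and annihilates it.\<close>

lemma optimal_effect:
  assumes F: "effect d F" and mu0: "\<And>j. mu r j \<noteq> 0"
    and opt: "tr (star Psi * (F * (\<Sum>j<n. mu r j *\<^sub>R (E j * Psi)))) = of_real (\<Sum>j<n. mu r j * q r j / real n)"
  shows "F * Psi = (\<Sum>j<n. q r j *\<^sub>R (E j * Psi))"
proof -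
  define f where "f j = Re (tr (star (E j * Psi) * (F * (E j * Psi))))" for j
  note compl = effect_compl[OF F]
  have iE: "idm d * (E j * Psi) = E j * Psi" for j by (rule idm_left[OF E_Psi_sized])
  have f0: "0 \<le> f j" for j
    using F E_Psi_sized unfolding effect_def psdF_def f_def by blast
  have fc: "Re (tr (star (E j * Psi) * ((idm d - F) * (E j * Psi)))) = 1 / real n - f j" if "j < n" for j
    using nrm2_E[OF that] by (simp add: f_def left_diff_distrib right_diff_distrib tr_diff iE nrm2_def)
  have f1: "f j \<le> 1 / real n" if "j < n" for j
  proof -
    have "0 \<le> Re (tr (star (E j * Psi) * ((idm d - F) * (E j * Psi))))"
      using compl E_Psi_sized unfolding effect_def psdF_def by blast
    then show ?thesis using fc[OF that] by simp
  qed
  have "Re (tr (star Psi * (F * (\<Sum>j<n. mu r j *\<^sub>R (E j * Psi))))) = (\<Sum>j<n. mu r j * f j)"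
    by (simp add: sum_distrib_left tr_simps tr_F_E f_def)
  then have "(\<Sum>j<n. mu r j * f j) = (\<Sum>j<n. mu r j * q r j / real n)" using opt by simp
  then have "(\<Sum>j<n. mu r j * (q r j / real n - f j)) = 0"
    by (simp add: right_diff_distrib sum_subtractf)
  moreover have nn: "0 \<le> mu r j * (q r j / real n - f j)" if "j \<in> {..<n}" for j
    using f0[of j] f1[of j] that by (auto simp: q_def intro!: mult_nonneg_nonneg mult_nonpos_nonneg)
  ultimately have "\<forall>j\<in>{..<n}. mu r j * (q r j / real n - f j) = 0"
    by (subst (asm) sum_nonneg_eq_0_iff) auto
  then have fq: "f j = q r j / real n" if "j < n" for j using mu0[of j] that by auto
  have FE: "F * (E j * Psi) = q r j *\<^sub>R (E j * Psi)" if j: "j < n" for j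
  proof (cases "mu r j > 0")
    case True
    then have "(idm d - F) * (E j * Psi) = 0"
      using fc[OF j] fq[OF j] by (intro effect_zero[OF compl E_Psi_sized]) (simp add: q_def)
    then show ?thesis using True by (simp add: left_diff_distrib iE q_def)
  next
    case False
    then have "F * (E j * Psi) = 0"
      using fq[OF j] by (intro effect_zero[OF F E_Psi_sized]) (simp add: q_def f_def)
    then show ?thesis using False by (simp add: q_def)
  qed
  have "Psi = (\<Sum>j<n. E j) * Psi" by (simp add: Pi_sum Pi_Psi)
  then have "F * Psi = F * ((\<Sum>j<n. E j) * Psi)" by simp
  also have "\<dots> = (\<Sum>j<n. F * (E j * Psi))" by (simp add: sum_distrib_left sum_distrib_right)
  also have "\<dots> = (\<Sum>j<n. q r j *\<^sub>R (E j * Psi))" by (intro sum.cong) (simp_all add: FE)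
  finally show ?thesis .
qed

lemma threshold_Psi:
  "(\<Sum>j<n. mu r j *\<^sub>R (E j * Psi)) = (2 * r - 1 / 2) *\<^sub>R Psi - real n *\<^sub>R (M 2 * Psi + M 3 * Psi)"
proof -
  have "(\<Sum>j<n. mu r j *\<^sub>R (E j * Psi)) = (\<Sum>j<n. mu r j *\<^sub>R E j) * Psi"
    by (simp add: sum_distrib_right)
  then show ?thesis
    unfolding threshold_spectral[symmetric] by (simp add: algebra_simps Pi_Psi m_Psi)
qed

end

section \<open>Local dilations\<close>

text \<open>\<open>R i\<close> stands for the transposed effect of the second party, which acts on
  \<open>Psi\<close> from the right. Passing to adjoints makes the second party a
  \<open>quad\<close> with state \<open>star Psi\<close>.\<close>

locale quad_pair = A: quad dA dB n eps Psi M + B: quad dB dA n eps "star Psi" R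
  for dA dB n eps Psi M R +
  assumes MR: "i < 4 \<Longrightarrow> M i * Psi = Psi * R i"
begin

lemma Psi_PiB: "Psi * B.pj = Psi"
  by (metis B.Pi_Psi B.Pi_star star_star star_times)

lemma m_pair: "i < 4 \<Longrightarrow> A.m i * Psi = Psi * B.m i"
proof -
  assume i: "i < 4"
  have "Psi * B.m i = M i * Psi * B.pj" by (simp add: B.m_def MR[OF i] mult.assoc)
  then show ?thesis by (simp add: A.m_Psi[OF i] mult.assoc Psi_PiB)
qed

lemma SDD_pair: "A.S * Psi = Psi * B.S" "A.D * Psi = Psi * B.D" "A.D' * Psi = Psi * B.D'"
  unfolding A.S_def B.S_def A.D_def B.D_def A.D'_def B.D'_def
  by (simp_all add: algebra_simps m_pair A.Pi_Psi Psi_PiB)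

text \<open>\<open>Psi\<close> maps ker \<open>B.S\<close> into ker \<open>A.S\<close>, and
  \<open>star Psi\<close> maps in the opposite direction. By these two inclusions both sides equal
  \<open>A.e0 * Psi * B.e0\<close>.\<close>

lemma e0_pair: "A.e0 * Psi = Psi * B.e0"
proof -
  have "A.e0 * (Psi * B.e0) = Psi * B.e0"
  proof (rule A.e0_ker')
    show "sized dA dB (Psi * B.e0)" by (rule sized_times[OF A.Psi_sized B.e0_sized])
    show "A.pj * (Psi * B.e0) = Psi * B.e0" by (simp add: mult.assoc[symmetric] A.Pi_Psi)
    show "A.S * (Psi * B.e0) = 0"
      by (simp add: mult.assoc[symmetric] SDD_pair) (simp add: mult.assoc B.S_e0)
  qed
  moreover have "B.e0 * (star Psi * A.e0) = star Psi * A.e0"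
  proof (rule B.e0_ker')
    show "sized dB dA (star Psi * A.e0)" by (rule sized_times[OF B.Psi_sized A.e0_sized])
    show "B.pj * (star Psi * A.e0) = star Psi * A.e0" by (simp add: mult.assoc[symmetric] B.Pi_Psi)
    have "B.S * star Psi = star Psi * A.S"
      using arg_cong[OF SDD_pair(1), of star] by (simp add: star_times A.stars B.stars)
    then show "B.S * (star Psi * A.e0) = 0"
      by (simp add: mult.assoc[symmetric]) (simp add: mult.assoc A.S_e0)
  qed
  then have "star (B.e0 * (star Psi * A.e0)) = star (star Psi * A.e0)" by simp
  then have "A.e0 * (Psi * B.e0) = A.e0 * Psi"
    by (simp add: star_times A.e0_star B.e0_star mult.assoc)
  ultimately show ?thesis by simp
qed

lemma X_pair: "A.X j * Psi = Psi * B.X j"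
  by (simp add: A.X_def B.X_def SDD_pair)

lemma C_pair: "A.C j * Psi = Psi * B.C j"
proof (induction j)
  case (Suc j)
  have "A.X j * A.C j * Psi = Psi * (B.X j * B.C j)"
    by (simp add: mult.assoc Suc) (simp add: mult.assoc[symmetric] X_pair)
  then show ?case by simp
qed (simp add: e0_pair)

end

text \<open>\<open>v j\<close> is an orthonormal basis of \<open>C^n\<close> in which the reference
  projections have the same matrices as the two parties have along their chains.\<close>

locale dilation = quad_pair +
  fixes v :: "nat \<Rightarrow> nat \<Rightarrow> complex" and P :: "nat \<Rightarrow> nat \<Rightarrow> nat \<Rightarrow> real"
  assumes v_ortho: "j < n \<Longrightarrow> l < n \<Longrightarrow> (\<Sum>x<n. cnj (v j x) * v l x) = (if j = l then 1 else 0)"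
    and v_complete: "x < n \<Longrightarrow> y < n \<Longrightarrow> (\<Sum>j<n. v j x * cnj (v j y)) = (if x = y then 1 else 0)"
    and v_act: "i < 4 \<Longrightarrow> l < n \<Longrightarrow> x < n \<Longrightarrow>
      (\<Sum>y<n. of_real (P i x y) * v l y) = (\<Sum>j<n. of_real (act_coeff n eps i j l) * v j x)"
begin

text \<open>Moving each eigenspace back to ker \<open>S\<close> and recording its position by
  \<open>v j\<close> identifies the support with \<open>C^n\<close> tensor ker \<open>S\<close>;
  \<open>K x\<close> is the block at coordinate \<open>x\<close>. The second party uses the
  conjugate basis because the sum over \<open>j\<close> of \<open>v j\<close> tensor its conjugate
  is \<open>sqrt n\<close> times \<open>phi n\<close>.\<close>

definition "K x = (\<Sum>j<n. scaleC (v j x) (star (A.C j)))"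
definition "L x = (\<Sum>j<n. scaleC (cnj (v j x)) (B.C j))"

lemma sum_over_frame:
  fixes G :: "nat \<Rightarrow> nat \<Rightarrow> fmat"
  shows "(\<Sum>x<n. \<Sum>j<n. \<Sum>l<n. scaleC (cnj (v j x) * v l x) (G j l)) = (\<Sum>j<n. G j j)"
proof -
  have "(\<Sum>x<n. \<Sum>j<n. \<Sum>l<n. scaleC (cnj (v j x) * v l x) (G j l))
      = (\<Sum>j<n. \<Sum>l<n. scaleC (\<Sum>x<n. cnj (v j x) * v l x) (G j l))"
    unfolding scaleC_sum_left by (subst sum.swap, rule sum.cong[OF refl], rule sum.swap)
  also have "\<dots> = (\<Sum>j<n. \<Sum>l<n. if l = j then G j j else 0)"
    by (intro sum.cong refl) (auto simp: v_ortho)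
  finally show ?thesis by simp
qed

lemma K_K: "(\<Sum>x<n. star (K x) * K x) = A.pj"
proof -
  have "star (K x) * K x = (\<Sum>j<n. \<Sum>l<n. scaleC (cnj (v j x) * v l x) (A.C j * star (A.C l)))" for x
    by (simp add: K_def star_sum star_scaleC sum_product scaleC_times_left scaleC_times_right mult.commute)
  then show ?thesis by (simp only: sum_over_frame[of "\<lambda>j l. A.C j * star (A.C l)"] A.Pi_sum)
qed

lemma L_L: "(\<Sum>x<n. L x * star (L x)) = B.pj"
proof -
  have "L x * star (L x) = (\<Sum>j<n. \<Sum>l<n. scaleC (cnj (v j x) * v l x) (B.C j * star (B.C l)))" for x
    by (simp add: L_def star_sum star_scaleC sum_product scaleC_times_left scaleC_times_right mult.commute)
  then show ?thesis by (simp only: sum_over_frame[of "\<lambda>j l. B.C j * star (B.C l)"] B.Pi_sum)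
qed

text \<open>\<open>Psi\<close> intertwines the two chains, so orthogonality leaves copies of
  \<open>A.e0 * Psi\<close> only, and completeness of \<open>v\<close> sums their coefficients. In
  blocks, the state is sent to \<open>phi n\<close> tensor a multiple of
  \<open>A.e0 * Psi\<close>.\<close>

lemma K_Psi_L:
  assumes "x < n" "y < n" shows "K x * (Psi * L y) = (if x = y then A.e0 * Psi else 0)"
proof -
  have "Psi * L y = (\<Sum>l<n. scaleC (cnj (v l y)) (A.C l * Psi))"
    by (simp add: L_def sum_distrib_left scaleC_times_right C_pair)
  then have "K x * (Psi * L y) = (\<Sum>j<n. \<Sum>l<n. scaleC (v j x * cnj (v l y)) (star (A.C j) * (A.C l * Psi)))"
    by (simp only: K_def sum_product scaleC_times_left scaleC_times_right scaleC_scaleC mult.commute)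
  also have "\<dots> = (\<Sum>j<n. \<Sum>l<n. if l = j then scaleC (v j x * cnj (v j y)) (A.e0 * Psi) else 0)"
    by (intro sum.cong refl) (auto simp: mult.assoc[symmetric] A.C_C)
  also have "\<dots> = scaleC (\<Sum>j<n. v j x * cnj (v j y)) (A.e0 * Psi)" by (simp add: scaleC_sum_left)
  finally show ?thesis using v_complete[OF assms] by simp
qed

lemma K_m:
  assumes i: "i < 4" and x: "x < n"
  shows "K x * A.m i = (\<Sum>y<n. scaleC (of_real (P i x y)) (K y))"
proof -
  have Cm: "star (A.C j) * A.m i = (\<Sum>l<n. scaleC (of_real (act_coeff n eps i l j)) (star (A.C l)))" if "j < n" for j
    using arg_cong[OF A.m_C[OF i that], of star]
    by (simp add: star_times star_sum star_scaleC A.m_star[OF i] scaleR_scaleC)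
  have "K x * A.m i = (\<Sum>j<n. \<Sum>l<n. scaleC (v j x * of_real (act_coeff n eps i j l)) (star (A.C l)))"
    by (simp add: K_def sum_distrib_right scaleC_times_left Cm scaleC_sum act_coeff_sym[of n eps i])
  also have "\<dots> = (\<Sum>l<n. scaleC (\<Sum>j<n. of_real (act_coeff n eps i j l) * v j x) (star (A.C l)))"
    unfolding scaleC_sum_left by (subst sum.swap) (simp add: mult.commute)
  also have "\<dots> = (\<Sum>l<n. scaleC (\<Sum>y<n. of_real (P i x y) * v l y) (star (A.C l)))"
    by (intro sum.cong refl) (simp add: v_act[OF i _ x])
  also have "\<dots> = (\<Sum>y<n. scaleC (of_real (P i x y)) (K y))"
    unfolding scaleC_sum_left K_def scaleC_sum by (subst sum.swap) simp
  finally show ?thesis .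
qed

lemma m_L:
  assumes i: "i < 4" and x: "x < n"
  shows "B.m i * L x = (\<Sum>y<n. scaleC (of_real (P i x y)) (L y))"
proof -
  have act: "(\<Sum>y<n. of_real (P i x y) * cnj (v l y)) = (\<Sum>j<n. of_real (act_coeff n eps i j l) * cnj (v j x))"
    if "l < n" for l
    using arg_cong[OF v_act[OF i that x], of cnj] by simp
  have "B.m i * L x = (\<Sum>j<n. \<Sum>l<n. scaleC (cnj (v j x) * of_real (act_coeff n eps i j l)) (B.C l))"
    by (simp add: L_def sum_distrib_left scaleC_times_right B.m_C[OF i] scaleC_sum scaleR_scaleC act_coeff_sym[of n eps i])
  also have "\<dots> = (\<Sum>l<n. scaleC (\<Sum>j<n. of_real (act_coeff n eps i j l) * cnj (v j x)) (B.C l))"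
    unfolding scaleC_sum_left by (subst sum.swap) (simp add: mult.commute)
  also have "\<dots> = (\<Sum>l<n. scaleC (\<Sum>y<n. of_real (P i x y) * cnj (v l y)) (B.C l))"
    by (intro sum.cong refl) (simp add: act)
  also have "\<dots> = (\<Sum>y<n. scaleC (of_real (P i x y)) (L y))"
    unfolding scaleC_sum_left L_def scaleC_sum by (subst sum.swap) simp
  finally show ?thesis .
qed

text \<open>\<open>UA x\<close> is the block of the isometry \<open>U\<^sub>A\<close> with first tensor index \<open>x\<close>, and \<open>VB x\<close> is the transpose
  of the corresponding block of \<open>U\<^sub>B\<close>.  Block 0 also carries the complement of the support.\<close>

definition "UA x = K x + (if x = 0 then idm dA - A.pj else 0)"
definition "VB x = L x + (if x = 0 then idm dB - B.pj else 0)"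

lemma K_sized: "sized dA dA (K x)" unfolding K_def by (intro sized_sum sized_scaleC sized_star A.C_sized)
lemma L_sized: "sized dB dB (L x)" unfolding L_def by (intro sized_sum sized_scaleC B.C_sized)

lemma C_Pi: "A.C j * A.pj = A.C j" "B.C j * B.pj = B.C j"
  by (metis A.C_e0 A.e0_Pi mult.assoc) (metis B.C_e0 B.e0_Pi mult.assoc)

lemma K_compl: "(idm dA - A.pj) * K x = 0"
proof -
  have "A.pj * star (A.C j) = star (A.C j)" for j
    using arg_cong[OF C_Pi(1), of star] by (simp add: star_times A.Pi_star)
  then have "A.pj * K x = K x" by (simp add: K_def sum_distrib_left scaleC_times_right)
  then show ?thesis by (simp add: left_diff_distrib idm_left[OF K_sized])
qed

lemma L_compl: "L x * (idm dB - B.pj) = 0"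
proof -
  have "L x * B.pj = L x" by (simp add: L_def sum_distrib_right scaleC_times_left C_Pi)
  then show ?thesis by (simp add: right_diff_distrib idm_right[OF L_sized])
qed

lemma UA_UA: "(\<Sum>x<n. star (UA x) * UA x) = idm dA"
proof -
  let ?p = "idm dA - A.pj"
  have sp: "star ?p = ?p" by (simp add: star_diff A.Pi_star)
  have Kp: "star (K x) * ?p = 0" for x
    using arg_cong[OF K_compl, of star] by (simp add: star_times sp)
  have pp: "?p * ?p = ?p"
    by (simp add: algebra_simps A.Pi_Pi idm_left[OF A.Pi_sized] idm_right[OF A.Pi_sized])
  have "star (UA x) * UA x = star (K x) * K x + (if x = 0 then ?p else 0)" for x
    by (auto simp: UA_def star_add sp distrib_left distrib_right Kp K_compl pp)
  then have "(\<Sum>x<n. star (UA x) * UA x) = A.pj + (\<Sum>x<n. if x = 0 then ?p else 0)"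
    by (simp add: sum.distrib K_K)
  also have "(\<Sum>x<n. if x = 0 then ?p else 0) = ?p" using A.npos by simp
  finally show ?thesis by simp
qed

lemma VB_VB: "(\<Sum>x<n. VB x * star (VB x)) = idm dB"
proof -
  let ?p = "idm dB - B.pj"
  have sp: "star ?p = ?p" by (simp add: star_diff B.Pi_star)
  have Lp: "?p * star (L x) = 0" for x
    using arg_cong[OF L_compl, of star] by (simp add: star_times sp)
  have pp: "?p * ?p = ?p"
    by (simp add: algebra_simps B.Pi_Pi idm_left[OF B.Pi_sized] idm_right[OF B.Pi_sized])
  have "VB x * star (VB x) = L x * star (L x) + (if x = 0 then ?p else 0)" for x
    by (auto simp: VB_def star_add sp distrib_left distrib_right Lp L_compl pp)
  then have "(\<Sum>x<n. VB x * star (VB x)) = B.pj + (\<Sum>x<n. if x = 0 then ?p else 0)"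
    by (simp add: sum.distrib L_L)
  also have "(\<Sum>x<n. if x = 0 then ?p else 0) = ?p" using A.npos by simp
  finally show ?thesis by simp
qed

lemma UA_sized: "sized dA dA (UA x)" and VB_sized: "sized dB dB (VB x)"
  by (auto simp: UA_def VB_def sized_ops K_sized L_sized A.Pi_sized B.Pi_sized)

text \<open>In blocks: on the state, the isometry turns \<open>Z\<close> into \<open>Zp\<close>
  tensor the identity. The parties are treated separately and combined in
  \<open>dilation_identity\<close>. In \<open>simB\<close> the operator \<open>Z\<close> is a
  transposed effect, while \<open>Zp\<close> is not transposed.\<close>

definition "simA Z Zp \<longleftrightarrow> (\<forall>x<n. UA x * (Z * Psi) = (\<Sum>y<n. scaleC (Zp x y) (K y * Psi)))"
definition "simB Z Zp \<longleftrightarrow> (\<forall>x<n. Psi * Z * VB x = (\<Sum>y<n. scaleC (Zp x y) (Psi * L y)))"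

lemma UA_Pi: "A.pj * Z = Z \<Longrightarrow> sized dA c Z \<Longrightarrow> UA x * Z = K x * Z"
  by (auto simp: UA_def distrib_right left_diff_distrib idm_left)

lemma simA_m:
  assumes i: "i < 4" shows "simA (M i) (\<lambda>x y. of_real (P i x y))"
  unfolding simA_def
proof (intro allI impI)
  fix x assume x: "x < n"
  have "sized dA dB (A.m i * Psi)" by (rule sized_times[OF A.m_sized[OF i] A.Psi_sized])
  moreover have "A.pj * (A.m i * Psi) = A.m i * Psi" by (simp add: mult.assoc[symmetric] A.Pi_m[OF i])
  ultimately have "UA x * (M i * Psi) = K x * (A.m i * Psi)" by (simp add: UA_Pi A.m_Psi[OF i])
  also have "\<dots> = K x * A.m i * Psi" by (simp add: mult.assoc)
  finally show "UA x * (M i * Psi) = (\<Sum>y<n. scaleC (of_real (P i x y)) (K y * Psi))"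
    by (simp add: K_m[OF i x] sum_distrib_right scaleC_times_left)
qed

lemma simB_m:
  assumes i: "i < 4" shows "simB (R i) (\<lambda>x y. of_real (P i x y))"
  unfolding simB_def
proof (intro allI impI)
  fix x assume x: "x < n"
  have PR: "Psi * R i = Psi * B.m i" using m_pair[OF i] A.m_Psi[OF i] MR[OF i] by simp
  have "B.m i * (idm dB - B.pj) = 0"
    by (simp add: right_diff_distrib idm_right[OF B.m_sized[OF i]] B.m_Pi[OF i])
  then have "Psi * R i * VB x = Psi * (B.m i * L x)"
    by (simp add: PR VB_def distrib_left mult.assoc)
  then show "Psi * R i * VB x = (\<Sum>y<n. scaleC (of_real (P i x y)) (Psi * L y))"
    by (simp add: m_L[OF i x] sum_distrib_left scaleC_times_right)
qed

lemma sim_one: "simA (idm dA) (\<lambda>x y. if x = y then 1 else 0)" "simB (idm dB) (\<lambda>x y. if x = y then 1 else 0)"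
proof -
  show "simA (idm dA) (\<lambda>x y. if x = y then 1 else 0)"
    unfolding simA_def
  proof (intro allI impI)
    fix x assume x: "x < n"
    have "(\<Sum>y<n. scaleC (if x = y then 1 else 0) (K y * Psi)) = (\<Sum>y<n. if y = x then K x * Psi else 0)"
      by (intro sum.cong) auto
    then show "UA x * (idm dA * Psi) = (\<Sum>y<n. scaleC (if x = y then 1 else 0) (K y * Psi))"
      using x by (simp add: idm_left[OF A.Psi_sized] UA_Pi[OF A.Pi_Psi A.Psi_sized])
  qed
  show "simB (idm dB) (\<lambda>x y. if x = y then 1 else 0)"
    unfolding simB_def
  proof (intro allI impI)
    fix x assume x: "x < n"
    have "(\<Sum>y<n. scaleC (if x = y then 1 else 0) (Psi * L y)) = (\<Sum>y<n. if y = x then Psi * L x else 0)"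
      by (intro sum.cong) auto
    moreover have "Psi * VB x = Psi * L x"
      by (simp add: VB_def distrib_left right_diff_distrib idm_right[OF A.Psi_sized] Psi_PiB)
    ultimately show "Psi * idm dB * VB x = (\<Sum>y<n. scaleC (if x = y then 1 else 0) (Psi * L y))"
      using x by (simp add: idm_right[OF A.Psi_sized])
  qed
qed

lemma sim_diff:
  "simA Z Zp \<Longrightarrow> simA W Wp \<Longrightarrow> simA (Z - W) (\<lambda>x y. Zp x y - Wp x y)"
  "simB Z Zp \<Longrightarrow> simB W Wp \<Longrightarrow> simB (Z - W) (\<lambda>x y. Zp x y - Wp x y)"
proof -
  have scaleC_diff_left: "scaleC (a - b) G = scaleC a G - scaleC b G" for a b and G :: fmat
    by (rule fmat_eqI) (simp add: scaleC.rep_eq ent_simps algebra_simps)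
  show "simA Z Zp \<Longrightarrow> simA W Wp \<Longrightarrow> simA (Z - W) (\<lambda>x y. Zp x y - Wp x y)"
    "simB Z Zp \<Longrightarrow> simB W Wp \<Longrightarrow> simB (Z - W) (\<lambda>x y. Zp x y - Wp x y)"
    by (simp_all add: simA_def simB_def left_diff_distrib right_diff_distrib scaleC_diff_left sum_subtractf)
qed

text \<open>For the fifth measurement, which is diagonal along the chain on one side and in the
  basis \<open>v\<close> on the other, with the same eigenvalues.\<close>

lemma simA_spectral:
  assumes F: "F * Psi = (\<Sum>j<n. c j *\<^sub>R (A.E j * Psi))"
    and Fp: "\<And>x j. x < n \<Longrightarrow> j < n \<Longrightarrow> (\<Sum>y<n. Fp x y * v j y) = of_real (c j) * v j x"
  shows "simA F Fp"
  unfolding simA_def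
proof (intro allI impI)
  fix x assume x: "x < n"
  have KE: "K x * A.E j = scaleC (v j x) (star (A.C j))" if j: "j < n" for j
  proof -
    have "K x * A.E j = (\<Sum>l<n. scaleC (v l x) (star (A.C l) * A.C j * star (A.C j)))"
      by (simp add: K_def sum_distrib_right scaleC_times_left mult.assoc)
    also have "\<dots> = (\<Sum>l<n. if l = j then scaleC (v j x) (A.e0 * star (A.C j)) else 0)"
      by (intro sum.cong refl) (auto simp: A.C_C)
    also have "A.e0 * star (A.C j) = star (A.C j)"
      using arg_cong[OF A.C_e0, of star] by (simp add: star_times A.e0_star)
    finally show ?thesis using j by simp
  qed
  have pF: "A.pj * (F * Psi) = F * Psi"
    by (simp add: F sum_distrib_left mult.assoc[symmetric] A.Pi_C)
  have iF: "sized dA dB (F * Psi)" unfolding F by (intro sized_sum sized_ops A.E_Psi_sized)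
  have "UA x * (F * Psi) = K x * (F * Psi)" by (rule UA_Pi[OF pF iF])
  also have "\<dots> = (\<Sum>j<n. c j *\<^sub>R ((K x * A.E j) * Psi))"
    by (simp add: F sum_distrib_left mult.assoc)
  also have "\<dots> = (\<Sum>j<n. scaleC (of_real (c j) * v j x) (star (A.C j) * Psi))"
    by (intro sum.cong refl) (simp add: KE scaleR_scaleC scaleC_times_left)
  also have "\<dots> = (\<Sum>j<n. scaleC (\<Sum>y<n. Fp x y * v j y) (star (A.C j) * Psi))"
    by (intro sum.cong refl) (simp add: Fp[OF x])
  also have "\<dots> = (\<Sum>y<n. scaleC (Fp x y) (K y * Psi))"
    unfolding scaleC_sum_left K_def sum_distrib_right scaleC_times_left scaleC_sum by (subst sum.swap) simp
  finally show "UA x * (F * Psi) = (\<Sum>y<n. scaleC (Fp x y) (K y * Psi))" .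
qed

text \<open>The scalar is \<open>sqrt n\<close> times the \<open>(x, y)\<close> coordinate of
  \<open>Zp\<close> tensor \<open>Wp\<close> applied to \<open>phi n\<close>, so this is the
  equation of \<open>local_dilation\<close> block by block.\<close>

lemma dilation_identity:
  assumes Z: "simA Z Zp" and W: "simB W Wp" and "x < n" "y < n"
  shows "UA x * (Z * Psi * W) * VB y = scaleC (\<Sum>t<n. Zp x t * Wp y t) (A.e0 * Psi)"
proof -
  have 1: "UA x * (Z * Psi) = (\<Sum>t<n. scaleC (Zp x t) (K t)) * Psi"
    using Z assms(3) by (simp add: simA_def sum_distrib_right scaleC_times_left)
  have 2: "Psi * W * VB y = (\<Sum>t<n. scaleC (Wp y t) (Psi * L t))"
    using W assms(4) by (simp add: simB_def)
  have "UA x * (Z * Psi * W) * VB y = (UA x * (Z * Psi)) * W * VB y" by (simp add: mult.assoc)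
  also have "\<dots> = (\<Sum>t<n. scaleC (Zp x t) (K t)) * (Psi * W * VB y)" unfolding 1 by (simp add: mult.assoc)
  also have "\<dots> = (\<Sum>t<n. \<Sum>u<n. scaleC (Zp x t * Wp y u) (K t * (Psi * L u)))"
    unfolding 2 by (simp only: sum_product scaleC_times_left scaleC_times_right scaleC_scaleC mult.commute)
  also have "\<dots> = (\<Sum>t<n. \<Sum>u<n. if u = t then scaleC (Zp x t * Wp y t) (A.e0 * Psi) else 0)"
    by (intro sum.cong refl) (auto simp: K_Psi_L)
  finally show ?thesis by (simp add: scaleC_sum_left)
qed

end

section \<open>Trace and rank of an idempotent\<close>

text \<open>Rank factorisation: \<open>A = B * R\<close>, where the columns of \<open>B\<close> form
  a maximal independent set of columns of \<open>A\<close>. Idempotence gives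
  \<open>A * B = B\<close>, and injectivity of \<open>B\<close> then gives \<open>R * B = 1\<close>;
  cyclicity of the trace finishes. This turns the rank condition into the value of
  \<open>tau D\<close>.\<close>

lemma (in vec_space) idempotent_trace_rank:
  assumes A: "A \<in> carrier_mat n n" and idem: "A * A = A"
  shows "(\<Sum>i<n. A $$ (i, i)) = of_nat (rank A)"
proof -
  let ?cs = "set (cols A)"
  have cs: "?cs \<subseteq> carrier_vec n" using A cols_dim by blast
  obtain U where U: "maximal U (\<lambda>T. T \<subseteq> ?cs \<and> lin_indpt T)" "finite U"
    using maximal_exists_superset[of ?cs "\<lambda>T. T \<subseteq> ?cs \<and> lin_indpt T" "{}"]
    by (auto simp: finite_lin_indpt2)
  then have Ucs: "U \<subseteq> ?cs" and Uli: "lin_indpt U" by (auto simp: maximal_def)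
  have Uc: "U \<subseteq> carrier_vec n" using Ucs cs by blast
  define r where "r = card U"
  have rank: "rank A = r" using rank_card_indpt[OF A U(1)] by (simp add: r_def)
  obtain bs where bs: "set bs = U" "distinct bs" using U(2) finite_distinct_list by blast
  then have lbs: "length bs = r" using distinct_card[of bs] by (simp add: r_def)
  define B where "B = mat_of_cols n bs"
  have B: "B \<in> carrier_mat n r" using mat_of_cols_carrier(1)[of n bs] by (simp add: B_def lbs)
  have colsB: "cols B = bs" unfolding B_def using Uc bs by (intro cols_mat_of_cols) auto
  have inj: "v = 0\<^sub>v r" if "v \<in> carrier_vec r" "B *\<^sub>v v = 0\<^sub>v n" for v
    using lin_depI[OF B that(1) _ that(2)] colsB bs Uli by auto
  have "\<exists>w. w \<in> carrier_vec r \<and> B *\<^sub>v w = c" if c: "c \<in> ?cs" for c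
  proof -
    have "c \<in> span U"
    proof (cases "c \<in> U")
      case True then show ?thesis using span_mem Uc by blast
    next
      case False
      then have "\<not> lin_indpt (insert c U)"
        using U(1) c Ucs unfolding maximal_def by (metis insert_subset subset_insertI insertI1)
      then show ?thesis
        using lin_dep_iff_in_span[OF Uc Uli subsetD[OF cs c] False] by simp
    qed
    then obtain a where "lincomb a U = c" using finite_in_span[OF U(2) Uc] by blast
    then have "B *\<^sub>v vec r (\<lambda>i. a (col B i)) = c"
      using mat_mult_eq_lincomb[OF B, of a] colsB bs by simp
    then show ?thesis by (intro exI[of _ "vec r (\<lambda>i. a (col B i))"]) simp
  qed
  then obtain w where w: "\<And>c. c \<in> ?cs \<Longrightarrow> w c \<in> carrier_vec r \<and> B *\<^sub>v w c = c" by metis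
  have colA: "col A j \<in> ?cs" if "j < n" for j
    using that A by (metis carrier_matD(2) cols_length cols_nth nth_mem)
  define R where "R = mat_of_cols r (map (\<lambda>j. w (col A j)) [0..<n])"
  have R: "R \<in> carrier_mat r n" by (intro carrier_matI) (simp_all add: R_def)
  have colR: "col R j = w (col A j)" if "j < n" for j
    unfolding R_def using that w[OF colA[OF that]] by (subst col_mat_of_cols) auto
  have BR: "B * R = A"
  proof (rule mat_col_eqI)
    fix j assume "j < dim_col A"
    then have j: "j < n" using A by simp
    then show "col (B * R) j = col A j"
      using col_mult2[OF B R j] w[OF colA[OF j]] by (simp add: colR)
  qed (use A B R in auto)
  have AB: "A * B = B"
  proof (rule mat_col_eqI)
    fix j assume "j < dim_col B"
    then have j: "j < r" using B by simp
    then have "col B j \<in> ?cs" using Ucs bs colsB B by (metis carrier_matD(2) cols_length cols_nth nth_mem subsetD)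
    then obtain i where i: "i < n" "col B j = col A i"
      using A by (metis carrier_matD(2) cols_length cols_nth in_set_conv_nth)
    have "A *\<^sub>v col A i = col A i" using col_mult2[OF A A i(1)] idem by simp
    then show "col (A * B) j = col B j" using col_mult2[OF A B j] i by simp
  qed (use A B in auto)
  have RB: "R * B = 1\<^sub>m r"
  proof (rule mat_col_eqI)
    fix j assume "j < dim_col (1\<^sub>m r)"
    then have j: "j < r" by simp
    let ?v = "R *\<^sub>v col B j - unit_vec r j"
    have cB: "col B j \<in> carrier_vec n" using B j by auto
    have v: "?v \<in> carrier_vec r" using R cB by auto
    have "B *\<^sub>v (R *\<^sub>v col B j) = col B j"
      using B R cB BR AB col_mult2[OF A B j] by (simp add: assoc_mult_mat_vec[symmetric, OF B R cB])
    moreover have "B *\<^sub>v unit_vec r j = col B j"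
      using col_mult2[OF B one_carrier_mat j] B j by simp
    ultimately have "B *\<^sub>v ?v = 0\<^sub>v n"
      using B R cB by (subst mult_minus_distrib_mat_vec[OF B]) auto
    then have "?v = 0\<^sub>v r" by (rule inj[OF v])
    then have "R *\<^sub>v col B j = unit_vec r j"
      using R cB by (intro eq_vecI) (auto simp: vec_eq_iff)
    then show "col (R * B) j = col (1\<^sub>m r) j" using col_mult2[OF R B j] j by simp
  qed (use R B in auto)
  have "(\<Sum>i<n. A $$ (i, i)) = (\<Sum>i<n. \<Sum>k<r. B $$ (i, k) * R $$ (k, i))"
    unfolding BR[symmetric] using B R
    by (intro sum.cong) (auto simp: scalar_prod_def atLeast0LessThan)
  also have "\<dots> = (\<Sum>k<r. \<Sum>i<n. R $$ (k, i) * B $$ (i, k))"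
    by (subst sum.swap) (simp add: mult.commute)
  also have "\<dots> = (\<Sum>k<r. (R * B) $$ (k, k))"
    using B R by (intro sum.cong) (auto simp: scalar_prod_def atLeast0LessThan)
  also have "\<dots> = of_nat r" by (simp add: RB)
  finally show ?thesis by (simp add: rank)
qed

section \<open>Matrices of the library as finitely supported matrices\<close>

lemma unit_column_ne: "idm 1 \<noteq> 0"
  using tr_idm[of 1] by auto

lemma zero_by_columns:
  assumes "sized d c B" "\<And>v. sized c 1 v \<Longrightarrow> B * v = 0" shows "B = 0"
proof (rule ccontr)
  assume "B \<noteq> 0"
  from unit_column[OF this assms(1)] assms(2) show False using unit_column_ne by force
qed

text \<open>Polarisation: with \<open>u = B * v\<close>, the forms at \<open>u + v\<close> and
  \<open>u + i v\<close> determine both mixed terms, one of which is the squared norm of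
  \<open>u\<close>.\<close>

lemma form_zero:
  assumes B: "sized d d B" and form: "\<And>v. sized d 1 v \<Longrightarrow> tr (star v * (B * v)) = 0"
  shows "B = 0"
proof (rule zero_by_columns[OF B])
  fix v assume v: "sized d 1 v"
  let ?u = "B * v"
  have u: "sized d 1 ?u" by (rule sized_times[OF B v])
  have 1: "tr (star ?u * ?u) + tr (star v * (B * ?u)) = 0"
    using form[OF sized_ops(2)[OF u v]] form[OF u] form[OF v]
    by (simp add: star_add distrib_left distrib_right tr_add add.commute)
  have "tr (star ?u * ?u) - tr (star v * (B * ?u)) = 0"
    using form[OF sized_ops(2)[OF u sized_scaleC[OF v, of \<i>]]] form[OF u] form[OF v]
    by (simp add: star_add distrib_left distrib_right tr_add star_scaleC scaleC_times_left scaleC_times_right tr_scaleC)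
  with 1 have "tr (star ?u * ?u) = 0" by (simp add: complex_eq_iff)
  then show "?u = 0" using nrm2_le_0[of ?u] by (simp add: nrm2_def)
qed

lemma psdFI:
  assumes A: "sized d d A"
    and form: "\<And>v. sized d 1 v \<Longrightarrow> Im (tr (star v * (A * v))) = 0 \<and> 0 \<le> Re (tr (star v * (A * v)))"
  shows "psdF d A"
  unfolding psdF_def
proof (intro conjI allI impI)
  \<comment> \<open>The form of \<open>A\<close> is real, so \<open>star A - A\<close> has zero
    form.\<close>
  have "star A - A = 0"
  proof (rule form_zero)
    show "sized d d (star A - A)" by (intro sized_ops sized_star A)
    fix v assume v: "sized d 1 v"
    have "tr (star v * (star A * v)) = cnj (tr (star v * (A * v)))"
      by (simp add: tr_star[symmetric] star_times mult.assoc)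
    then show "tr (star v * ((star A - A) * v)) = 0"
      using form[OF v] by (simp add: algebra_simps tr_diff complex_eq_iff)
  qed
  then show "star A = A" by simp
  show "sized d d A" by fact
  fix c Y assume Y: "sized d c Y"
  define y where "y j = fmat_of d 1 (\<lambda>i _. ent Y i j)" for j
  have y: "sized d 1 (y j)" "ent (y j) i 0 = ent Y i j" for i j
    using sized_ent[OF Y, of i j] by (auto simp: y_def fmat_of.rep_eq)
  have "tr (star Y * (A * Y)) = (\<Sum>j<c. \<Sum>i<d. cnj (ent Y i j) * ent (A * Y) i j)"
    by (rule tr_star_times[OF Y])
  also have "\<dots> = (\<Sum>j<c. \<Sum>i<d. cnj (ent (y j) i 0) * ent (A * y j) i 0)"
    using A by (simp add: y(2) ent_times[of d d])
  also have "\<dots> = (\<Sum>j<c. tr (star (y j) * (A * y j)))"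
    by (simp add: tr_star_times[OF y(1)])
  finally show "0 \<le> Re (tr (star Y * (A * Y)))" using form[OF y(1)] by (simp add: sum_nonneg)
qed

lemma proj_effect:
  assumes "sized d d F" "is_proj F" shows "effect d F"
proof -
  have psd: "psdF d G" if "sized d d G" "is_proj G" for G
  proof -
    have "tr (star Y * (G * Y)) = tr (star (G * Y) * (G * Y))" for Y
      using that(2) by (simp add: star_times is_projD mult.assoc)
    then show ?thesis using that by (auto simp: psdF_def is_projD nrm2_def[symmetric] nrm2_nonneg)
  qed
  have "is_proj (idm d - F)"
    using assms by (simp add: is_proj_def star_diff algebra_simps idm_left idm_right)
  then show ?thesis using assms psd by (simp add: effect_def sized_ops)
qed

definition col_mat :: "complex vec \<Rightarrow> fmat" where "col_mat v = fmat_of (dim_vec v) 1 (\<lambda>i _. v $ i)"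

lemma sized_col_mat: "v \<in> carrier_vec d \<Longrightarrow> sized d 1 (col_mat v)" by (auto simp: col_mat_def)

lemma col_mat_surj: "sized d 1 u \<Longrightarrow> \<exists>v\<in>carrier_vec d. col_mat v = u"
  by (intro bexI[of _ "vec d (\<lambda>i. ent u i 0)"])
    (auto simp: col_mat_def fmat_of.rep_eq sized_def intro!: fmat_eqI)

lemma col_mat_eq_0: "v \<in> carrier_vec d \<Longrightarrow> col_mat v = 0 \<longleftrightarrow> v = 0\<^sub>v d"
proof -
  assume v: "v \<in> carrier_vec d"
  have "v $ i = ent (col_mat v) i 0" if "i < d" for i using v that by (simp add: col_mat_def fmat_of.rep_eq)
  then have "col_mat v = 0 \<Longrightarrow> v = 0\<^sub>v d" using v by (auto simp: ent_simps)
  moreover have "col_mat (0\<^sub>v d) = 0" by (rule fmat_eqI) (auto simp: col_mat_def fmat_of.rep_eq ent_simps)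
  ultimately show ?thesis by auto
qed

lemma of_mat_col_mat: "A \<in> carrier_mat m d \<Longrightarrow> v \<in> carrier_vec d \<Longrightarrow> of_mat A * col_mat v = col_mat (A *\<^sub>v v)"
  by (rule fmat_eqI)
    (auto simp: ent_times[of m d] col_mat_def of_mat_def fmat_of.rep_eq scalar_prod_def atLeast0LessThan)

lemma cinner_col_mat: "u \<in> carrier_vec d \<Longrightarrow> v \<in> carrier_vec d \<Longrightarrow> cinner u v = tr (star (col_mat u) * col_mat v)"
  by (simp add: tr_star_times[OF sized_col_mat] cinner_def) (auto simp: col_mat_def fmat_of.rep_eq)

lemma form_col_mat:
  assumes "A \<in> carrier_mat d d" "v \<in> carrier_vec d"
  shows "cinner v (A *\<^sub>v v) = tr (star (col_mat v) * (of_mat A * col_mat v))"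
proof -
  have "A *\<^sub>v v \<in> carrier_vec d" using assms by simp
  then show ?thesis by (simp add: cinner_col_mat[OF assms(2)] of_mat_col_mat[OF assms])
qed

lemma psd_of_mat: "psd d A \<longleftrightarrow> A \<in> carrier_mat d d \<and> psdF d (of_mat A)"
proof
  assume A: "psd d A"
  then have c: "A \<in> carrier_mat d d" by (simp add: psd_def)
  have "psdF d (of_mat A)"
  proof (rule psdFI)
    fix u assume "sized d 1 u"
    then obtain v where v: "v \<in> carrier_vec d" "col_mat v = u" using col_mat_surj by blast
    have "Im (cinner v (A *\<^sub>v v)) = 0 \<and> 0 \<le> Re (cinner v (A *\<^sub>v v))"
      using A v(1) unfolding psd_def by blast
    then show "Im (tr (star u * (of_mat A * u))) = 0 \<and> 0 \<le> Re (tr (star u * (of_mat A * u)))"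
      unfolding form_col_mat[OF c v(1)] v(2) .
  qed (use c in simp)
  then show "A \<in> carrier_mat d d \<and> psdF d (of_mat A)" using c by simp
next
  assume A: "A \<in> carrier_mat d d \<and> psdF d (of_mat A)"
  show "psd d A"
    unfolding psd_def
  proof (intro conjI ballI)
    fix v :: "complex vec" assume v: "v \<in> carrier_vec d"
    let ?t = "tr (star (col_mat v) * (of_mat A * col_mat v))"
    have "cnj ?t = ?t" using A by (simp add: tr_star[symmetric] star_times psdF_def mult.assoc)
    then have "Im ?t = 0" by (simp add: complex_eq_iff)
    then show "Im (cinner v (A *\<^sub>v v)) = 0" using A v form_col_mat[of A d v] by simp
    show "0 \<le> Re (cinner v (A *\<^sub>v v))"
      using A v sized_col_mat[OF v] by (auto simp: form_col_mat psdF_def)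
  qed (use A in simp)
qed

lemma of_mat_inject: "A \<in> carrier_mat m n \<Longrightarrow> B \<in> carrier_mat m n \<Longrightarrow> of_mat A = of_mat B \<longleftrightarrow> A = B"
proof -
  assume c: "A \<in> carrier_mat m n" "B \<in> carrier_mat m n"
  have "ent (of_mat Z) i j = Z $$ (i, j)" if "Z \<in> carrier_mat m n" "i < m" "j < n" for Z i j
    using that by (simp add: of_mat_def fmat_of.rep_eq)
  then have "of_mat A = of_mat B \<Longrightarrow> A = B" using c by (intro eq_matI) (auto, metis)
  then show ?thesis by auto
qed

lemma of_mat_adj: "of_mat (adj A) = star (of_mat A)"
  by (rule fmat_eqI) (auto simp: of_mat_def adj_def fmat_of.rep_eq star.rep_eq)

lemma of_mat_add: "A \<in> carrier_mat m n \<Longrightarrow> B \<in> carrier_mat m n \<Longrightarrow> of_mat (A + B) = of_mat A + of_mat B"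
  by (rule fmat_eqI) (auto simp: of_mat_def fmat_of.rep_eq ent_simps)

lemma of_mat_minus: "A \<in> carrier_mat m n \<Longrightarrow> B \<in> carrier_mat m n \<Longrightarrow> of_mat (A - B) = of_mat A - of_mat B"
  by (rule fmat_eqI) (auto simp: of_mat_def fmat_of.rep_eq ent_simps)

lemma of_mat_smult: "of_mat (c \<cdot>\<^sub>m A) = scaleC c (of_mat A)"
  by (rule fmat_eqI) (auto simp: of_mat_def fmat_of.rep_eq scaleC.rep_eq)

section \<open>The reference projections\<close>

locale frakP =
  fixes n :: nat and P :: "nat \<Rightarrow> real mat"
  assumes n1: "n \<ge> 1" and frakP: "frakP_quad n P"
begin

definition "PM i = of_mat (cplx (P (Suc i)))"
definition "Phi = (1 / sqrt (real n)) *\<^sub>R idm n"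
text \<open>The difference of the ranks of \<open>P 1\<close> and \<open>P 2\<close>; it takes the
  role of \<open>eps\<close>.\<close>

definition "sg = - ((-1) ^ n :: real)"

context fixes i :: nat assumes i: "i < 4" begin

lemma P_props: "P (Suc i) \<in> carrier_mat n n" "transpose_mat (P (Suc i)) = P (Suc i)"
  "P (Suc i) * P (Suc i) = P (Suc i)"
proof -
  have "Suc i \<in> {1..4}" using i by auto
  then have "real_orth_proj n (P (Suc i))" using frakP unfolding frakP_quad_def by blast
  then show "P (Suc i) \<in> carrier_mat n n" "transpose_mat (P (Suc i)) = P (Suc i)"
    "P (Suc i) * P (Suc i) = P (Suc i)" by (auto simp: real_orth_proj_def)
qed

lemma cplx_P: "cplx (P (Suc i)) \<in> carrier_mat n n" using P_props by (simp add: cplx_def)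

lemma PM_sized: "sized n n (PM i)" by (simp add: PM_def cplx_P)

lemma PM_ent: "x < n \<Longrightarrow> y < n \<Longrightarrow> ent (PM i) x y = of_real (P (Suc i) $$ (x, y))"
  using P_props by (simp add: PM_def of_mat_def fmat_of.rep_eq cplx_def)

lemma P_sym: "x < n \<Longrightarrow> y < n \<Longrightarrow> P (Suc i) $$ (x, y) = P (Suc i) $$ (y, x)"
  using P_props(1,2) by (metis carrier_matD index_transpose_mat(1))

lemma PM_star: "star (PM i) = PM i"
proof (rule fmat_eqI)
  fix x y
  show "ent (star (PM i)) x y = ent (PM i) x y"
    using sized_ent[OF PM_sized, of x y] sized_ent[OF PM_sized, of y x] P_sym[of x y]
    by (cases "x < n \<and> y < n") (auto simp: star.rep_eq PM_ent)
qed

lemma PM_PM: "PM i * PM i = PM i"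
proof -
  have "cplx (P (Suc i)) * cplx (P (Suc i)) = cplx (P (Suc i) * P (Suc i))"
    using P_props(1) by (simp add: cplx_def of_real_hom.mat_hom_mult)
  then show ?thesis using of_mat_mult[OF cplx_P cplx_P] by (simp add: PM_def P_props)
qed

lemma PM_tr: "tr (PM i) = of_real (real (vec_space.rank n (P (Suc i))))"
proof -
  have "tr (PM i) = of_real (\<Sum>x<n. P (Suc i) $$ (x, x))"
    by (simp add: tr_eq[of n n] PM_sized PM_ent)
  then show ?thesis using vec_space.idempotent_trace_rank[OF P_props(1,3)] by simp
qed

end

lemma PM_sum: "PM 0 + PM 1 + PM 2 + PM 3 = (2 - 1 / real n) *\<^sub>R idm n"
proof (rule fmat_eqI)
  fix x y
  show "ent (PM 0 + PM 1 + PM 2 + PM 3) x y = ent ((2 - 1 / real n) *\<^sub>R idm n) x y"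
  proof (cases "x < n \<and> y < n")
    case True
    have c: "P 1 \<in> carrier_mat n n" "P 2 \<in> carrier_mat n n" "P 3 \<in> carrier_mat n n" "P 4 \<in> carrier_mat n n"
      using P_props(1)[of 0] P_props(1)[of 1] P_props(1)[of 2] P_props(1)[of 3]
      by (simp_all add: numeral_eq_Suc)
    have "P 1 + P 2 + P 3 + P 4 = (2 - 1 / real n) \<cdot>\<^sub>m 1\<^sub>m n"
      using frakP by (simp add: frakP_quad_def)
    then have "(P 1 + P 2 + P 3 + P 4) $$ (x, y) = ((2 - 1 / real n) \<cdot>\<^sub>m 1\<^sub>m n) $$ (x, y)" by simp
    then have "P 1 $$ (x, y) + P 2 $$ (x, y) + P 3 $$ (x, y) + P 4 $$ (x, y) = (if x = y then 2 - 1 / real n else 0)"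
      using True c by (auto split: if_splits)
    moreover have "ent (PM 0) x y = P 1 $$ (x, y)" "ent (PM 1) x y = P 2 $$ (x, y)"
      "ent (PM 2) x y = P 3 $$ (x, y)" "ent (PM 3) x y = P 4 $$ (x, y)"
      using PM_ent[of 0] PM_ent[of 1] PM_ent[of 2] PM_ent[of 3] True by (simp_all add: numeral_eq_Suc)
    ultimately have "ent (PM 0 + PM 1 + PM 2 + PM 3) x y = of_real (if x = y then 2 - 1 / real n else 0)"
      by (simp only: plus_fmat.rep_eq of_real_add[symmetric])
    then show ?thesis using True by (simp add: ent_simps idm_def fmat_of.rep_eq)
  next
    case False
    have "sized n n (PM 0 + PM 1 + PM 2 + PM 3)" by (intro sized_ops PM_sized) simp_all
    moreover have "sized n n ((2 - 1 / real n) *\<^sub>R idm n)" by (intro sized_ops sized_idm)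
    ultimately show ?thesis using False by (simp add: sized_ent)
  qed
qed

lemma Phi_simps: "star Phi = Phi" "Phi * star Phi = (1 / real n) *\<^sub>R idm n"
  "sized n c Z \<Longrightarrow> Phi * Z = (1 / sqrt (real n)) *\<^sub>R Z"
  "sized c n Z \<Longrightarrow> Z * Phi = (1 / sqrt (real n)) *\<^sub>R Z"
  by (simp_all add: Phi_def star_scaleR idm_left idm_right)

lemma tr_Phi: "sized n n Z \<Longrightarrow> tr (star Phi * (Z * Phi)) = tr Z / of_nat n"
  by (simp add: Phi_simps sized_ops tr_scaleR of_real_mult[symmetric] del: of_real_mult)


text \<open>The reference quadruple with the maximally entangled state is itself an instance, so its
  adapted basis comes from the same chain.\<close>

sublocale quad n n n sg Phi PM
proof
  show "n \<ge> 1" by (rule n1)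
  show "sg * sg = 1" by (simp add: sg_def power_mult_distrib[symmetric])
  show "sized n n Phi" by (simp add: Phi_def sized_ops)
  show "sized n n (PM i)" if "i < 4" for i by (rule PM_sized[OF that])
  show "star (PM i) = PM i" if "i < 4" for i by (rule PM_star[OF that])
  show "PM i * (PM i * Phi) = PM i * Phi" if "i < 4" for i
    by (simp add: mult.assoc[symmetric] PM_PM[OF that])
  show "PM i * (Phi * star Phi) = Phi * star Phi * PM i" if "i < 4" for i
    unfolding Phi_simps(2) by (simp add: idm_left[OF PM_sized[OF that]] idm_right[OF PM_sized[OF that]])
  have "(PM 0 + PM 1 + PM 2 + PM 3) * Phi = (2 - 1 / real n) *\<^sub>R Phi"
    unfolding PM_sum Phi_def by (simp add: mult.commute)
  then show "PM 0 * Phi + PM 1 * Phi + PM 2 * Phi + PM 3 * Phi = (2 - 1 / real n) *\<^sub>R Phi"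
    by (simp add: distrib_right)
  show "tr (star Phi * Phi) = 1"
    using tr_Phi[of "idm n"] n1 by (simp add: tr_idm Phi_def)
  have "int (vec_space.rank n (P 1)) = int (n div 2) - (-1) ^ n" "vec_space.rank n (P 2) = n div 2"
    using frakP by (auto simp: frakP_quad_def)
  then have "int (vec_space.rank n (P 1)) - int (vec_space.rank n (P 2)) = - ((-1) ^ n)" by simp
  then have "real_of_int (int (vec_space.rank n (P 1)) - int (vec_space.rank n (P 2))) = real_of_int (- ((-1) ^ n))"
    by (rule arg_cong)
  then have "real (vec_space.rank n (P 1)) - real (vec_space.rank n (P 2)) = sg"
    by (simp add: sg_def)
  then have "tr (PM 0 - PM 1) = of_real sg"
    by (simp add: tr_diff PM_tr numeral_2_eq_2 of_real_diff[symmetric] del: of_real_diff of_real_of_nat_eq)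
  moreover have "sized n n (PM 0 - PM 1)" by (intro sized_ops PM_sized) simp_all
  ultimately show "tr (star Phi * ((PM 0 - PM 1) * Phi)) = of_real (sg / real n)"
    using tr_Phi[of "PM 0 - PM 1"] by simp
qed

lemma Pi_idm: "pj = idm n"
proof -
  have "(1 / sqrt (real n)) *\<^sub>R pj = Phi"
    using Pi_Psi Phi_simps(4)[OF Pi_sized] by simp
  also have "\<dots> = (1 / sqrt (real n)) *\<^sub>R idm n" by (rule Phi_def)
  finally have "(1 / sqrt (real n)) *\<^sub>R pj = (1 / sqrt (real n)) *\<^sub>R idm n" .
  then show ?thesis by (rule scaleR_left_imp_eq[rotated]) (use n1 in simp)
qed

lemma m_PM: "i < 4 \<Longrightarrow> m i = PM i"
  by (simp add: m_def Pi_idm idm_right[OF PM_sized])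

section \<open>An orthonormal basis adapted to the reference quadruple\<close>

lemma tr_e0: "tr e0 = 1"
  using rigidity(1) tr_Phi[OF e0_sized] n1 by (simp add: tau_def)

text \<open>\<open>e0\<close> has trace 1. For a unit vector in its range, subtracting the rank one
  projection leaves a projection of trace 0.\<close>

lemma e0_column: "\<exists>y. sized n 1 y \<and> star y * y = idm 1 \<and> e0 * y = y \<and> y * star y = e0"
proof -
  have "e0 \<noteq> 0" using tr_e0 by auto
  from unit_column[OF this e0_sized] obtain w where
    w: "sized n 1 w" "star (e0 * w) * (e0 * w) = idm 1" by blast
  let ?y = "e0 * w" let ?f = "?y * star ?y"
  have y: "sized n 1 ?y" by (rule sized_times[OF e0_sized w(1)])
  have ey: "e0 * ?y = ?y" by (simp add: mult.assoc[symmetric] e0_e0)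
  have f: "is_proj ?f" "tr ?f = 1" using column_proj[OF y w(2)] by auto
  have ef: "e0 * ?f = ?f" by (simp add: mult.assoc[symmetric] ey e0_e0)
  then have fe: "?f * e0 = ?f" using f(1) by (metis e0_star is_projD(1) star_times)
  have "star (e0 - ?f) * (e0 - ?f) = e0 - ?f"
    unfolding star_diff e0_star is_projD(1)[OF f(1)]
    by (simp only: left_diff_distrib right_diff_distrib e0_e0 ef fe is_projD(2)[OF f(1)]) simp
  then have "nrm2 (e0 - ?f) \<le> 0" by (simp add: nrm2_def tr_diff tr_e0 f(2))
  then have "e0 - ?f = 0" by (rule nrm2_le_0)
  then show ?thesis using y w(2) ey by (intro exI[of _ ?y]) simp
qed

definition "y0 = (SOME y. sized n 1 y \<and> star y * y = idm 1 \<and> e0 * y = y \<and> y * star y = e0)"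

lemma y0: "sized n 1 y0" "star y0 * y0 = idm 1" "e0 * y0 = y0" "y0 * star y0 = e0"
  using someI_ex[OF e0_column] unfolding y0_def by blast+

text \<open>Carrying a unit vector of the one-dimensional ker \<open>S\<close> along the chain gives
  eigenvectors of \<open>S\<close>.\<close>

definition "vk j = C j * y0"
definition "v j x = ent (vk j) x 0"

lemma vk_sized: "sized n 1 (vk j)" unfolding vk_def by (rule sized_times[OF C_sized y0(1)])

lemma vk_ortho: "j < n \<Longrightarrow> star (vk j) * vk l = (if j = l then idm 1 else 0)"
proof -
  assume j: "j < n"
  have "star (vk j) * vk l = star y0 * (star (C j) * C l) * y0"
    by (simp add: vk_def star_times mult.assoc)
  then show ?thesis using C_C[OF j, of l] y0 by (simp add: mult.assoc)
qed

lemma vk_E: "vk j * star (vk j) = E j"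
proof -
  have "vk j * star (vk j) = C j * (y0 * star y0) * star (C j)" by (simp add: vk_def star_times mult.assoc)
  then show ?thesis by (simp add: y0 C_e0)
qed

lemma v_ortho: "j < n \<Longrightarrow> l < n \<Longrightarrow> (\<Sum>x<n. cnj (v j x) * v l x) = (if j = l then 1 else 0)"
proof -
  assume j: "j < n" "l < n"
  have "(\<Sum>x<n. cnj (v j x) * v l x) = tr (star (vk j) * vk l)"
    by (simp add: tr_star_times[OF vk_sized] v_def)
  then show ?thesis using vk_ortho[OF j(1), of l] tr_idm[of 1] by simp
qed

lemma v_complete: "x < n \<Longrightarrow> y < n \<Longrightarrow> (\<Sum>j<n. v j x * cnj (v j y)) = (if x = y then 1 else 0)"
proof -
  assume xy: "x < n" "y < n"
  have "(\<Sum>j<n. v j x * cnj (v j y)) = ent (\<Sum>j<n. vk j * star (vk j)) x y"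
  proof -
    have "ent (vk j * star (vk j)) x y = v j x * cnj (v j y)" for j
      using ent_times[of n 1 "vk j" "star (vk j)" x y] vk_sized by (simp add: star.rep_eq v_def)
    then show ?thesis by (simp add: ent_sum)
  qed
  also have "(\<Sum>j<n. vk j * star (vk j)) = idm n" by (simp add: vk_E Pi_sum Pi_idm)
  finally show ?thesis using xy by (simp add: idm_def fmat_of.rep_eq)
qed

lemma op_v: "sized n n Z \<Longrightarrow> (\<Sum>y<n. ent Z x y * v l y) = ent (Z * vk l) x 0"
  by (simp add: ent_times[of n n] v_def)

lemma v_act:
  assumes "i < 4" "l < n" "x < n"
  shows "(\<Sum>y<n. of_real (P (Suc i) $$ (x, y)) * v l y) = (\<Sum>j<n. of_real (act_coeff n sg i j l) * v j x)"
proof -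
  have "(\<Sum>y<n. of_real (P (Suc i) $$ (x, y)) * v l y) = (\<Sum>y<n. ent (PM i) x y * v l y)"
    using assms by (intro sum.cong) (auto simp: PM_ent)
  also have "\<dots> = ent (PM i * vk l) x 0" by (rule op_v[OF PM_sized[OF assms(1)]])
  also have "PM i * vk l = (\<Sum>j<n. act_coeff n sg i j l *\<^sub>R vk j)"
    using m_C[OF assms(1,2)] by (simp add: m_PM[OF assms(1)] vk_def mult.assoc[symmetric] sum_distrib_right)
  finally show ?thesis by (simp add: ent_sum ent_simps v_def)
qed

section \<open>The fifth reference projection as a spectral projection\<close>

definition "J r = (complex_of_real (2 * r - 1/2)) \<cdot>\<^sub>m 1\<^sub>m n - (complex_of_real (real n)) \<cdot>\<^sub>m (cplx (P 3) + cplx (P 4))"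

lemma cplx_P34: "cplx (P 3) \<in> carrier_mat n n" "cplx (P 4) \<in> carrier_mat n n"
  using cplx_P[of 2] cplx_P[of 3] by (simp_all add: numeral_eq_Suc)

lemma J_carrier: "J r \<in> carrier_mat n n"
  unfolding J_def by (intro minus_carrier_mat smult_carrier_mat add_carrier_mat cplx_P34)

lemma J_spectral: "of_mat (J r) = (\<Sum>j<n. mu r j *\<^sub>R E j)"
proof -
  note c = cplx_P34
  have "of_mat (J r) = (2 * r - 1 / 2) *\<^sub>R idm n - real n *\<^sub>R (of_mat (cplx (P 3)) + of_mat (cplx (P 4)))"
    unfolding J_def using c
    by (subst of_mat_minus[of _ n n]) (auto simp: of_mat_add[of _ n n] of_mat_smult of_mat_one scaleR_scaleC)
  also have "of_mat (cplx (P 3)) + of_mat (cplx (P 4)) = m 2 + m 3"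
    by (simp add: m_PM) (simp add: PM_def numeral_eq_Suc)
  finally show ?thesis using threshold_spectral[of r] by (simp only: Pi_idm)
qed

lemma E_vk: "j < n \<Longrightarrow> l < n \<Longrightarrow> E j * vk l = (if j = l then vk l else 0)"
proof -
  assume j: "j < n" "l < n"
  have "E j * vk l = vk j * (star (vk j) * vk l)" by (simp add: vk_E[symmetric] mult.assoc)
  then show ?thesis using vk_ortho[OF j(1), of l] by (simp add: idm_right[OF vk_sized, simplified])
qed

lemma spectral_vk:
  assumes l: "l < n" shows "(\<Sum>j<n. c j *\<^sub>R E j) * vk l = c l *\<^sub>R vk l"
proof -
  have "(\<Sum>j<n. c j *\<^sub>R E j) * vk l = (\<Sum>j<n. if j = l then c l *\<^sub>R vk l else 0)"
    unfolding sum_distrib_right by (intro sum.cong refl) (auto simp: E_vk[OF _ l])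
  then show ?thesis using l by simp
qed

lemma determined_by_vk:
  assumes "sized n n Z" "\<And>l. l < n \<Longrightarrow> Z * vk l = c l *\<^sub>R vk l"
  shows "Z = (\<Sum>j<n. c j *\<^sub>R E j)"
proof -
  have "Z = Z * (\<Sum>j<n. vk j * star (vk j))"
    by (simp add: vk_E Pi_sum Pi_idm idm_right[OF assms(1)])
  also have "\<dots> = (\<Sum>j<n. (Z * vk j) * star (vk j))" by (simp add: sum_distrib_left mult.assoc)
  also have "\<dots> = (\<Sum>j<n. c j *\<^sub>R E j)" using assms(2) vk_E by simp
  finally show ?thesis .
qed

lemma spectral_mult: "(\<Sum>j<n. c j *\<^sub>R E j) * (\<Sum>j<n. d j *\<^sub>R E j) = (\<Sum>j<n. (c j * d j) *\<^sub>R E j)"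
proof (rule determined_by_vk)
  show "sized n n ((\<Sum>j<n. c j *\<^sub>R E j) * (\<Sum>j<n. d j *\<^sub>R E j))"
    by (rule sized_times[of n n _ n n]; intro sized_sum sized_ops E_sized)
  fix l assume "l < n"
  then show "(\<Sum>j<n. c j *\<^sub>R E j) * (\<Sum>j<n. d j *\<^sub>R E j) * vk l = (c l * d l) *\<^sub>R vk l"
    by (simp add: mult.assoc spectral_vk)
qed

lemma spectral_star: "star (\<Sum>j<n. c j *\<^sub>R E j) = (\<Sum>j<n. c j *\<^sub>R E j)"
  by (simp add: star_sum star_scaleR star_times)

lemma spectral_one: "(\<Sum>j<n. 1 *\<^sub>R E j) = idm n"
  by (simp add: Pi_sum Pi_idm)

lemma spectral_form:
  "tr (star u * ((\<Sum>j<n. c j *\<^sub>R E j) * u)) = of_real (\<Sum>j<n. c j * nrm2 (E j * u))"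
proof -
  have "tr (star u * (E j * u)) = of_real (nrm2 (E j * u))" if "j < n" for j
  proof -
    have "star (E j * u) * (E j * u) = star u * (E j * E j * u)"
      using E_star[of j] by (simp only: star_times mult.assoc)
    then show ?thesis using E_E[OF that that] by (simp add: tr_star_self[symmetric])
  qed
  then show ?thesis by (simp add: sum_distrib_left sum_distrib_right tr_sum tr_scaleR)
qed

definition "S0 r = (\<Sum>j<n. sgn (mu r j) *\<^sub>R E j)"

definition "sgn_pred r Z \<longleftrightarrow> Z \<in> carrier_mat n n \<and> adj Z = Z \<and> Z * Z = 1\<^sub>m n \<and> Z * J r = J r * Z \<and> posdef n (Z * J r)"

text \<open>Let \<open>u\<close> be the deviation of \<open>Z\<close> from
  \<open>sgn (mu r l)\<close> on \<open>vk l\<close>. It is an eigenvector of \<open>J r\<close> for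
  \<open>mu r l\<close>, and of \<open>Z\<close> for \<open>- sgn (mu r l)\<close> because
  \<open>Z\<close> squares to 1. The form of \<open>Z * J r\<close> at \<open>u\<close> is then
  nonpositive, which positive definiteness allows only for \<open>u = 0\<close>.\<close>

lemma sgn_pred_of_mat:
  assumes "sgn_pred r Z" and mu0: "\<And>j. mu r j \<noteq> 0"
  shows "of_mat Z = S0 r"
  unfolding S0_def
proof (rule determined_by_vk)
  have Z: "Z \<in> carrier_mat n n" "adj Z = Z" "Z * Z = 1\<^sub>m n" "Z * J r = J r * Z" "posdef n (Z * J r)"
    using assms unfolding sgn_pred_def by auto
  let ?s = "of_mat Z" let ?x = "of_mat (J r)"
  show sb: "sized n n ?s" using Z by simp
  have ss: "?s * ?s = idm n" using of_mat_mult[OF Z(1) Z(1)] Z(3) by (simp add: of_mat_one)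
  have sx: "?s * ?x = ?x * ?s" using of_mat_mult[OF Z(1) J_carrier] of_mat_mult[OF J_carrier Z(1)] Z(4) by metis
  fix l assume l: "l < n"
  let ?m = "mu r l"
  have xv: "?x * vk l = ?m *\<^sub>R vk l" by (simp add: J_spectral spectral_vk[OF l])
  have gg: "sgn ?m * sgn ?m = 1" using mu0[of l] by (simp add: sgn_if)
  define u where "u = ?s * vk l - sgn ?m *\<^sub>R vk l"
  have ub: "sized n 1 u" unfolding u_def by (intro sized_ops sized_times[OF sb vk_sized] vk_sized)
  have ssv: "?s * (?s * vk l) = vk l"
    by (simp add: mult.assoc[symmetric] ss) (rule idm_left[OF vk_sized])
  have "?x * (?s * vk l) = ?s * (?x * vk l)" by (simp add: mult.assoc[symmetric] sx)
  then have xu: "?x * u = ?m *\<^sub>R u" by (simp add: u_def right_diff_distrib xv scaleR_right_diff_distrib)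
  have su: "?s * u = (- sgn ?m) *\<^sub>R u"
    using gg by (simp add: u_def right_diff_distrib ssv scaleR_right_diff_distrib)
  have "u = 0"
  proof (rule ccontr)
    assume u0: "u \<noteq> 0"
    obtain w where w: "w \<in> carrier_vec n" "col_mat w = u" using col_mat_surj[OF ub] by blast
    have "w \<noteq> 0\<^sub>v n" using u0 w col_mat_eq_0 by metis
    then have "0 < Re (cinner w ((Z * J r) *\<^sub>v w))" using Z(5) w(1) by (simp add: posdef_def)
    also have "cinner w ((Z * J r) *\<^sub>v w) = tr (star u * (?s * ?x * u))"
      using form_col_mat[of "Z * J r" n w] of_mat_mult[OF Z(1) J_carrier] w Z(1) J_carrier by simp
    also have "?s * ?x * u = (- \<bar>?m\<bar>) *\<^sub>R u"
      by (simp add: mult.assoc xu su abs_sgn mult.commute)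
    also have "Re (tr (star u * ((- \<bar>?m\<bar>) *\<^sub>R u))) = - \<bar>?m\<bar> * nrm2 u"
      by (simp add: tr_simps nrm2_def)
    finally show False using nrm2_nonneg[of u] by (simp add: mult_nonneg_nonneg leD)
  qed
  then show "?s * vk l = sgn ?m *\<^sub>R vk l" by (simp add: u_def)
qed

lemma sgn_pred_S0:
  assumes mu0: "\<And>j. mu r j \<noteq> 0"
  shows "sgn_pred r (mat n n (\<lambda>(i, j). ent (S0 r) i j))"
proof -
  let ?S = "mat n n (\<lambda>(i, j). ent (S0 r) i j)"
  have c: "?S \<in> carrier_mat n n" by simp
  have S0b: "sized n n (S0 r)" unfolding S0_def by (intro sized_sum sized_ops E_sized)
  have o: "of_mat ?S = S0 r" by (rule of_mat_ent[OF S0b])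
  have SJ: "of_mat (?S * J r) = (\<Sum>j<n. \<bar>mu r j\<bar> *\<^sub>R E j)"
    unfolding of_mat_mult[OF c J_carrier] o by (simp add: S0_def J_spectral spectral_mult abs_sgn mult.commute)
  show ?thesis
    unfolding sgn_pred_def
  proof (intro conjI)
    show "?S \<in> carrier_mat n n" by simp
    have "adj ?S \<in> carrier_mat n n" by (simp add: adj_def)
    moreover have "of_mat (adj ?S) = of_mat ?S" by (simp add: of_mat_adj o) (simp add: S0_def spectral_star)
    ultimately show "adj ?S = ?S" using of_mat_inject[OF _ c] by blast
    have g: "sgn (mu r j) * sgn (mu r j) = 1" for j using mu0[of j] by (simp add: sgn_if)
    have "of_mat (?S * ?S) = S0 r * S0 r" unfolding of_mat_mult[OF c c] o ..
    also have "\<dots> = idm n" unfolding S0_def spectral_mult g by (rule spectral_one)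
    finally have "of_mat (?S * ?S) = of_mat (1\<^sub>m n)" by (simp only: of_mat_one)
    then show "?S * ?S = 1\<^sub>m n"
      by (rule iffD1[OF of_mat_inject[OF mult_carrier_mat[OF c c] one_carrier_mat]])
    have "of_mat (?S * J r) = of_mat (J r * ?S)"
      unfolding SJ of_mat_mult[OF J_carrier c] o by (simp add: S0_def J_spectral spectral_mult abs_sgn)
    then show "?S * J r = J r * ?S"
      by (rule iffD1[OF of_mat_inject[OF mult_carrier_mat[OF c J_carrier] mult_carrier_mat[OF J_carrier c]]])
    show "posdef n (?S * J r)"
      unfolding posdef_def
    proof (intro conjI ballI impI)
      show cc: "?S * J r \<in> carrier_mat n n" by (rule mult_carrier_mat[OF c J_carrier])
      fix w :: "complex vec" assume w: "w \<in> carrier_vec n" "w \<noteq> 0\<^sub>v n"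
      let ?u = "col_mat w"
      have f: "cinner w ((?S * J r) *\<^sub>v w) = of_real (\<Sum>j<n. \<bar>mu r j\<bar> * nrm2 (E j * ?u))"
        unfolding form_col_mat[OF cc w(1)] SJ spectral_form ..
      then show "Im (cinner w ((?S * J r) *\<^sub>v w)) = 0" by simp
      have nn: "0 \<le> \<bar>mu r j\<bar> * nrm2 (E j * ?u)" for j by (simp add: nrm2_nonneg)
      have "(\<Sum>j<n. \<bar>mu r j\<bar> * nrm2 (E j * ?u)) \<noteq> 0"
      proof
        assume "(\<Sum>j<n. \<bar>mu r j\<bar> * nrm2 (E j * ?u)) = 0"
        then have "\<forall>j\<in>{..<n}. \<bar>mu r j\<bar> * nrm2 (E j * ?u) = 0"
          using nn by (subst (asm) sum_nonneg_eq_0_iff) auto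
        then have "E j * ?u = 0" if "j < n" for j
          using mu0[of j] that nrm2_le_0[of "E j * ?u"] by auto
        then have "(\<Sum>j<n. E j) * ?u = 0" by (simp add: sum_distrib_right)
        then have "?u = 0" using idm_left[OF sized_col_mat[OF w(1)]] by (simp add: Pi_sum Pi_idm)
        then show False using w col_mat_eq_0 by blast
      qed
      then have "0 < (\<Sum>j<n. \<bar>mu r j\<bar> * nrm2 (E j * ?u))"
        using nn sum_nonneg[of "{..<n}" "\<lambda>j. \<bar>mu r j\<bar> * nrm2 (E j * ?u)"] by fastforce
      then show "0 < Re (cinner w ((?S * J r) *\<^sub>v w))" using f by simp
    qed
  qed
qed

lemma msgn_J:
  assumes mu0: "\<And>j. mu r j \<noteq> 0"
  shows "sgn_pred r (msgn (J r))"
proof -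
  have d: "dim_row (J r) = n" using J_carrier by blast
  have "sgn_pred r (THE Z. sgn_pred r Z)"
  proof (rule theI)
    show "sgn_pred r (mat n n (\<lambda>(i, j). ent (S0 r) i j))" by (rule sgn_pred_S0[OF mu0])
    fix Z assume Z: "sgn_pred r Z"
    have "of_mat Z = of_mat (mat n n (\<lambda>(i, j). ent (S0 r) i j))"
      using sgn_pred_of_mat[OF Z mu0] sgn_pred_of_mat[OF sgn_pred_S0[OF mu0] mu0] by simp
    then show "Z = mat n n (\<lambda>(i, j). ent (S0 r) i j)"
      using Z of_mat_inject[of Z n n "mat n n (\<lambda>(i, j). ent (S0 r) i j)"] by (simp add: sgn_pred_def)
  qed
  moreover have "msgn (J r) = (THE Z. sgn_pred r Z)"
    unfolding msgn_def sgn_pred_def d ..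
  ultimately show ?thesis by simp
qed

lemma frakQ_of_mat:
  fixes r :: nat
  shows "frakQ n r P \<in> carrier_mat n n" "of_mat (frakQ n r P) = (\<Sum>j<n. q (real r) j *\<^sub>R E j)"
proof -
  have S: "sgn_pred (real r) (msgn (J (real r)))" by (rule msgn_J) (rule mu_nonzero)
  then have c: "msgn (J (real r)) \<in> carrier_mat n n" by (simp add: sgn_pred_def)
  have Q: "frakQ n r P = (1/2) \<cdot>\<^sub>m (1\<^sub>m n + msgn (J (real r)))" by (simp add: frakQ_def J_def)
  then show "frakQ n r P \<in> carrier_mat n n" using c by simp
  have "of_mat (frakQ n r P) = (1/2) *\<^sub>R (idm n + S0 (real r))"
    unfolding Q of_mat_smult using c sgn_pred_of_mat[OF S mu_nonzero] by (simp add: of_mat_add[of _ n n] of_mat_one scaleR_scaleC)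
  also have "\<dots> = (\<Sum>j<n. (1/2) *\<^sub>R (1 *\<^sub>R E j + sgn (mu r j) *\<^sub>R E j))"
    unfolding S0_def spectral_one[symmetric] sum.distrib[symmetric] scaleR_right.sum ..
  also have "\<dots> = (\<Sum>j<n. q (real r) j *\<^sub>R E j)"
  proof (intro sum.cong refl)
    fix j
    have h: "(1/2) * (1 + sgn (mu r j)) = q (real r) j"
      using mu_nonzero[of r j] by (simp add: q_def sgn_if)
    show "(1/2) *\<^sub>R (1 *\<^sub>R E j + sgn (mu r j) *\<^sub>R E j) = q (real r) j *\<^sub>R E j"
      by (simp only: h scaleR_left_distrib[symmetric] scaleR_scaleR)
  qed
  finally show "of_mat (frakQ n r P) = (\<Sum>j<n. q (real r) j *\<^sub>R E j)" .
qed

lemma frakQ_proj: "is_proj (of_mat (frakQ n r P))"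
proof -
  have "q (real r) j * q (real r) j = q (real r) j" for j by (simp add: q_def)
  then show ?thesis unfolding frakQ_of_mat is_proj_def spectral_star spectral_mult by (simp only: refl simp_thms)
qed

lemma frakQ_v:
  assumes "l < n" "x < n"
  shows "(\<Sum>y<n. ent (of_mat (frakQ n r P)) x y * v l y) = of_real (q (real r) l) * v l x"
proof -
  have "sized n n (of_mat (frakQ n r P))" by (simp add: frakQ_of_mat(1))
  then have "(\<Sum>y<n. ent (of_mat (frakQ n r P)) x y * v l y) = ent (of_mat (frakQ n r P) * vk l) x 0" by (rule op_v)
  also have "of_mat (frakQ n r P) * vk l = q (real r) l *\<^sub>R vk l"
    unfolding frakQ_of_mat(2) by (rule spectral_vk[OF assms(1)])
  finally show ?thesis by (simp add: ent_simps v_def)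
qed

text \<open>The reference projection has full weight \<open>1/n\<close> on exactly the eigenspaces
  with positive \<open>mu\<close>, so it attains the maximum required in
  \<open>optimal_effect\<close>.\<close>

lemma frakQ_value:
  "tr (star Phi * (of_mat (frakQ n r P) * (\<Sum>j<n. mu (real r) j *\<^sub>R (E j * Phi))))
    = of_real (\<Sum>j<n. mu (real r) j * q (real r) j / real n)"
proof -
  have "of_mat (frakQ n r P) * (\<Sum>j<n. mu (real r) j *\<^sub>R (E j * Phi))
      = (\<Sum>j<n. q (real r) j *\<^sub>R E j) * (\<Sum>j<n. mu (real r) j *\<^sub>R E j) * Phi"
    unfolding frakQ_of_mat(2) by (simp add: sum_distrib_right[of _ _ Phi] mult.assoc)
  also have "\<dots> = (\<Sum>j<n. (q (real r) j * mu (real r) j) *\<^sub>R E j) * Phi"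
    by (simp only: spectral_mult)
  finally have "tr (star Phi * (of_mat (frakQ n r P) * (\<Sum>j<n. mu (real r) j *\<^sub>R (E j * Phi))))
      = tau (\<Sum>j<n. (q (real r) j * mu (real r) j) *\<^sub>R E j)"
    by (simp only: tau_def)
  also have "\<dots> = (\<Sum>j<n. of_real (q (real r) j * mu (real r) j) * of_real (1 / real n))"
    unfolding tau_simps by (intro sum.cong refl) (simp add: tau_CC rigidity(1))
  finally show ?thesis by (simp add: mult.commute)
qed

end

section \<open>Strategies with the reference correlation\<close>

lemma nrm2_diff: "nrm2 (a - b) = nrm2 a + nrm2 b - 2 * Re (tr (star a * b))"
proof -
  have "tr (star b * a) = cnj (tr (star a * b))" by (simp add: tr_star[symmetric] star_times)
  then show ?thesis by (simp add: nrm2_def star_diff left_diff_distrib right_diff_distrib tr_diff)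
qed

lemma nrm2_star: "nrm2 (star a) = nrm2 a"
  by (simp add: nrm2_def tr_comm)

text \<open>Two families appear so that, when applied, each term of the double sum pairs an operator
  of the first party with one of the second.\<close>

lemma tr_expand:
  "tr (star ((\<Sum>i\<in>I. a i) - c *\<^sub>R Z) * ((\<Sum>j\<in>I. b j) - c *\<^sub>R Z)) = (\<Sum>i\<in>I. \<Sum>j\<in>I. tr (star (a i) * b j))
     - of_real c * (\<Sum>i\<in>I. tr (star (a i) * Z)) - of_real c * (\<Sum>j\<in>I. tr (star Z * b j))
     + of_real c * of_real c * tr (star Z * Z)"
proof -
  have "tr (star (\<Sum>i\<in>I. a i) * (\<Sum>j\<in>I. b j)) = (\<Sum>i\<in>I. \<Sum>j\<in>I. tr (star (a i) * b j))"
    by (simp only: star_sum sum_product tr_sum)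
  moreover have "tr (star (\<Sum>i\<in>I. a i) * Z) = (\<Sum>i\<in>I. tr (star (a i) * Z))"
    by (simp only: star_sum sum_distrib_right tr_sum)
  moreover have "tr (star Z * (\<Sum>j\<in>I. b j)) = (\<Sum>j\<in>I. tr (star Z * b j))"
    by (simp only: sum_distrib_left tr_sum)
  ultimately show ?thesis
    by (simp add: star_diff star_scaleR left_diff_distrib right_diff_distrib tr_diff tr_scaleR)
qed

text \<open>A strategy in matrix form: \<open>B j\<close> is the transpose of the second party's
  effect. Only the effects of the first outcome are kept, so the marginals become separate
  equations.\<close>

locale matched = frakP n P for n P +
  fixes dA dB r :: nat and Ps :: fmat and A B :: "nat \<Rightarrow> fmat"
  assumes Ps_sized: "sized dA dB Ps" and Ps_unit: "tr (star Ps * Ps) = 1"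
    and A_effect: "i < 5 \<Longrightarrow> effect dA (A i)" and B_effect: "j < 4 \<Longrightarrow> effect dB (B j)"
    and corrAB: "i < 5 \<Longrightarrow> j < 4 \<Longrightarrow> tr (star Ps * (A i * Ps * B j))
      = tr (star Phi * ((if i < 4 then PM i else of_mat (frakQ n r P)) * Phi * PM j))"
    and corrA: "i < 5 \<Longrightarrow> tr (star Ps * (A i * Ps))
      = tr (star Phi * ((if i < 4 then PM i else of_mat (frakQ n r P)) * Phi))"
    and corrB: "j < 4 \<Longrightarrow> tr (star Ps * (Ps * B j)) = tr (star Phi * (Phi * PM j))"
begin

lemma Phi_comm: "i < 4 \<Longrightarrow> Phi * PM i = PM i * Phi"
  by (simp add: Phi_simps(3)[OF PM_sized] Phi_simps(4)[OF PM_sized])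

text \<open>The correlation as a matrix of inner products between two families of vectors.\<close>

lemma corr_eq: "i < 4 \<Longrightarrow> j < 4 \<Longrightarrow> tr (star (A i * Ps) * (Ps * B j)) = tr (star (PM i * Phi) * (PM j * Phi))"
  using corrAB[of i j] A_effect[of i] by (simp add: star_times effect_star PM_star Phi_comm mult.assoc)

lemma corrA_eq: "i < 4 \<Longrightarrow> tr (star (A i * Ps) * Ps) = tr (star (PM i * Phi) * Phi)"
  using corrA[of i] A_effect[of i] by (simp add: star_times effect_star PM_star mult.assoc)

lemma corrB_eq: "j < 4 \<Longrightarrow> tr (star Ps * (Ps * B j)) = tr (star Phi * (PM j * Phi))"
  using corrB[of j] by (simp add: Phi_comm)

lemma A_sized: "i < 5 \<Longrightarrow> sized dA dA (A i)" and A_star: "i < 5 \<Longrightarrow> star (A i) = A i"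
  and B_sized: "j < 4 \<Longrightarrow> sized dB dB (B j)" and B_star: "j < 4 \<Longrightarrow> star (B j) = B j"
  using A_effect B_effect effect_sized effect_star by blast+

lemma PM_form: "i < 4 \<Longrightarrow> tr (star (PM i * Phi) * (PM i * Phi)) = tr (star Phi * (PM i * Phi))"
  by (simp add: star_times PM_star mult.assoc M_idem)

text \<open>Since \<open>F^2 <= F\<close> for an effect, each squared norm is at most a marginal
  probability, and for the reference projections the two agree.\<close>

lemma bounds:
  assumes i: "i < 4"
  shows "nrm2 (A i * Ps) \<le> nrm2 (PM i * Phi)" "nrm2 (Ps * B i) \<le> nrm2 (PM i * Phi)"
proof -
  have nP: "nrm2 (PM i * Phi) = Re (tr (star Phi * (PM i * Phi)))" by (simp add: nrm2_def PM_form i)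
  have "nrm2 (A i * Ps) \<le> Re (tr (star Ps * (A i * Ps)))"
    using A_effect[of i] Ps_sized i by (intro effect_square_le) auto
  then show "nrm2 (A i * Ps) \<le> nrm2 (PM i * Phi)"
    using corrA[of i] i nP by simp
  have "nrm2 (B i * star Ps) \<le> Re (tr (star (star Ps) * (B i * star Ps)))"
    using B_effect[of i] sized_star[OF Ps_sized] i by (intro effect_square_le) auto
  also have "B i * star Ps = star (Ps * B i)" by (simp add: star_times B_star i)
  also have "tr (star (star Ps) * star (Ps * B i)) = tr (star Ps * (Ps * B i))"
    by (simp add: star_times B_star i) (metis mult.assoc tr_comm)
  finally show "nrm2 (Ps * B i) \<le> nrm2 (PM i * Phi)"
    by (simp only: nrm2_star corrB_eq[OF i] nP)
qed

text \<open>In the expanded squared distance, \<open>bounds\<close> controls both squared norms and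
  the correlation gives the mixed term; the total is at most zero.\<close>

lemma AB: "i < 4 \<Longrightarrow> A i * Ps = Ps * B i"
proof -
  assume i: "i < 4"
  have "nrm2 (A i * Ps - Ps * B i) \<le> 0"
    using bounds[OF i] corr_eq[OF i i] by (simp add: nrm2_diff) (simp add: nrm2_def)
  then show ?thesis using nrm2_le_0 by fastforce
qed

text \<open>With \<open>v = A i * Ps\<close> and \<open>w = Ps - v\<close>, the form of
  \<open>A i\<close> at \<open>w\<close> is \<open>|v|^2 - 2 |v|^2 + <v, A i v>\<close>, because the
  marginal equals \<open>|v|^2\<close>. It is at most zero by \<open>A i <= 1\<close>, so
  \<open>A i\<close> annihilates \<open>w\<close>.\<close>

lemma A_A: "i < 4 \<Longrightarrow> A i * (A i * Ps) = A i * Ps"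
proof -
  assume i: "i < 4"
  let ?w = "(idm dA - A i) * Ps" let ?v = "A i * Ps"
  have w: "?w = Ps - ?v" by (simp add: left_diff_distrib idm_left[OF Ps_sized])
  have e: "effect dA (A i)" using i by (intro A_effect) simp
  have v: "sized dA dB ?v" by (rule sized_times[OF effect_sized[OF e] Ps_sized])
  have wb: "sized dA dB ?w" unfolding w by (intro sized_ops Ps_sized v)
  have t: "tr (star Ps * ?v) = of_real (nrm2 ?v)"
    using corrA[of i] corr_eq[OF i i] i by (simp add: tr_star_self[symmetric] AB[symmetric] PM_form)
  have sv: "star Ps * (A i * ?v) = star ?v * ?v" by (simp add: star_times effect_star[OF e] mult.assoc)
  have "0 \<le> Re (tr (star ?v * ((idm dA - A i) * ?v)))"
    using effect_compl[OF e] v unfolding effect_def psdF_def by blast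
  then have le: "Re (tr (star ?v * (A i * ?v))) \<le> nrm2 ?v"
    by (simp add: left_diff_distrib right_diff_distrib idm_left[OF v] tr_diff nrm2_def)
  have "nrm2 (A i * ?w) \<le> Re (tr (star ?w * (A i * ?w)))" by (rule effect_square_le[OF e wb])
  also have "star ?w * (A i * ?w) = star Ps * ?v - star Ps * (A i * ?v) - (star ?v * ?v - star ?v * (A i * ?v))"
    unfolding w star_diff by (simp add: left_diff_distrib right_diff_distrib)
  also have "Re (tr \<dots>) \<le> 0" using le by (simp add: sv t tr_diff tr_star_self)
  finally have "A i * ?w = 0" by (rule nrm2_le_0)
  then show ?thesis unfolding w by (simp add: right_diff_distrib)
qed

lemma sum4: "(\<Sum>i<(4::nat). f i) = f 0 + f 1 + f 2 + (f 3 :: fmat)"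
  by (simp add: eval_nat_numeral)

text \<open>By \<open>AB\<close>, one copy of the defect \<open>Z\<close> can be written with the
  \<open>A i\<close> and the other with the \<open>B j\<close>. Its squared norm is then a
  combination of correlations, to which the reference assigns the value 0.\<close>

lemma A_sum: "A 0 * Ps + A 1 * Ps + A 2 * Ps + A 3 * Ps = (2 - 1 / real n) *\<^sub>R Ps"
proof -
  let ?c = "2 - 1 / real n"
  define Z where "Z = (\<Sum>i<4. A i * Ps) - ?c *\<^sub>R Ps"
  define Y where "Y = (\<Sum>i<4. PM i * Phi) - ?c *\<^sub>R Phi"
  have Z': "Z = (\<Sum>i<4. Ps * B i) - ?c *\<^sub>R Ps" by (simp add: Z_def AB)
  have "tr (star Z * Z) = tr (star ((\<Sum>i<4. A i * Ps) - ?c *\<^sub>R Ps) * ((\<Sum>i<4. Ps * B i) - ?c *\<^sub>R Ps))"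
    using Z_def Z' by simp
  also have "\<dots> = (\<Sum>i<4. \<Sum>j<4. tr (star (A i * Ps) * (Ps * B j)))
     - of_real ?c * (\<Sum>i<4. tr (star (A i * Ps) * Ps)) - of_real ?c * (\<Sum>j<4. tr (star Ps * (Ps * B j)))
     + of_real ?c * of_real ?c * tr (star Ps * Ps)"
    by (rule tr_expand)
  also have "\<dots> = (\<Sum>i<4. \<Sum>j<4. tr (star (PM i * Phi) * (PM j * Phi)))
     - of_real ?c * (\<Sum>i<4. tr (star (PM i * Phi) * Phi)) - of_real ?c * (\<Sum>j<4. tr (star Phi * (PM j * Phi)))
     + of_real ?c * of_real ?c * tr (star Phi * Phi)"
    by (simp add: corr_eq corrA_eq corrB_eq Ps_unit tr_Psi)
  also have "\<dots> = tr (star Y * Y)"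
    unfolding Y_def by (rule tr_expand[symmetric])
  also have "Y = 0" using M_sum by (simp add: Y_def sum4)
  finally have "Z = 0" using nrm2_le_0[of Z] by (simp add: nrm2_def)
  then show ?thesis by (simp add: Z_def sum4)
qed

lemma quadA: "quad dA dB n sg Ps A"
proof
  show "n \<ge> 1" by (rule n1)
  show "sg * sg = 1" by (rule eps)
  show "sized dA dB Ps" by (rule Ps_sized)
  show "tr (star Ps * Ps) = 1" by (rule Ps_unit)
  show "A 0 * Ps + A 1 * Ps + A 2 * Ps + A 3 * Ps = (2 - 1 / real n) *\<^sub>R Ps" by (rule A_sum)
  show "tr (star Ps * ((A 0 - A 1) * Ps)) = of_real (sg / real n)"
    using tr_D corrA[of 0] corrA[of 1] by (simp add: left_diff_distrib right_diff_distrib tr_diff)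
  fix i :: nat assume i: "i < 4"
  show "sized dA dA (A i)" "star (A i) = A i" using i A_sized A_star by simp_all
  show "A i * (A i * Ps) = A i * Ps" by (rule A_A[OF i])
  \<comment> \<open>\<open>A i\<close> passes through \<open>Ps\<close> as \<open>B i\<close>, is
    absorbed into an adjoint, and comes back as \<open>A i\<close> on the right.\<close>
  have "A i * (Ps * star Ps) = Ps * (B i * star Ps)" by (simp add: mult.assoc[symmetric] AB[OF i])
  also have "B i * star Ps = star (A i * Ps)" by (simp add: AB[OF i] star_times B_star[OF i])
  finally show "A i * (Ps * star Ps) = Ps * star Ps * A i"
    using i by (simp add: star_times A_star mult.assoc)
qed

lemma quadB: "quad dB dA n sg (star Ps) B"
proof
  have sA: "star (A i * Ps) = star (Ps * B i)" if "i < 4" for i using AB[OF that] by simp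
  have BP: "B i * star Ps = star Ps * A i" if "i < 4" for i
    using sA[OF that] that by (simp add: star_times A_star B_star)
  show "n \<ge> 1" by (rule n1)
  show "sg * sg = 1" by (rule eps)
  show "sized dB dA (star Ps)" by (rule sized_star[OF Ps_sized])
  show "tr (star (star Ps) * star Ps) = 1" using Ps_unit by (simp add: tr_comm)
  have "B i * star Ps = star (A i * Ps)" if "i < 4" for i
    using BP[OF that] that by (simp add: star_times A_star)
  then have "B 0 * star Ps + B 1 * star Ps + B 2 * star Ps + B 3 * star Ps
      = star (A 0 * Ps + A 1 * Ps + A 2 * Ps + A 3 * Ps)" by (simp add: star_add)
  then show "B 0 * star Ps + B 1 * star Ps + B 2 * star Ps + B 3 * star Ps = (2 - 1 / real n) *\<^sub>R star Ps"
    by (simp only: A_sum star_scaleR)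
  have tB: "tr (star (star Ps) * (B i * star Ps)) = tr (star Phi * (PM i * Phi))" if "i < 4" for i
    using corrB_eq[OF that] tr_comm[of Ps "B i * star Ps"] tr_comm[of "star Ps" "Ps * B i"] tr_comm[of "Ps * B i" "star Ps"]
    by (metis mult.assoc star_star tr_comm)
  show "tr (star (star Ps) * ((B 0 - B 1) * star Ps)) = of_real (sg / real n)"
    using tr_D tB[of 0] tB[of 1] by (simp add: left_diff_distrib right_diff_distrib tr_diff)
  fix i :: nat assume i: "i < 4"
  show "sized dB dB (B i)" "star (B i) = B i" using i B_sized B_star by simp_all
  show "B i * (B i * star Ps) = B i * star Ps"
    using arg_cong[OF A_A[OF i], of star] i by (simp add: BP star_times A_star mult.assoc[symmetric])
  show "B i * (star Ps * star (star Ps)) = star Ps * star (star Ps) * B i"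
    by (simp add: mult.assoc[symmetric] BP[OF i]) (simp add: mult.assoc AB[OF i])
qed

sublocale dil: dilation dA dB n sg Ps A B v "\<lambda>i x y. P (Suc i) $$ (x, y)"
  by (intro dilation.intro quad_pair.intro quadA quadB quad_pair_axioms.intro dilation_axioms.intro
      AB v_ortho v_complete v_act)

lemma sim_PM:
  assumes "i < 4"
  shows "dil.simA (A i) (ent (PM i))" "dil.simB (B i) (ent (PM i))"
  using dil.simA_m[OF assms] dil.simB_m[OF assms] assms unfolding dil.simA_def dil.simB_def
  by (simp_all add: PM_ent)

text \<open>The value to be maximised contains products of the fifth effect with \<open>A 2\<close>
  and \<open>A 3\<close>. Replacing these by \<open>B 2\<close> and \<open>B 3\<close> on the other
  side turns it into correlations, so it equals the optimal reference value.\<close>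

lemma sim_Q: "dil.simA (A 4) (ent (of_mat (frakQ n r P)))"
proof (rule dil.simA_spectral)
  let ?Q = "of_mat (frakQ n r P)"
  have AQ: "tr (star Ps * (A 4 * (Ps * B j))) = tr (star Phi * (?Q * (PM j * Phi)))" if "j < 4" for j
    using corrAB[of 4 j] that by (simp add: mult.assoc Phi_comm)
  have "tr (star Ps * (A 4 * (\<Sum>j<n. dil.A.mu (real r) j *\<^sub>R (dil.A.E j * Ps))))
      = (2 * real r - 1 / 2) * tr (star Ps * (A 4 * Ps))
        - n * (tr (star Ps * (A 4 * (A 2 * Ps))) + tr (star Ps * (A 4 * (A 3 * Ps))))"
    unfolding dil.A.threshold_Psi by (simp add: right_diff_distrib distrib_left tr_simps)
  also have "\<dots> = (2 * real r - 1 / 2) * tr (star Phi * (?Q * Phi))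
        - n * (tr (star Phi * (?Q * (PM 2 * Phi))) + tr (star Phi * (?Q * (PM 3 * Phi))))"
    using corrA[of 4] by (simp add: AB AQ)
  also have "\<dots> = tr (star Phi * (?Q * (\<Sum>j<n. mu (real r) j *\<^sub>R (E j * Phi))))"
    unfolding threshold_Psi by (simp add: right_diff_distrib distrib_left tr_simps)
  also have "\<dots> = of_real (\<Sum>j<n. mu (real r) j * q (real r) j / real n)" by (rule frakQ_value)
  finally have opt: "tr (star Ps * (A 4 * (\<Sum>j<n. dil.A.mu (real r) j *\<^sub>R (dil.A.E j * Ps))))
      = of_real (\<Sum>j<n. dil.A.mu (real r) j * dil.A.q (real r) j / real n)" .
  show "A 4 * Ps = (\<Sum>j<n. dil.A.q (real r) j *\<^sub>R (dil.A.E j * Ps))"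
    by (rule dil.A.optimal_effect[OF A_effect dil.A.mu_nonzero opt]) simp
  show "(\<Sum>y<n. ent ?Q x y * v j y) = of_real (dil.A.q (real r) j) * v j x" if "x < n" "j < n" for x j
    by (rule frakQ_v[OF that(2,1)])
qed

end

section \<open>Tensor products as matrix products\<close>

lemma divmod_index: "y < b \<Longrightarrow> (x * b + y) div b = x" "y < b \<Longrightarrow> (x * b + y) mod b = y"
  for x y b :: nat
  by simp_all

lemma index_bound: "x < a \<Longrightarrow> y < b \<Longrightarrow> x * b + y < a * b" for x y a b :: nat
proof -
  assume "x < a" "y < b"
  then have "x * b + y < Suc x * b" by simp
  also have "\<dots> \<le> a * b" using \<open>x < a\<close> by (intro mult_le_mono1) simp
  finally show ?thesis .
qed

lemma index_split: "k < a * b \<Longrightarrow> k div b < a \<and> k mod b < b \<and> k = (k div b) * b + k mod b" for k a b :: nat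
  by (cases "b = 0") (auto simp: less_mult_imp_div_less)

lemma sum_index: "(\<Sum>k<a * b. f k) = (\<Sum>x<a. \<Sum>y<b. f (x * b + y))" for f :: "nat \<Rightarrow> 'a::comm_monoid_add"
proof -
  have "(\<Sum>x<a. \<Sum>y<b. f (x * b + y)) = (\<Sum>(x, y)\<in>{..<a} \<times> {..<b}. f (x * b + y))"
    by (rule sum.cartesian_product)
  also have "\<dots> = (\<Sum>k<a * b. f k)"
    by (rule sum.reindex_bij_witness[of _ "\<lambda>k. (k div b, k mod b)" "\<lambda>(x, y). x * b + y"])
      (auto simp: index_bound dest: index_split)
  finally show ?thesis ..
qed

text \<open>A vector of \<open>C^a \<otimes> C^b\<close> becomes an \<open>a \<times> b\<close> matrix, on which \<open>A \<otimes> B\<close> acts as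
  \<open>Z \<mapsto> A Z B\<^sup>T\<close>.\<close>

definition vec_mat :: "nat \<Rightarrow> nat \<Rightarrow> complex vec \<Rightarrow> fmat" where
  "vec_mat a b psi = fmat_of a b (\<lambda>x y. psi $ (x * b + y))"

lemma vec_mat_sized[simp]: "sized a b (vec_mat a b psi)" by (simp add: vec_mat_def)

lemma vec_mat_ent: "x < a \<Longrightarrow> y < b \<Longrightarrow> ent (vec_mat a b psi) x y = psi $ (x * b + y)"
  by (simp add: vec_mat_def fmat_of.rep_eq)

lemma vec_mat_cinner:
  assumes "v \<in> carrier_vec (a * b)"
  shows "cinner u v = tr (star (vec_mat a b u) * vec_mat a b v)"
proof -
  have "cinner u v = (\<Sum>x<a. \<Sum>y<b. cnj (u $ (x * b + y)) * v $ (x * b + y))"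
    using assms by (simp add: cinner_def sum_index)
  also have "\<dots> = (\<Sum>y<b. \<Sum>x<a. cnj (ent (vec_mat a b u) x y) * ent (vec_mat a b v) x y)"
    by (subst sum.swap) (simp add: vec_mat_ent)
  finally show ?thesis by (simp add: tr_star_times[OF vec_mat_sized])
qed

lemma ent_of_mat: "A \<in> carrier_mat m n \<Longrightarrow> i < m \<Longrightarrow> j < n \<Longrightarrow> ent (of_mat A) i j = A $$ (i, j)"
  by (simp add: of_mat_def fmat_of.rep_eq)

lemma kron_carrier: "A \<in> carrier_mat a c \<Longrightarrow> B \<in> carrier_mat b d \<Longrightarrow> kron A B \<in> carrier_mat (a * b) (c * d)"
  by (simp add: kron_def)

lemma kron_vec_index:
  assumes A: "A \<in> carrier_mat a c" and B: "B \<in> carrier_mat b d" and psi: "psi \<in> carrier_vec (c * d)"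
    and x: "x < a" and y: "y < b"
  shows "(kron A B *\<^sub>v psi) $ (x * b + y) = (\<Sum>s<c. \<Sum>t<d. A $$ (x, s) * B $$ (y, t) * psi $ (s * d + t))"
proof -
  have "x * b + y < a * b" by (rule index_bound[OF x y])
  then have "(kron A B *\<^sub>v psi) $ (x * b + y) = (\<Sum>k<c * d. kron A B $$ (x * b + y, k) * psi $ k)"
    using kron_carrier[OF A B] psi by (simp add: scalar_prod_def atLeast0LessThan)
  also have "\<dots> = (\<Sum>s<c. \<Sum>t<d. kron A B $$ (x * b + y, s * d + t) * psi $ (s * d + t))"
    by (rule sum_index)
  also have "\<dots> = (\<Sum>s<c. \<Sum>t<d. A $$ (x, s) * B $$ (y, t) * psi $ (s * d + t))"
    using A B x y by (intro sum.cong refl) (simp add: kron_def index_bound divmod_index)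
  finally show ?thesis .
qed

lemma vec_mat_kron:
  assumes A: "A \<in> carrier_mat a c" and B: "B \<in> carrier_mat b d" and psi: "psi \<in> carrier_vec (c * d)"
  shows "vec_mat a b (kron A B *\<^sub>v psi) = of_mat A * vec_mat c d psi * of_mat (transpose_mat B)"
proof (rule fmat_eqI)
  fix x y
  have bt: "sized d b (of_mat (transpose_mat B))" using B by simp
  have ib: "sized a b (of_mat A * vec_mat c d psi * of_mat (transpose_mat B))"
    by (rule sized_times[OF sized_times[OF sized_of_mat[OF A] vec_mat_sized] bt])
  show "ent (vec_mat a b (kron A B *\<^sub>v psi)) x y = ent (of_mat A * vec_mat c d psi * of_mat (transpose_mat B)) x y"
  proof (cases "x < a \<and> y < b")
    case True
    then have xy: "x < a" "y < b" by auto
    have "ent (of_mat A * vec_mat c d psi * of_mat (transpose_mat B)) x y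
        = (\<Sum>t<d. (\<Sum>s<c. ent (of_mat A) x s * ent (vec_mat c d psi) s t) * ent (of_mat (transpose_mat B)) t y)"
      by (simp add: ent_times[of d b _ "of_mat (transpose_mat B)"] ent_times[of a d "of_mat A * vec_mat c d psi"]
          ent_times[of a c "of_mat A"] sized_of_mat[OF A] sized_times[OF sized_of_mat[OF A] vec_mat_sized])
    also have "\<dots> = (\<Sum>t<d. \<Sum>s<c. A $$ (x, s) * B $$ (y, t) * psi $ (s * d + t))"
      using A B xy by (intro sum.cong refl)
        (simp add: ent_of_mat[OF A] ent_of_mat[of "transpose_mat B" d b] vec_mat_ent sum_distrib_right sum_distrib_left mult_ac)
    finally show ?thesis
      using kron_vec_index[OF A B psi xy] by (subst (asm) sum.swap) (simp add: vec_mat_ent xy)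
  next
    case False
    then show ?thesis using sized_ent[OF ib False] sized_ent[OF vec_mat_sized False] by simp
  qed
qed

lemma corr_vec_mat:
  assumes A: "M i a \<in> carrier_mat c c" and B: "N j b \<in> carrier_mat d d" and psi: "psi \<in> carrier_vec (c * d)"
  shows "corr psi M N a b i j = tr (star (vec_mat c d psi) * (of_mat (M i a) * vec_mat c d psi * of_mat (transpose_mat (N j b))))"
proof -
  have "kron (M i a) (N j b) *\<^sub>v psi \<in> carrier_vec (c * d)"
    using kron_carrier[OF A B] psi by simp
  then show ?thesis by (simp add: corr_def vec_mat_cinner vec_mat_kron[OF A B psi])
qed

text \<open>The transpose of a Hermitian matrix is its entrywise conjugate, and conjugation, unlike
  transposition, preserves the order of products.\<close>

lift_definition cnjm :: "fmat \<Rightarrow> fmat" is "\<lambda>f i j. cnj (f i j)" by auto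

lemma cnjm_sized: "sized m n A \<Longrightarrow> sized m n (cnjm A)" by (simp add: sized_def cnjm.rep_eq)
lemma cnjm_cnjm: "cnjm (cnjm A) = A" by transfer simp
lemma cnjm_diff: "cnjm (A - B) = cnjm A - cnjm B"
  by (rule fmat_eqI) (simp add: cnjm.rep_eq ent_simps)
lemma cnjm_star: "cnjm (star A) = star (cnjm A)" by transfer simp
lemma cnjm_idm: "cnjm (idm d) = idm d"
  by (rule fmat_eqI) (simp add: cnjm.rep_eq idm_def fmat_of.rep_eq)

lemma cnjm_times: "cnjm (A * B) = cnjm A * cnjm B"
proof (rule fmat_eqI)
  fix i j
  obtain d where "sized d d A" "sized d d B" using sized_ex2 by blast
  then show "ent (cnjm (A * B)) i j = ent (cnjm A * cnjm B) i j"
    by (simp add: ent_times[of d d] cnjm_sized cnjm.rep_eq)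
qed

lemma tr_cnjm: "tr (cnjm A) = cnj (tr A)"
proof -
  obtain d where "sized d d A" using sized_ex2 by blast
  then show ?thesis by (simp add: tr_eq[of d d] cnjm_sized cnjm.rep_eq)
qed

lemma of_mat_transpose: "of_mat (transpose_mat A) = cnjm (star (of_mat A))"
  by (rule fmat_eqI) (auto simp: of_mat_def cnjm.rep_eq star.rep_eq fmat_of.rep_eq)

lemma effect_cnjm: "effect d A \<Longrightarrow> effect d (cnjm A)"
proof -
  have psd: "psdF d (cnjm G)" if G: "psdF d G" for G
    unfolding psdF_def
  proof (intro conjI allI impI)
    show "star (cnjm G) = cnjm G" "sized d d (cnjm G)"
      using G by (simp_all add: psdF_def cnjm_star[symmetric] cnjm_sized)
    fix c Y assume "sized d c Y"
    then have "0 \<le> Re (tr (star (cnjm Y) * (G * cnjm Y)))"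
      using G cnjm_sized unfolding psdF_def by blast
    also have "star (cnjm Y) * (G * cnjm Y) = cnjm (star Y * (cnjm G * Y))"
      by (simp add: cnjm_times cnjm_star cnjm_cnjm)
    finally show "0 \<le> Re (tr (star Y * (cnjm G * Y)))" by (simp add: tr_cnjm)
  qed
  assume "effect d A"
  then show ?thesis using psd[of A] psd[of "idm d - A"] by (simp add: effect_def cnjm_diff cnjm_idm)
qed

lemma povm_two:
  assumes "povm d 2 E"
  shows "a < 2 \<Longrightarrow> E a \<in> carrier_mat d d" "of_mat (E 1) = idm d - of_mat (E 0)" "effect d (of_mat (E 0))"
proof -
  have p: "psd d (E a)" if "a < 2" for a using assms that by (simp add: povm_def)
  show "a < 2 \<Longrightarrow> E a \<in> carrier_mat d d" using p by (simp add: psd_of_mat)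
  have c: "E 0 \<in> carrier_mat d d" "E 1 \<in> carrier_mat d d" using p by (simp_all add: psd_of_mat)
  have s: "E 0 $$ (i, j) + E 1 $$ (i, j) = (if i = j then 1 else 0)" if "i < d" "j < d" for i j
    using assms that by (simp add: povm_def numeral_2_eq_2)
  show e1: "of_mat (E 1) = idm d - of_mat (E 0)"
  proof (rule fmat_eqI)
    fix i j
    show "ent (of_mat (E 1)) i j = ent (idm d - of_mat (E 0)) i j"
    proof (cases "i < d \<and> j < d")
      case True
      then show ?thesis using s[of i j] c
        by (simp add: ent_simps ent_of_mat[of _ d d] idm_def fmat_of.rep_eq) (metis add_diff_cancel_left' diff_0_eq_0 diff_0)
    next
      case False
      then show ?thesis using sized_ent[OF sized_of_mat[OF c(2)] False] sized_ent[OF sized_of_mat[OF c(1)] False]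
          sized_ent[OF sized_idm False] by (simp add: ent_simps)
    qed
  qed
  show "effect d (of_mat (E 0))" using p[of 0] p[of 1] e1 by (simp add: effect_def psd_of_mat)
qed

lemma povm_binmeas:
  assumes "F \<in> carrier_mat d d" "is_proj (of_mat F)"
  shows "povm d 2 (binmeas d F)"
proof -
  have e: "effect d (of_mat F)" using assms by (intro proj_effect) simp
  have c: "1\<^sub>m d - F \<in> carrier_mat d d" using assms(1) by (rule minus_carrier_mat)
  have "of_mat (1\<^sub>m d - F) = idm d - of_mat F" using assms(1) by (simp add: of_mat_minus[of _ d d] of_mat_one)
  then have "psd d (binmeas d F a)" for a
    using e assms(1) c by (simp add: binmeas_def psd_of_mat effect_def)
  moreover have "(\<Sum>a<2. binmeas d F a $$ (i, j)) = (if i = j then 1 else 0)" if "i < d" "j < d" for i j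
    using assms(1) that by (simp add: binmeas_def numeral_2_eq_2)
  ultimately show ?thesis by (simp add: povm_def)
qed

section \<open>The reference strategy and the extraction of a local dilation\<close>

context frakP begin

lemma vec_mat_phi: "vec_mat n n (phi n) = Phi"
proof (rule fmat_eqI)
  fix x y
  show "ent (vec_mat n n (phi n)) x y = ent Phi x y"
  proof (cases "x < n \<and> y < n")
    case True
    then show ?thesis
      by (simp add: vec_mat_ent phi_def index_bound divmod_index Phi_def ent_simps idm_def fmat_of.rep_eq)
  next
    case False
    then show ?thesis using sized_ent[OF vec_mat_sized False] sized_ent[OF sized_idm False]
      by (simp add: Phi_def ent_simps)
  qed
qed

lemma phi_carrier: "phi n \<in> carrier_vec (n * n)" by (simp add: phi_def)

lemma stratA_0: "i < 5 \<Longrightarrow> stratA n r P i 0 \<in> carrier_mat n n"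
    "i < 4 \<Longrightarrow> of_mat (stratA n r P i 0) = PM i"
    "of_mat (stratA n r P 4 0) = of_mat (frakQ n r P)"
  using cplx_P frakQ_of_mat(1) by (auto simp: stratA_def binmeas_def PM_def)

lemma stratB_0: "j < 4 \<Longrightarrow> stratB n P j 0 \<in> carrier_mat n n"
    "j < 4 \<Longrightarrow> of_mat (stratB n P j 0) = PM j"
  using cplx_P by (auto simp: stratB_def binmeas_def PM_def)

lemma povm_stratA: "i < 5 \<Longrightarrow> povm n 2 (stratA n r P i)"
  using cplx_P[of i] frakQ_of_mat(1) frakQ_proj PM_star[of i] PM_PM[of i]
  by (auto simp: stratA_def is_proj_def PM_def intro!: povm_binmeas)

lemma povm_stratB: "j < 4 \<Longrightarrow> povm n 2 (stratB n P j)"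
  using cplx_P[of j] PM_star[of j] PM_PM[of j]
  by (auto simp: stratB_def is_proj_def PM_def intro!: povm_binmeas)

lemma strategy_P: "strategy n n (phi n) 5 (\<lambda>_. 2) (stratA n r P) 4 (\<lambda>_. 2) (stratB n P)"
proof -
  have "cinner (phi n) (phi n) = 1"
    using tr_Psi by (simp add: vec_mat_cinner[OF phi_carrier] vec_mat_phi)
  then show ?thesis
    using phi_carrier povm_stratA povm_stratB by (simp add: strategy_def unit_vec_c_def)
qed

text \<open>The reference matrices are real and symmetric, so the transpose required for the second
  party leaves them unchanged.\<close>

lemma PM_cnjm: "i < 4 \<Longrightarrow> cnjm (PM i) = PM i"
proof (rule fmat_eqI)
  fix x y assume i: "i < 4"
  show "ent (cnjm (PM i)) x y = ent (PM i) x y"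
    using sized_ent[OF PM_sized[OF i], of x y] PM_ent[OF i, of x y]
    by (cases "x < n \<and> y < n") (auto simp: cnjm.rep_eq)
qed

lemma of_mat_stratB_transpose: "j < 4 \<Longrightarrow> of_mat (transpose_mat (stratB n P j 0)) = PM j"
  by (simp add: of_mat_transpose stratB_0 PM_star PM_cnjm)

lemma self_test_dilation:
  assumes strat: "strategy dA dB psi 5 (\<lambda>_. 2) M 4 (\<lambda>_. 2) N"
    and corr: "\<And>i j a b. i < 5 \<Longrightarrow> j < 4 \<Longrightarrow> a < 2 \<Longrightarrow> b < 2 \<Longrightarrow>
      corr psi M N a b i j = corr (phi n) (stratA n r P) (stratB n P) a b i j"
  shows "local_dilation n n (phi n) (stratA n r P) (stratB n P) 5 (\<lambda>_. 2) 4 (\<lambda>_. 2) dA dB psi M N"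
proof -
  have psi: "psi \<in> carrier_vec (dA * dB)" "cinner psi psi = 1"
    and povmM: "\<And>i. i < 5 \<Longrightarrow> povm dA 2 (M i)" and povmN: "\<And>j. j < 4 \<Longrightarrow> povm dB 2 (N j)"
    using strat by (auto simp: strategy_def unit_vec_c_def)
  define Ps where "Ps = vec_mat dA dB psi"
  define A where "A i = of_mat (M i 0)" for i
  define B where "B j = of_mat (transpose_mat (N j 0))" for j
  have cM: "M i a \<in> carrier_mat dA dA" if "i < 5" "a < 2" for i a
    using povm_two(1)[OF povmM[OF that(1)], of a] that by simp
  have cN: "N j b \<in> carrier_mat dB dB" if "j < 4" "b < 2" for j b
    using povm_two(1)[OF povmN[OF that(1)], of b] that by simp
  have cA: "stratA n r P i a \<in> carrier_mat n n" if "i < 5" "a < 2" for i a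
    using povm_two(1)[OF povm_stratA[OF that(1)]] that by simp
  have cB: "stratB n P j b \<in> carrier_mat n n" if "j < 4" "b < 2" for j b
    using povm_two(1)[OF povm_stratB[OF that(1)], of b] that by simp
  have transpose_one: "of_mat (transpose_mat (E 1)) = idm d - of_mat (transpose_mat (E 0))" if "povm d 2 E" for d E
    using povm_two(2)[OF that] by (simp add: of_mat_transpose cnjm_diff cnjm_idm star_diff)
  have M1: "of_mat (M i 1) = idm dA - A i" if "i < 5" for i using povm_two(2)[OF povmM[OF that]] by (simp add: A_def)
  have N1: "of_mat (transpose_mat (N j 1)) = idm dB - B j" if "j < 4" for j
    using transpose_one[OF povmN[OF that]] by (simp add: B_def)
  define A' where "A' i = of_mat (stratA n r P i 0)" for i
  have A': "A' i = (if i < 4 then PM i else of_mat (frakQ n r P))" if "i < 5" for i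
  proof (cases "i < 4")
    case False
    then have "i = 4" using that by simp
    then show ?thesis using stratA_0(3) by (simp add: A'_def)
  qed (simp add: A'_def stratA_0)
  have SA1: "of_mat (stratA n r P i 1) = idm n - A' i" if "i < 5" for i
    using povm_two(2)[OF povm_stratA[OF that]] by (simp add: A'_def)
  have SB1: "of_mat (transpose_mat (stratB n P j 1)) = idm n - PM j" if "j < 4" for j
    using transpose_one[OF povm_stratB[OF that]] of_mat_stratB_transpose[OF that] by simp
  have Psb: "sized dA dB Ps" by (simp add: Ps_def)
  have c: "tr (star Ps * (of_mat (M i a) * Ps * of_mat (transpose_mat (N j b))))
      = tr (star Phi * (of_mat (stratA n r P i a) * Phi * of_mat (transpose_mat (stratB n P j b))))"
    if "i < 5" "j < 4" "a < 2" "b < 2" for i j a b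
    using corr[OF that] corr_vec_mat[of M i a dA N j b dB psi, OF cM cN psi(1)]
      corr_vec_mat[of "stratA n r P" i a n "stratB n P" j b n "phi n", OF cA cB phi_carrier] that
    by (simp add: Ps_def vec_mat_phi)
  have c00: "tr (star Ps * (A i * Ps * B j)) = tr (star Phi * (A' i * Phi * PM j))" if "i < 5" "j < 4" for i j
    using c[OF that, of 0 0] by (simp add: A_def B_def A'_def of_mat_stratB_transpose[OF that(2)])
  have c01: "tr (star Ps * (A i * Ps * (idm dB - B j))) = tr (star Phi * (A' i * Phi * (idm n - PM j)))"
    if "i < 5" "j < 4" for i j
    using c[OF that, of 0 1] N1[OF that(2)] SB1[OF that(2)] by (simp add: A_def A'_def)
  have c10: "tr (star Ps * ((idm dA - A i) * Ps * B j)) = tr (star Phi * ((idm n - A' i) * Phi * PM j))"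
    if "i < 5" "j < 4" for i j
    using c[OF that, of 1 0] M1[OF that(1)] SA1[OF that(1)] by (simp add: B_def of_mat_stratB_transpose[OF that(2)])
  have Ab: "sized dA dA (A i)" if "i < 5" for i using cM[OF that] by (simp add: A_def)
  have A'b: "sized n n (A' i)" if "i < 5" for i using cA[OF that] by (simp add: A'_def)
  interpret matched n P dA dB r Ps A B
  proof
    show "sized dA dB Ps" by (rule Psb)
    show "tr (star Ps * Ps) = 1" using psi vec_mat_cinner[of psi dA dB psi] by (simp add: Ps_def)
    show "effect dA (A i)" if "i < 5" for i using povm_two(3)[OF povmM[OF that]] by (simp add: A_def)
    show "effect dB (B j)" if "j < 4" for j
    proof -
      have "effect dB (of_mat (N j 0))" by (rule povm_two(3)[OF povmN[OF that]])
      then show ?thesis using effect_cnjm[of dB "of_mat (N j 0)"] by (simp add: B_def of_mat_transpose effect_star)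
    qed
    show "tr (star Ps * (A i * Ps * B j)) = tr (star Phi * ((if i < 4 then PM i else of_mat (frakQ n r P)) * Phi * PM j))"
      if "i < 5" "j < 4" for i j
      using c00[OF that] A'[OF that(1)] by simp
    show "tr (star Ps * (A i * Ps)) = tr (star Phi * ((if i < 4 then PM i else of_mat (frakQ n r P)) * Phi))"
      if "i < 5" for i
    proof -
      \<comment> \<open>Adding both outcomes of one measurement of the second party gives the
        marginal.\<close>
      have "A i * Ps * idm dB = A i * Ps" by (rule idm_right[OF sized_times[OF Ab[OF that] Psb]])
      moreover have "A' i * Phi * idm n = A' i * Phi" by (rule idm_right[OF sized_times[OF A'b[OF that] Psi_sized]])
      ultimately have "tr (star Ps * (A i * Ps)) = tr (star Phi * (A' i * Phi))"
        using c00[OF that, of 0] c01[OF that, of 0] by (simp add: right_diff_distrib tr_diff)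
      then show ?thesis using A'[OF that] by simp
    qed
    show "tr (star Ps * (Ps * B j)) = tr (star Phi * (Phi * PM j))" if "j < 4" for j
      using c00[of 0 j] c10[of 0 j] that idm_left[OF Psb] idm_left[OF Psi_sized]
      by (simp add: right_diff_distrib left_diff_distrib tr_diff)
  qed
  have simA0: "dil.simA (A i) (ent (A' i))" if "i < 5" for i
    using sim_PM(1)[of i] sim_Q A'[OF that] that by (cases "i < 4") (auto simp: less_Suc_eq eval_nat_numeral)
  have simA: "dil.simA (of_mat (M i a)) (ent (of_mat (stratA n r P i a)))" if i: "i < 5" and a: "a < 2" for i a
  proof (cases "a = 0")
    case True
    then show ?thesis using simA0[OF i] by (simp add: A_def A'_def)
  next
    case False
    then have a1: "a = 1" using a by simp
    show ?thesis
      using dil.sim_diff(1)[OF dil.sim_one(1) simA0[OF i]] unfolding a1 M1[OF i] SA1[OF i] dil.simA_def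
      by (simp add: ent_simps idm_def fmat_of.rep_eq)
  qed
  have PB: "ent (PM j) y t = stratB n P j 0 $$ (y, t)" if "j < 4" "y < n" "t < n" for j y t
    using stratB_0(2)[OF that(1)] ent_of_mat[OF stratB_0(1)[OF that(1)] that(2,3)] by simp
  have simB: "dil.simB (of_mat (transpose_mat (N j b))) (\<lambda>y t. stratB n P j b $$ (y, t))" if j: "j < 4" and b: "b < 2" for j b
  proof (cases "b = 0")
    case True
    then show ?thesis using sim_PM(2)[OF j] PB[OF j] unfolding dil.simB_def by (simp add: B_def)
  next
    case False
    then have b1: "b = 1" using b by simp
    have "stratB n P j 1 $$ (y, t) = (if y = t then 1 else 0) - ent (PM j) y t" if "y < n" "t < n" for y t
      using that PB[OF j that] stratB_0(1)[OF j] by (simp add: stratB_def binmeas_def)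
    then show ?thesis
      using dil.sim_diff(2)[OF dil.sim_one(2) sim_PM(2)[OF j]] unfolding b1 N1[OF j] dil.simB_def by simp
  qed
  let ?G = "dil.A.e0 * Ps"
  \<comment> \<open>The auxiliary spaces are copies of \<open>C^dA\<close> and \<open>C^dB\<close>,
    large enough to contain ker \<open>S\<close> on each side. The factor \<open>sqrt n\<close>
    normalises, as \<open>tau e0 = 1/n\<close>.\<close>
  define aux where "aux = vec (dA * dB) (\<lambda>k. sqrt (real n) * ent ?G (k div dB) (k mod dB))"
  define UA where "UA = mat (n * dA) dA (\<lambda>(k, c). ent (dil.UA (k div dA)) (k mod dA) c)"
  define UB where "UB = mat (n * dB) dB (\<lambda>(k, c). ent (dil.VB (k div dB)) c (k mod dB))"
  have cUA: "UA \<in> carrier_mat (n * dA) dA" and cUB: "UB \<in> carrier_mat (n * dB) dB"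
    by (simp_all add: UA_def UB_def)
  have isoA: "isometry (n * dA) dA UA"
  proof -
    have "adj UA * UA = 1\<^sub>m dA"
    proof (rule eq_matI)
      fix s t assume "s < dim_row (1\<^sub>m dA)" "t < dim_col (1\<^sub>m dA)"
      then have st: "s < dA" "t < dA" by auto
      have "(adj UA * UA) $$ (s, t) = (\<Sum>k<n * dA. cnj (UA $$ (k, s)) * UA $$ (k, t))"
        using cUA st by (simp add: scalar_prod_def adj_def atLeast0LessThan)
      also have "\<dots> = (\<Sum>x<n. \<Sum>k<dA. cnj (ent (dil.UA x) k s) * ent (dil.UA x) k t)"
        unfolding sum_index using st by (intro sum.cong refl) (simp add: UA_def index_bound divmod_index)
      also have "\<dots> = ent (\<Sum>x<n. star (dil.UA x) * dil.UA x) s t"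
        by (simp add: ent_sum ent_times[of dA dA] dil.UA_sized star.rep_eq)
      finally show "(adj UA * UA) $$ (s, t) = 1\<^sub>m dA $$ (s, t)"
        using st by (simp add: dil.UA_UA idm_def fmat_of.rep_eq)
    qed (use cUA in \<open>auto simp: adj_def\<close>)
    then show ?thesis using cUA by (simp add: isometry_def)
  qed
  have isoB: "isometry (n * dB) dB UB"
  proof -
    have "adj UB * UB = 1\<^sub>m dB"
    proof (rule eq_matI)
      fix s t assume "s < dim_row (1\<^sub>m dB)" "t < dim_col (1\<^sub>m dB)"
      then have st: "s < dB" "t < dB" by auto
      have "(adj UB * UB) $$ (s, t) = (\<Sum>k<n * dB. cnj (UB $$ (k, s)) * UB $$ (k, t))"
        using cUB st by (simp add: scalar_prod_def adj_def atLeast0LessThan)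
      also have "\<dots> = (\<Sum>x<n. \<Sum>k<dB. ent (dil.VB x) t k * cnj (ent (dil.VB x) s k))"
      proof -
        have "UB $$ (x * dB + k, c) = ent (dil.VB x) c k" if "x < n" "k < dB" "c < dB" for x k c
          using that by (simp add: UB_def index_bound divmod_index)
        then show ?thesis unfolding sum_index using st by (intro sum.cong refl) (simp add: mult.commute)
      qed
      also have "\<dots> = ent (\<Sum>x<n. dil.VB x * star (dil.VB x)) t s"
        by (simp add: ent_sum ent_times[of dB dB] dil.VB_sized star.rep_eq)
      finally show "(adj UB * UB) $$ (s, t) = 1\<^sub>m dB $$ (s, t)"
        using st by (simp add: dil.VB_VB idm_def fmat_of.rep_eq)
    qed (use cUB in \<open>auto simp: adj_def\<close>)
    then show ?thesis using cUB by (simp add: isometry_def)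
  qed
  have Gb: "sized dA dB ?G" by (rule sized_times[OF dil.A.e0_sized Psb])
  have vmaux: "vec_mat dA dB aux = sqrt (real n) *\<^sub>R ?G"
  proof (rule fmat_eqI)
    fix x y
    show "ent (vec_mat dA dB aux) x y = ent (sqrt (real n) *\<^sub>R ?G) x y"
      using sized_ent[OF vec_mat_sized, of x dA y dB aux] sized_ent[OF Gb, of x y]
      by (cases "x < dA \<and> y < dB") (auto simp: vec_mat_ent aux_def index_bound divmod_index ent_simps)
  qed
  have auxc: "aux \<in> carrier_vec (dA * dB)" by (simp add: aux_def)
  have "cinner aux aux = of_nat n * tr (star ?G * ?G)"
    by (simp add: vec_mat_cinner[OF auxc] vmaux star_scaleR tr_scaleR of_real_mult[symmetric] del: of_real_mult)
  also have "tr (star ?G * ?G) = dil.A.tau dil.A.e0"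
    using dil.A.tau_nrm2[of dil.A.e0] by (simp add: tr_star_self dil.A.e0_star dil.A.e0_e0)
  also have "of_nat n * \<dots> = 1" using n1 by (simp add: dil.A.rigidity(1))
  finally have aux1: "unit_vec_c (dA * dB) aux" using auxc by (simp add: unit_vec_c_def)
  have main: "(kron UA UB *\<^sub>v (kron (M i a) (N j b) *\<^sub>v psi)) $ ((x * dA + k) * (n * dB) + (y * dB + l))
      = (kron (stratA n r P i a) (stratB n P j b) *\<^sub>v phi n) $ (x * n + y) * aux $ (k * dB + l)"
    if i: "i < 5" and j: "j < 4" and a: "a < 2" and b: "b < 2"
      and x: "x < n" and k: "k < dA" and y: "y < n" and l: "l < dB" for i j a b x k y l
  proof -
    let ?w = "kron (M i a) (N j b) *\<^sub>v psi"
    let ?Z = "of_mat (M i a) * Ps * of_mat (transpose_mat (N j b))"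
    let ?s = "\<Sum>t<n. ent (of_mat (stratA n r P i a)) x t * stratB n P j b $$ (y, t)"
    have wc: "?w \<in> carrier_vec (dA * dB)" using kron_carrier[OF cM[OF i a] cN[OF j b]] psi by simp
    have w: "?w $ (p * dB + q) = ent ?Z p q" if "p < dA" "q < dB" for p q
      using vec_mat_kron[OF cM[OF i a] cN[OF j b] psi(1)] vec_mat_ent[OF that, of ?w] by (simp add: Ps_def)
    have Zb: "sized dA dB ?Z" unfolding vec_mat_kron[OF cM[OF i a] cN[OF j b] psi(1), folded Ps_def, symmetric] by simp
    have "(kron UA UB *\<^sub>v ?w) $ ((x * dA + k) * (n * dB) + (y * dB + l))
        = (\<Sum>p<dA. \<Sum>q<dB. UA $$ (x * dA + k, p) * UB $$ (y * dB + l, q) * ?w $ (p * dB + q))"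
      by (rule kron_vec_index[OF cUA cUB wc index_bound[OF x k] index_bound[OF y l]])
    also have "\<dots> = (\<Sum>p<dA. \<Sum>q<dB. ent (dil.UA x) k p * ent ?Z p q * ent (dil.VB y) q l)"
      using x y k l by (intro sum.cong refl) (simp add: UA_def UB_def index_bound divmod_index w)
    also have "\<dots> = (\<Sum>q<dB. \<Sum>p<dA. ent (dil.UA x) k p * ent ?Z p q * ent (dil.VB y) q l)"
      by (rule sum.swap)
    also have "\<dots> = ent (dil.UA x * ?Z * dil.VB y) k l"
      unfolding ent_times[OF disjI2[OF dil.VB_sized]] ent_times[OF disjI1[OF dil.UA_sized]] sum_distrib_right ..
    also have "dil.UA x * ?Z * dil.VB y = scaleC ?s ?G"
      by (rule dil.dilation_identity[OF simA[OF i a] simB[OF j b] x y])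
    also have "ent (scaleC ?s ?G) k l = ?s / sqrt (real n) * aux $ (k * dB + l)"
      using n1 k l by (simp add: scaleC.rep_eq aux_def index_bound divmod_index)
    also have "?s / sqrt (real n) = (kron (stratA n r P i a) (stratB n P j b) *\<^sub>v phi n) $ (x * n + y)"
    proof -
      note cA' = cA[OF i a] and cB' = cB[OF j b]
      have "(kron (stratA n r P i a) (stratB n P j b) *\<^sub>v phi n) $ (x * n + y)
          = ent (of_mat (stratA n r P i a) * Phi * of_mat (transpose_mat (stratB n P j b))) x y"
        using vec_mat_kron[OF cA' cB' phi_carrier] vec_mat_ent[OF x y] by (metis vec_mat_phi)
      also have "\<dots> = (1 / sqrt (real n)) * ent (of_mat (stratA n r P i a) * of_mat (transpose_mat (stratB n P j b))) x y"
        by (simp add: Phi_simps(4)[OF sized_of_mat[OF cA']] ent_simps)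
      also have "ent (of_mat (stratA n r P i a) * of_mat (transpose_mat (stratB n P j b))) x y = ?s"
        unfolding ent_times[OF disjI1[OF sized_of_mat[OF cA']]]
        using cB' y by (intro sum.cong refl) (simp add: ent_of_mat[of "transpose_mat (stratB n P j b)" n n])
      finally show ?thesis by simp
    qed
    finally show ?thesis .
  qed
  show ?thesis
    unfolding local_dilation_def Let_def
    by (intro exI[of _ dA] exI[of _ dB] exI[of _ aux] exI[of _ UA] exI[of _ UB] conjI aux1 isoA isoB allI impI main)
qed

end

theorem theorem5p10:
  fixes n r :: nat and P :: "nat \<Rightarrow> real mat"
  assumes "r < n"
    and "frakP_quad n P"
  shows "self_tested n n (phi n) 5 (\<lambda>_. 2) (stratA n r P) 4 (\<lambda>_. 2) (stratB n P)"
proof -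
  interpret frakP n P using assms by unfold_locales auto
  show ?thesis
    unfolding self_tested_def using strategy_P self_test_dilation by blast
qed

end
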